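(* Let $\mathbb{F}$ be a function field of one variable over a finite field $\mathbb{K}=\mathbb{F}_q$ with $q$ elements, and let $\zeta_{\mathbb{F}}(s)$ be its zeta-function, viewed as a meromorphic function of $s$ on $\mathbb{C}$. Then both the order and the lower order of $\zeta_{\mathbb{F}}$ are equal to $1$.
   Context: Zeta-function. $\mathbb{K}$ is a finite field with $q$ elements; $\mathbb{F}$ is a function field of one variable over $\mathbb{K}$ (a finitely generated extension of $\mathbb{K}$ of transcendence degree $1$, equivalently the function field of a smooth, irreducible, projective algebraic curve over $\mathbb{K}$), with $\mathbb{K}$ as its full constant field, and $g$ denotes its genus. For $\Re s>1$, $$\zeta_{\mathbb{F}}(s)=\sum_{\alpha}\frac{1}{|\alpha|^{s}}=\prod_{p}\left(1-\frac{1}{|p|^{s}}\right)^{-1},$$ where $\alpha$ ranges over the positive (effective) divisors, $p$ over the prime divisors, and $|\alpha|=q^{\deg\alpha}$ is the absolute norm. With $u=q^{-s}$ one has $\zeta_{\mathbb{F}}(s)=Z(u)=\dfrac{L(u)}{(1-qu)(1-u)}$, where $L$ is a polynomial of degree $2g$ with $L(0)=1$; this defines the meromorphic continuation of $\zeta_{\mathbb{F}}$ to $\mathbb{C}$. Nevanlinna theory. For $f$ meromorphic on $\mathbb{C}$, let $m(r,f)=\frac{1}{2\pi}\int_0^{2\pi}\log^+|f(re^{i\theta})|\,d\theta$; let $n(t,f)$ be the number of poles of $f$ in $|s|\le t$ counted with multiplicity, $N(r,f)=\int_0^r\frac{n(t,f)-n(0,f)}{t}\,dt+n(0,f)\log r$,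 and $T(r,f)=m(r,f)+N(r,f)$. The order of $f$ is $\rho=\limsup_{r\to\infty}\frac{\log T(r,f)}{\log r}$ and the lower order is $\underline{\rho}=\liminf_{r\to\infty}\frac{\log T(r,f)}{\log r}$. *)

theory Defs
  imports
    "HOL-Complex_Analysis.Complex_Analysis"
    "HOL-Algebra.Algebraic_Closure_Type"
    "HOL-Algebra.Generated_Fields"
begin

section \<open>Function fields of one variable\<close>

abbreviation field_ring :: "'a::field ring" where
  "field_ring \<equiv> ring_of_type_algebra"

text \<open>
  The type \<open>'a\<close> is the function field and \<open>K\<close> its field of constants. The conjuncts after
  the first say: finitely generated over \<open>K\<close>; transcendence degree one, with \<open>{x}\<close> a transcendence
  basis; and \<open>K\<close> algebraically closed in \<open>'a\<close> (full constant field).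
\<close>

definition function_field :: "'a::field set \<Rightarrow> bool" where
  "function_field K \<longleftrightarrow>
     subfield K field_ring \<and>
     (\<exists>S. finite S \<and> generate_field field_ring (K \<union> S) = UNIV) \<and>
     (\<exists>x. ring.transcendental field_ring K x \<and>
          (\<forall>y. ring.algebraic field_ring (generate_field field_ring (K \<union> {x})) y)) \<and>
     (\<forall>y. ring.algebraic field_ring K y \<longrightarrow> y \<in> K)"


section \<open>Prime divisors and positive divisors\<close>

text \<open>A prime divisor is represented by its valuation ring.\<close>

definition prime_divisors :: "'a::field set \<Rightarrow> 'a set set" where
  "prime_divisors K =
     {R. subring R field_ring \<and> K \<subset> R \<and> R \<subset> UNIV \<and> (\<forall>z. z \<in> R \<or> inverse z \<in> R)}"

definition maximal_ideal_of :: "'a::field set \<Rightarrow> 'a set" where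
  "maximal_ideal_of R = R - Units (field_ring\<lparr>carrier := R\<rparr>)"

definition residue_field :: "'a::field set \<Rightarrow> 'a set ring" where
  "residue_field R = field_ring\<lparr>carrier := R\<rparr> Quot maximal_ideal_of R"

definition prime_degree :: "'a::field set \<Rightarrow> 'a set \<Rightarrow> nat" where
  "prime_degree K R =
     ring.dim (residue_field R)
       ((\<lambda>a. maximal_ideal_of R +>\<^bsub>field_ring\<lparr>carrier := R\<rparr>\<^esub> a) ` K)
       (carrier (residue_field R))"

text \<open>
  A positive divisor is a finite formal sum of prime divisors with coefficients in the natural
  numbers, that is, a finite multiset of prime divisors (the zero divisor included).
\<close>

definition positive_divisors :: "'a::field set \<Rightarrow> 'a set multiset set" where
  "positive_divisors K = {D. set_mset D \<subseteq> prime_divisors K}"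

definition divisor_degree :: "'a::field set \<Rightarrow> 'a set multiset \<Rightarrow> nat" where
  "divisor_degree K D = (\<Sum>R\<in>#D. prime_degree K R)"

definition absolute_norm :: "'a::field set \<Rightarrow> 'a set multiset \<Rightarrow> nat" where
  "absolute_norm K D = card K ^ divisor_degree K D"


section \<open>The zeta-function\<close>

definition zeta_series :: "'a::field set \<Rightarrow> complex \<Rightarrow> complex" where
  "zeta_series K s = (\<Sum>\<^sub>\<infinity>D\<in>positive_divisors K. 1 / of_nat (absolute_norm K D) powr s)"

text \<open>
  The meromorphic continuation of the series to the whole plane. Requiring the function to be
  \<^emph>\<open>nicely\<close> meromorphic (no removable singularities, value 0 at poles) makes it unique as a total
  function.
\<close>

definition zeta :: "'a::field set \<Rightarrow> complex \<Rightarrow> complex" where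
  "zeta K = (THE f. f nicely_meromorphic_on UNIV \<and> (\<forall>s. Re s > 1 \<longrightarrow> f s = zeta_series K s))"


section \<open>Nevanlinna theory\<close>

text \<open>Since \<open>ln 0 = 0\<close> for the reals, \<open>ln_plus 0 = 0\<close>, as it should be.\<close>

definition ln_plus :: "real \<Rightarrow> real" where
  "ln_plus x = max 0 (ln x)"

definition proximity :: "real \<Rightarrow> (complex \<Rightarrow> complex) \<Rightarrow> real" where
  "proximity r f =
     1 / (2 * pi) * integral {0..2 * pi} (\<lambda>\<theta>. ln_plus (norm (f (of_real r * exp (\<i> * of_real \<theta>)))))"

definition pole_count :: "real \<Rightarrow> (complex \<Rightarrow> complex) \<Rightarrow> nat" where
  "pole_count t f = (\<Sum>z | norm z \<le> t \<and> is_pole f z. nat (- zorder f z))"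

definition integrated_pole_count :: "real \<Rightarrow> (complex \<Rightarrow> complex) \<Rightarrow> real" where
  "integrated_pole_count r f =
     integral {0..r} (\<lambda>t. (real (pole_count t f) - real (pole_count 0 f)) / t)
     + real (pole_count 0 f) * ln r"

definition nevanlinna_characteristic :: "real \<Rightarrow> (complex \<Rightarrow> complex) \<Rightarrow> real" where
  "nevanlinna_characteristic r f = proximity r f + integrated_pole_count r f"

definition nevanlinna_order :: "(complex \<Rightarrow> complex) \<Rightarrow> ereal" where
  "nevanlinna_order f =
     Limsup at_top (\<lambda>r::real. ereal (ln (nevanlinna_characteristic r f) / ln r))"

definition nevanlinna_lower_order :: "(complex \<Rightarrow> complex) \<Rightarrow> ereal" where
  "nevanlinna_lower_order f =
     Liminf at_top (\<lambda>r::real. ereal (ln (nevanlinna_characteristic r f) / ln r))"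

end

theory Submission
  imports Defs "HOL-Library.Poly_Mapping" "HOL-Real_Asymp.Real_Asymp"
begin

text \<open>
  With \<open>u = q\<^sup>-\<^sup>s\<close> the zeta-function is the generating series of the numbers \<open>A\<^sub>n\<close> of positive divisors of
  degree \<open>n\<close>. A divisor class of large degree \<open>n\<close> contains \<open>(q\<^sup>n\<^sup>-\<^sup>G - 1) / (q - 1)\<close> positive divisors by
  Riemann's theorem, and translation by the divisor of poles of a function, of degree \<open>m\<close> say, shows that
  the number of classes of degree \<open>n\<close> is \<open>m\<close>-periodic in \<open>n\<close>. Hence the zeta-function is a rational function
  of \<open>u\<close> with denominator \<open>(1 - u\<^sup>m) (1 - (q u)\<^sup>m)\<close> and a pole at \<open>s = 1\<close>. Since it is periodic in \<open>s\<close>, its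
  counting function of poles has at least linear growth and is \<open>O(r log r)\<close>, while its proximity function is
  \<open>O(r)\<close>: the denominators are at least \<open>\<bar>1 - \<bar>u\<bar>\<^sup>m\<bar>\<close> and \<open>\<bar>1 - \<bar>q u\<bar>\<^sup>m\<bar>\<close> in modulus, which
  depend only on \<open>Re s\<close> and have logarithms integrable along circles. Because \<open>K\<close> is finite, all
  dimensions over \<open>K\<close> are handled as cardinalities.
\<close>

hide_const (open) module.smult up_ring.coeff up_ring.monom Polynomials.degree Polynomials.lead_coeff

section \<open>Relative independence over the constant field\<close>

text \<open>The degree theory rests on one integer, the degree m of the function field over
  \<open>K(y)\<close>, squeezed from both sides. Reduction modulo y shows that the zeros of y have
  total degree at most m; counting products of powers of y with m independent elements shows that
  its poles have total degree at least m. The same bounds for the inverse of y close the circle: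
  zeros and poles both have degree m, principal divisors have degree 0, and Riemann's theorem
  follows by comparing an arbitrary divisor with multiples of one pole divisor. The obstacle on the
  analytic side is cancellation: the numerator of the rational function is not known explicitly, so
  a zero of the denominator may fail to be a pole. Hence only two facts about poles are used. All
  lie in two vertical progressions, and s = 1 is one of them, because the numerator there is, up to
  a positive factor, a sum of class numbers over a full period. Periodicity in s turns this single
  pole into linearly many, and a factor log r in the upper bound disappears in the quotient of
  logarithms that defines the order.\<close>

definition polys_over :: "'a::field set \<Rightarrow> 'a poly set" where
  "polys_over K = {p. \<forall>i. coeff p i \<in> K}"

text \<open>For y transcendental over K this says that the function field has degree less than n
  over \<open>K(y)\<close>. The coefficients are taken in \<open>K[y]\<close>, denominators being
  cleared once and for all.\<close>

definition all_dependent :: "'a::field set \<Rightarrow> 'a \<Rightarrow> nat \<Rightarrow> bool" where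
  "all_dependent K y n \<longleftrightarrow> (\<forall>us::nat \<Rightarrow> 'a. \<exists>p. (\<forall>i<n. p i \<in> polys_over K) \<and> (\<exists>i<n. p i \<noteq> 0) \<and>
     (\<Sum>i<n. poly (p i) y * us i) = 0)"

text \<open>A relation over \<open>K[y]\<close> all of whose constant terms vanish can be divided by
  y, which lowers the total degree. The surviving constant term makes the reduction modulo y a
  nontrivial relation over K.\<close>

lemma all_dependentE:
  assumes "all_dependent K y n" "y \<noteq> 0"
  obtains p where "\<And>i. i < n \<Longrightarrow> p i \<in> polys_over K" "\<exists>i<n. coeff (p i) 0 \<noteq> 0"
    "(\<Sum>i<n. poly (p i) y * us i) = 0"
proof -
  have "\<exists>p. (\<forall>i<n. p i \<in> polys_over K) \<and> (\<exists>i<n. coeff (p i) 0 \<noteq> 0) \<and> (\<Sum>i<n. poly (p i) y * us i) = 0"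
    if "\<forall>i<n. p i \<in> polys_over K" "\<exists>i<n. p i \<noteq> 0" "(\<Sum>i<n. poly (p i) y * us i) = 0" for p
    using that
  proof (induction "\<Sum>i<n. degree (p i)" arbitrary: p rule: less_induct)
    case less
    show ?case
    proof (cases "\<exists>i<n. coeff (p i) 0 \<noteq> 0")
      case True
      then show ?thesis using less.prems by blast
    next
      case False
      define p' where "p' i = poly_shift 1 (p i)" for i
      have p: "p i = pCons 0 (p' i)" if "i < n" for i
        using False that by (intro poly_eqI) (auto simp: p'_def coeff_poly_shift coeff_pCons split: nat.splits)
      have deg: "degree (p' i) \<le> degree (p i)" if "i < n" for i
        using p[OF that] by (cases "p' i = 0") auto
      obtain j where j: "j < n" "p j \<noteq> 0" using less.prems by blast
      then have degj: "degree (p' j) < degree (p j)"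
        using p[OF j(1)] by (auto split: if_splits)
      have "(\<Sum>i<n. degree (p' i)) < (\<Sum>i<n. degree (p i))"
        using deg degj j(1) by (intro sum_strict_mono_ex1) auto
      moreover have "\<forall>i<n. p' i \<in> polys_over K"
        using less.prems(1) by (auto simp: p'_def coeff_poly_shift polys_over_def)
      moreover have "\<exists>i<n. p' i \<noteq> 0" using j p by force
      moreover have "(\<Sum>i<n. poly (p' i) y * us i) = 0"
      proof -
        have "y * (\<Sum>i<n. poly (p' i) y * us i) = (\<Sum>i<n. poly (p i) y * us i)"
          by (simp add: sum_distrib_left p mult_ac)
        then show ?thesis using less.prems(3) assms(2) by simp
      qed
      ultimately show ?thesis using less.hyps[of p'] by simp
    qed
  qed
  note * = this
  from assms(1) have "\<exists>p. (\<forall>i<n. p i \<in> polys_over K) \<and> (\<exists>i<n. p i \<noteq> 0) \<and> (\<Sum>i<n. poly (p i) y * us i) = 0"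
    unfolding all_dependent_def by (rule spec)
  then have "\<exists>p. (\<forall>i<n. p i \<in> polys_over K) \<and> (\<exists>i<n. coeff (p i) 0 \<noteq> 0) \<and> (\<Sum>i<n. poly (p i) y * us i) = 0"
  proof (rule exE)
    fix p assume "(\<forall>i<n. p i \<in> polys_over K) \<and> (\<exists>i<n. p i \<noteq> 0) \<and> (\<Sum>i<n. poly (p i) y * us i) = 0"
    then show ?thesis by (intro *[of p]) blast+
  qed
  then obtain p where p: "(\<forall>i<n. p i \<in> polys_over K) \<and> (\<exists>i<n. coeff (p i) 0 \<noteq> 0) \<and> (\<Sum>i<n. poly (p i) y * us i) = 0"
    by (rule exE)
  show ?thesis by (rule that[of p]) (use p in auto)
qed

lemma sum_mem:
  fixes S :: "'a::comm_monoid_add set"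
  assumes S: "0 \<in> S" "\<And>a b. a \<in> S \<Longrightarrow> b \<in> S \<Longrightarrow> a + b \<in> S" and "\<And>i. i \<in> I \<Longrightarrow> f i \<in> S"
  shows "sum f I \<in> S"
  using assms(3) by (induction I rule: infinite_finite_induct) (auto intro: S)

text \<open>The interface between the algebraic definition of a function field and elementary
  arithmetic: \<open>transcendental\<close> expresses that K is the full constant field, and
  \<open>ex_all_dependent\<close> that the function field is finite over \<open>K(y)\<close> for
  every y outside K.\<close>

locale function_field_const =
  fixes K :: "'a::field set"
  assumes zero_K: "0 \<in> K" and one_K: "1 \<in> K"
    and add_K: "\<And>a b. a \<in> K \<Longrightarrow> b \<in> K \<Longrightarrow> a + b \<in> K"
    and mult_K: "\<And>a b. a \<in> K \<Longrightarrow> b \<in> K \<Longrightarrow> a * b \<in> K"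
    and uminus_K: "\<And>a. a \<in> K \<Longrightarrow> - a \<in> K"
    and inverse_K: "\<And>a. a \<in> K \<Longrightarrow> inverse a \<in> K"
    and finite_K: "finite K"
    and transcendental: "\<And>y p. y \<notin> K \<Longrightarrow> p \<in> polys_over K \<Longrightarrow> p \<noteq> 0 \<Longrightarrow> poly p y \<noteq> 0"
    and ex_all_dependent: "\<And>y. y \<notin> K \<Longrightarrow> \<exists>n. all_dependent K y n"
    and K_ne_UNIV: "K \<noteq> UNIV"
begin

lemma diff_K: "a \<in> K \<Longrightarrow> b \<in> K \<Longrightarrow> a - b \<in> K"
  using add_K[of a "- b"] uminus_K by simp

lemma divide_K: "a \<in> K \<Longrightarrow> b \<in> K \<Longrightarrow> a / b \<in> K"
  using mult_K[of a "inverse b"] inverse_K by (simp add: field_simps)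

abbreviation q :: nat where "q \<equiv> card K"

lemma q_ge_2: "q \<ge> 2"
proof -
  have "card {0, 1::'a} \<le> card K" using zero_K one_K by (intro card_mono finite_K) auto
  then show ?thesis by simp
qed

definition ksubspace :: "'a set \<Rightarrow> bool" where
  "ksubspace S \<longleftrightarrow> 0 \<in> S \<and> (\<forall>a\<in>S. \<forall>b\<in>S. a + b \<in> S) \<and> (\<forall>c\<in>K. \<forall>a\<in>S. c * a \<in> S)"

lemma
  assumes "ksubspace S"
  shows ksubspace_0: "0 \<in> S"
    and ksubspace_add: "a \<in> S \<Longrightarrow> b \<in> S \<Longrightarrow> a + b \<in> S"
    and ksubspace_mult: "c \<in> K \<Longrightarrow> a \<in> S \<Longrightarrow> c * a \<in> S"
  using assms by (auto simp: ksubspace_def)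

lemma ksubspace_uminus: "ksubspace S \<Longrightarrow> a \<in> S \<Longrightarrow> - a \<in> S"
  using ksubspace_mult[of S "- 1" a] uminus_K one_K by simp

lemma ksubspace_diff: "ksubspace S \<Longrightarrow> a \<in> S \<Longrightarrow> b \<in> S \<Longrightarrow> a - b \<in> S"
  using ksubspace_add[of S a "- b"] ksubspace_uminus[of S b] by simp

lemma ksubspace_sum: "ksubspace S \<Longrightarrow> (\<And>i. i \<in> I \<Longrightarrow> f i \<in> S) \<Longrightarrow> sum f I \<in> S"
  by (intro sum_mem ksubspace_0 ksubspace_add)

lemma poly_mult_mem:
  assumes S: "ksubspace S" and y: "\<And>a. a \<in> S \<Longrightarrow> y * a \<in> S" and "p \<in> polys_over K" "a \<in> S"
  shows "poly p y * a \<in> S"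
  using assms(3)
proof (induction p)
  case 0
  then show ?case using ksubspace_0[OF S] by simp
next
  case (pCons c p)
  have "p \<in> polys_over K"
    unfolding polys_over_def
  proof safe
    fix i
    have "coeff (pCons c p) (Suc i) \<in> K" using pCons.prems unfolding polys_over_def by blast
    then show "coeff p i \<in> K" by simp
  qed
  moreover have "coeff (pCons c p) 0 \<in> K" using pCons.prems unfolding polys_over_def by blast
  then have "c \<in> K" by simp
  ultimately have "c * a + y * (poly p y * a) \<in> S"
    by (intro ksubspace_add[OF S] ksubspace_mult[OF S] y pCons.IH \<open>a \<in> S\<close>)
  then show ?case by (simp add: algebra_simps)
qed

text \<open>Linear independence over K of the classes of the \<open>us i\<close> modulo H.\<close>

definition rel_independent :: "'a set \<Rightarrow> 'a set \<Rightarrow> nat \<Rightarrow> (nat \<Rightarrow> 'a) \<Rightarrow> bool" where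
  "rel_independent H S k us \<longleftrightarrow> (\<forall>i<k. us i \<in> S) \<and> (\<forall>c. (\<forall>i<k. c i \<in> K) \<longrightarrow>
    (\<Sum>i<k. c i * us i) \<in> H \<longrightarrow> (\<forall>i<k. c i = 0))"

text \<open>A longest independent family spans S modulo H. Its length k is the least number for
  which no independent family of length k + 1 exists; minimality supplies a family of length
  k.\<close>

lemma rel_basis:
  assumes H: "ksubspace H" and bound: "\<And>us. \<not> rel_independent H S (Suc m) us"
  obtains k us where "k \<le> m" "rel_independent H S k us"
    "\<And>s. s \<in> S \<Longrightarrow> \<exists>c\<in>({..<k} \<rightarrow>\<^sub>E K). s - (\<Sum>i<k. c i * us i) \<in> H"
proof -
  have "rel_independent H S 0 us" for us by (simp add: rel_independent_def)
  then have ex: "\<exists>us. rel_independent H S 0 us" by blast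
  define k where "k = (LEAST k. \<not> (\<exists>us. rel_independent H S (Suc k) us))"
  have k: "\<not> (\<exists>us. rel_independent H S (Suc k) us)"
    unfolding k_def by (rule LeastI[of _ m]) (use bound in blast)
  have km: "k \<le> m" unfolding k_def by (rule Least_le) (use bound in blast)
  have "\<exists>us. rel_independent H S k us"
  proof (cases k)
    case 0
    then show ?thesis using ex by simp
  next
    case (Suc k')
    then have "\<not> \<not> (\<exists>us. rel_independent H S (Suc k') us)"
      using not_less_Least[of k' "\<lambda>k. \<not> (\<exists>us. rel_independent H S (Suc k) us)"] unfolding k_def by simp
    then show ?thesis using Suc by simp
  qed
  then obtain us where us: "rel_independent H S k us" by blast
  have "\<exists>c\<in>({..<k} \<rightarrow>\<^sub>E K). s - (\<Sum>i<k. c i * us i) \<in> H" if s: "s \<in> S" for s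
  proof -
    \<comment> \<open>Appending s at position k destroys independence; in the resulting relation the
      coefficient of s is nonzero, and the relation can be solved for s.\<close>
    have "\<not> rel_independent H S (Suc k) (us(k := s))" using k by blast
    then obtain c where c: "\<forall>i<Suc k. c i \<in> K" "(\<Sum>i<Suc k. c i * (us(k := s)) i) \<in> H" "\<exists>i<Suc k. c i \<noteq> 0"
      using us s unfolding rel_independent_def by (auto simp: less_Suc_eq)
    have sum: "(\<Sum>i<Suc k. c i * (us(k := s)) i) = (\<Sum>i<k. c i * us i) + c k * s"
      by simp
    have ck: "c k \<noteq> 0"
    proof
      assume "c k = 0"
      then have "(\<Sum>i<k. c i * us i) \<in> H" using c(2) sum by simp
      then have "\<forall>i<k. c i = 0" using us c(1) unfolding rel_independent_def by auto
      then show False using c(3) \<open>c k = 0\<close> by (auto simp: less_Suc_eq)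
    qed
    define d where "d = (\<lambda>i\<in>{..<k}. - c i / c k)"
    have "d \<in> {..<k} \<rightarrow>\<^sub>E K" using c(1) by (auto simp: d_def intro!: divide_K uminus_K)
    moreover have "s - (\<Sum>i<k. d i * us i) = inverse (c k) * (\<Sum>i<Suc k. c i * (us(k := s)) i)"
    proof -
      have "(\<Sum>i<k. d i * us i) = - (\<Sum>i<k. c i * us i) / c k"
        by (simp add: d_def sum_divide_distrib sum_negf[symmetric])
      then show ?thesis unfolding sum using ck by (simp add: field_simps)
    qed
    moreover have "\<dots> \<in> H" by (rule ksubspace_mult[OF H]) (use c inverse_K in auto)
    ultimately show ?thesis by metis
  qed
  then show ?thesis using that km us by blast
qed

lemma ksubspace_dilate:
  assumes "ksubspace S"
  shows "ksubspace {z. z / y \<in> S}"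
  using assms ksubspace_mult[OF assms] unfolding ksubspace_def
  by (auto simp: add_divide_distrib simp flip: times_divide_eq_right)

lemma finite_funcset_K: "finite ({..<k::nat} \<rightarrow>\<^sub>E K)"
  by (intro finite_PiE) (auto simp: finite_K)

lemma ksubspace_combination: "ksubspace S \<Longrightarrow> \<forall>i<k. us i \<in> S \<Longrightarrow> c \<in> ({..<k} \<rightarrow>\<^sub>E K) \<Longrightarrow> (\<Sum>i<k. c i * us i) \<in> S"
  by (intro ksubspace_sum ksubspace_mult) auto

text \<open>A \<open>K\<close>-basis of \<open>S / y S\<close> has at most \<open>m\<close> elements: a \<open>K[y]\<close>-linear relation, divided by the
  largest possible power of \<open>y\<close> and reduced modulo \<open>y\<close>, is a nontrivial relation over \<open>K\<close>.\<close>

lemma card_incongruent_le: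
  assumes S: "ksubspace S"
    and y: "\<And>a. a \<in> S \<Longrightarrow> y * a \<in> S" "y \<noteq> 0" "all_dependent K y (Suc m)"
    and T: "T \<subseteq> S" "\<And>a b. a \<in> T \<Longrightarrow> b \<in> T \<Longrightarrow> (a - b) / y \<in> S \<Longrightarrow> a = b"
  shows "finite T \<and> card T \<le> q ^ m"
proof -
  define H where "H = {z. z / y \<in> S}"
  have H: "ksubspace H" unfolding H_def by (rule ksubspace_dilate[OF S])
  have not_indep: "\<not> rel_independent H S (Suc m) us" for us
  proof
    assume ind: "rel_independent H S (Suc m) us"
    from all_dependentE[OF y(3,2), of us]
    obtain p where p: "\<And>i. i < Suc m \<Longrightarrow> p i \<in> polys_over K" "\<exists>i<Suc m. coeff (p i) 0 \<noteq> 0"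
      "(\<Sum>i<Suc m. poly (p i) y * us i) = 0" by blast
    define p' where "p' i = poly_shift 1 (p i)" for i
    have pp': "p i = pCons (coeff (p i) 0) (p' i)" for i
      by (intro poly_eqI) (auto simp: p'_def coeff_poly_shift coeff_pCons split: nat.splits)
    have p': "p' i \<in> polys_over K" if "i < Suc m" for i
      using p(1)[OF that] by (auto simp: p'_def coeff_poly_shift polys_over_def)
    \<comment> \<open>Splitting off the constant terms puts the rest of the relation into y S, that
      is, into H.\<close>
    have "poly (p i) y = coeff (p i) 0 + y * poly (p' i) y" for i
      by (subst pp') simp
    then have "0 = (\<Sum>i<Suc m. (coeff (p i) 0 + y * poly (p' i) y) * us i)" using p(3) by simp
    also have "\<dots> = (\<Sum>i<Suc m. coeff (p i) 0 * us i) + y * (\<Sum>i<Suc m. poly (p' i) y * us i)"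
      by (simp only: ring_distribs sum.distrib sum_distrib_left mult.assoc)
    finally have "(\<Sum>i<Suc m. coeff (p i) 0 * us i) / y = - (\<Sum>i<Suc m. poly (p' i) y * us i)"
      using y(2) by (simp add: field_simps eq_neg_iff_add_eq_0 del: sum.lessThan_Suc)
    moreover have "\<dots> \<in> S"
      using ind p' unfolding rel_independent_def
      by (intro ksubspace_uminus ksubspace_sum S poly_mult_mem[of S] y) auto
    ultimately have in_H: "(\<Sum>i<Suc m. coeff (p i) 0 * us i) \<in> H" by (simp add: H_def)
    have "\<forall>i<Suc m. coeff (p i) 0 \<in> K" using p(1) by (auto simp: polys_over_def)
    with in_H have "\<forall>i<Suc m. coeff (p i) 0 = 0"
      using ind unfolding rel_independent_def by (elim conjE allE[where x = "\<lambda>i. coeff (p i) 0"]) blast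
    with p(2) show False by blast
  qed
  obtain k us where km: "k \<le> m" and us: "rel_independent H S k us"
    and span: "\<And>s. s \<in> S \<Longrightarrow> \<exists>c\<in>({..<k} \<rightarrow>\<^sub>E K). s - (\<Sum>i<k. c i * us i) \<in> H"
    using rel_basis[OF H not_indep] by blast
  then have "\<forall>s\<in>T. \<exists>c. c\<in>({..<k} \<rightarrow>\<^sub>E K) \<and> s - (\<Sum>i<k. c i * us i) \<in> H" using T by blast
  then obtain c where c: "\<And>s. s \<in> T \<Longrightarrow> c s\<in>({..<k} \<rightarrow>\<^sub>E K)" "\<And>s. s \<in> T \<Longrightarrow> s - (\<Sum>i<k. c s i * us i) \<in> H"
    by metis
  have "inj_on c T"
  proof (rule inj_onI)
    fix a b assume ab: "a \<in> T" "b \<in> T" "c a = c b"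
    have "a - b = (a - (\<Sum>i<k. c a i * us i)) - (b - (\<Sum>i<k. c b i * us i))"
      using ab by simp
    also have "\<dots> \<in> H" by (intro ksubspace_diff H c(2) ab)
    finally show "a = b" using T ab unfolding H_def by blast
  qed
  moreover have sub: "c ` T \<subseteq> ({..<k} \<rightarrow>\<^sub>E K)" using c by blast
  ultimately have "finite T" "card T \<le> card ({..<k} \<rightarrow>\<^sub>E K)"
    using inj_on_finite[of c T] card_inj_on_le[of c T] finite_funcset_K by auto
  moreover have "card ({..<k} \<rightarrow>\<^sub>E K) = q ^ k" by (simp add: card_funcsetE)
  moreover have "q ^ k \<le> q ^ m" using km q_ge_2 by (intro power_increasing) auto
  ultimately show ?thesis by simp
qed

text \<open>T is a full set of representatives of S modulo H, so it corresponds bijectively to the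
  coordinate vectors with respect to a basis of the quotient.\<close>

lemma card_quotient:
  assumes H: "ksubspace H" and S: "ksubspace S" and T: "finite T" "T \<subseteq> S"
    "\<And>a b. a \<in> T \<Longrightarrow> b \<in> T \<Longrightarrow> a - b \<in> H \<Longrightarrow> a = b" "\<And>s. s \<in> S \<Longrightarrow> \<exists>a\<in>T. s - a \<in> H"
  shows "\<exists>n. card T = q ^ n"
proof -
  \<comment> \<open>Stated for every independent family because it serves twice: injectivity bounds
    the length of such families, and for a maximal one the map is onto T.\<close>
  have le: "bij_betw (\<lambda>c. SOME a. a \<in> T \<and> (\<Sum>i<k. c i * us i) - a \<in> H) ({..<k} \<rightarrow>\<^sub>E K)
      ((\<lambda>c. SOME a. a \<in> T \<and> (\<Sum>i<k. c i * us i) - a \<in> H) ` ({..<k} \<rightarrow>\<^sub>E K))"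
      (is "bij_betw ?f _ _")
    and sub: "(\<lambda>c. SOME a. a \<in> T \<and> (\<Sum>i<k. c i * us i) - a \<in> H) ` ({..<k} \<rightarrow>\<^sub>E K) \<subseteq> T"
    and f: "\<And>c. c \<in> ({..<k} \<rightarrow>\<^sub>E K) \<Longrightarrow> (\<Sum>i<k. c i * us i) - (SOME a. a \<in> T \<and> (\<Sum>i<k. c i * us i) - a \<in> H) \<in> H"
    if ind: "rel_independent H S k us" for k us
  proof -
    have f: "?f c \<in> T \<and> (\<Sum>i<k. c i * us i) - ?f c \<in> H" if "c \<in> ({..<k} \<rightarrow>\<^sub>E K)" for c
    proof (rule someI_ex)
      have "(\<Sum>i<k. c i * us i) \<in> S"
        by (rule ksubspace_combination[OF S _ that]) (use ind in \<open>auto simp: rel_independent_def\<close>)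
      then show "\<exists>a. a \<in> T \<and> (\<Sum>i<k. c i * us i) - a \<in> H" using T(4) by blast
    qed
    show "?f ` ({..<k} \<rightarrow>\<^sub>E K) \<subseteq> T" using f by blast
    show "(\<Sum>i<k. c i * us i) - ?f c \<in> H" if "c \<in> ({..<k} \<rightarrow>\<^sub>E K)" for c using f that by blast
    have "inj_on ?f ({..<k} \<rightarrow>\<^sub>E K)"
    proof (rule inj_onI)
      fix c d assume cd: "c \<in> ({..<k} \<rightarrow>\<^sub>E K)" "d \<in> ({..<k} \<rightarrow>\<^sub>E K)" "?f c = ?f d"
      have "((\<Sum>i<k. c i * us i) - ?f c) - ((\<Sum>i<k. d i * us i) - ?f d) \<in> H"
        by (rule ksubspace_diff[OF H conjunct2[OF f[OF cd(1)]] conjunct2[OF f[OF cd(2)]]])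
      then have "(\<Sum>i<k. (c i - d i) * us i) \<in> H"
        using cd(3) by (simp add: sum_subtractf left_diff_distrib)
      moreover have "\<forall>i<k. c i - d i \<in> K" using cd by (auto intro!: diff_K)
      ultimately have "\<forall>i<k. c i - d i = 0"
        using ind unfolding rel_independent_def by (elim conjE allE[where x = "\<lambda>i. c i - d i"]) blast
      then show "c = d" using cd by (intro PiE_ext[OF cd(1,2)]) auto
    qed
    then show "bij_betw ?f ({..<k} \<rightarrow>\<^sub>E K) (?f ` ({..<k} \<rightarrow>\<^sub>E K))" by (rule inj_on_imp_bij_betw)
  qed
  have card: "card ({..<k} \<rightarrow>\<^sub>E K) = q ^ k" for k by (simp add: card_funcsetE)
  have not_indep: "\<not> rel_independent H S (Suc (card T)) us" for us
  proof
    assume "rel_independent H S (Suc (card T)) us"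
    from bij_betw_same_card[OF le[OF this]] card_mono[OF T(1) sub[OF this]]
    have "q ^ Suc (card T) \<le> card T" by (simp add: card del: power_Suc)
    moreover have "Suc (card T) < q ^ Suc (card T)" using q_ge_2 by (intro power_gt_expt) auto
    ultimately show False by linarith
  qed
  obtain k us where "k \<le> card T" and us: "rel_independent H S k us"
    and span: "\<And>s. s \<in> S \<Longrightarrow> \<exists>c\<in>({..<k} \<rightarrow>\<^sub>E K). s - (\<Sum>i<k. c i * us i) \<in> H"
    using rel_basis[OF H not_indep] by blast
  let ?f = "\<lambda>c. SOME a. a \<in> T \<and> (\<Sum>i<k. c i * us i) - a \<in> H"
  have "T \<subseteq> ?f ` ({..<k} \<rightarrow>\<^sub>E K)"
  proof
    fix a assume a: "a \<in> T"
    then obtain c where c: "c\<in>({..<k} \<rightarrow>\<^sub>E K)" "a - (\<Sum>i<k. c i * us i) \<in> H" using span T(2) by blast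
    have "a - (\<Sum>i<k. c i * us i) + ((\<Sum>i<k. c i * us i) - ?f c) \<in> H"
      by (rule ksubspace_add[OF H c(2) f[OF us c(1)]])
    then have diff: "a - ?f c \<in> H" by simp
    have "?f c \<in> T" by (rule subsetD[OF sub[OF us] imageI[OF c(1)]])
    then have "a = ?f c" by (rule T(3)[OF a _ diff])
    then show "a \<in> ?f ` ({..<k} \<rightarrow>\<^sub>E K)" using c(1) by blast
  qed
  then have "T = ?f ` ({..<k} \<rightarrow>\<^sub>E K)" using sub[OF us] by blast
  then have "card T = q ^ k" using bij_betw_same_card[OF le[OF us]] card by metis
  then show ?thesis by blast
qed

end

section \<open>Places and valuations\<close>

context function_field_const
begin

text \<open>The valuation rings of the function field that contain K. Closure under negation follows
  from -1 being in K.\<close>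

definition places :: "'a set set" where
  "places = {R. K \<subseteq> R \<and> R \<noteq> UNIV \<and> (\<forall>a\<in>R. \<forall>b\<in>R. a + b \<in> R \<and> a * b \<in> R) \<and> (\<forall>z. z \<in> R \<or> inverse z \<in> R)}"

text \<open>The non-units of R. Zero is listed separately because \<open>inverse 0 = 0\<close> lies
  in R.\<close>

definition max_ideal :: "'a set \<Rightarrow> 'a set" where
  "max_ideal R = {z. z = 0 \<or> inverse z \<notin> R}"

context
  fixes R assumes R: "R \<in> places"
begin

lemma
  shows place_K: "a \<in> K \<Longrightarrow> a \<in> R"
    and place_add: "a \<in> R \<Longrightarrow> b \<in> R \<Longrightarrow> a + b \<in> R"
    and place_mult: "a \<in> R \<Longrightarrow> b \<in> R \<Longrightarrow> a * b \<in> R"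
    and place_inverse: "a \<in> R \<or> inverse a \<in> R"
    and place_ne_UNIV: "\<exists>z. z \<notin> R"
  using R unfolding places_def by blast+

lemma place_0: "0 \<in> R" and place_1: "1 \<in> R"
  using place_K zero_K one_K by auto

lemma place_uminus: "a \<in> R \<Longrightarrow> - a \<in> R"
  using place_mult[of "- 1" a] place_K[OF uminus_K[OF one_K]] by simp

lemma place_diff: "a \<in> R \<Longrightarrow> b \<in> R \<Longrightarrow> a - b \<in> R"
  using place_add[of a "- b"] place_uminus by simp

lemma place_power: "a \<in> R \<Longrightarrow> a ^ n \<in> R"
  by (induction n) (auto intro: place_1 place_mult)

lemma max_ideal_subset: "z \<in> max_ideal R \<Longrightarrow> z \<in> R"
  using place_inverse[of z] by (auto simp: max_ideal_def place_0)

lemma max_ideal_mult: "z \<in> max_ideal R \<Longrightarrow> a \<in> R \<Longrightarrow> a * z \<in> max_ideal R"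
  using place_mult[of a "inverse (a * z)"] by (auto simp: max_ideal_def field_simps)

lemma one_notin_max_ideal: "1 \<notin> max_ideal R"
  by (simp add: max_ideal_def place_1)

lemma max_ideal_add:
  assumes "z \<in> max_ideal R" "w \<in> max_ideal R" shows "z + w \<in> max_ideal R"
proof (cases "z = 0 \<or> w = 0")
  case True
  then show ?thesis using assms by auto
next
  case False
  then consider "z / w \<in> R" | "w / z \<in> R"
    using place_inverse[of "z / w"] by (auto simp: inverse_eq_divide)
  then show ?thesis
  proof cases
    case 1
    have "(z / w + 1) * w \<in> max_ideal R" by (intro max_ideal_mult assms place_add 1 place_1)
    then show ?thesis using False by (simp add: field_simps)
  next
    case 2
    have "(w / z + 1) * z \<in> max_ideal R" by (intro max_ideal_mult assms place_add 2 place_1)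
    then show ?thesis using False by (simp add: field_simps)
  qed
qed

lemma max_ideal_notin_K: "z \<in> max_ideal R \<Longrightarrow> z \<noteq> 0 \<Longrightarrow> z \<notin> K"
  using inverse_K place_K by (auto simp: max_ideal_def)

lemma ex_max_ideal: "\<exists>z. z \<in> max_ideal R \<and> z \<noteq> 0"
proof -
  obtain z where "z \<notin> R" using place_ne_UNIV by blast
  then have "inverse z \<in> max_ideal R" "inverse z \<noteq> 0" using place_0 by (auto simp: max_ideal_def)
  then show ?thesis by blast
qed

definition incongruent :: "'a \<Rightarrow> 'a set \<Rightarrow> bool" where
  "incongruent z T \<longleftrightarrow> T \<subseteq> R \<and> (\<forall>a\<in>T. \<forall>b\<in>T. (a - b) / z \<in> R \<longrightarrow> a = b)"

text \<open>R is closed under multiplication by z, so R / z R has at most \<open>q ^ m\<close>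
  elements as soon as any m + 1 elements are dependent over \<open>K[z]\<close>. This finiteness is
  what makes R discrete.\<close>

lemma incongruent_bound:
  assumes "z \<in> max_ideal R" "z \<noteq> 0"
  shows "\<exists>B. \<forall>T. incongruent z T \<longrightarrow> finite T \<and> card T \<le> B"
proof -
  obtain n where "all_dependent K z n" using ex_all_dependent max_ideal_notin_K assms by blast
  moreover from this have "n \<noteq> 0" by (auto simp: all_dependent_def)
  ultimately obtain m where m: "all_dependent K z (Suc m)" by (cases n) auto
  have "finite T \<and> card T \<le> q ^ m" if T: "incongruent z T" for T
  proof (rule card_incongruent_le[OF _ _ _ m])
    show "ksubspace R" unfolding ksubspace_def using place_0 place_add place_mult place_K by blast
    show "a = b" if "a \<in> T" "b \<in> T" "(a - b) / z \<in> R" for a b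
      using T that unfolding incongruent_def by blast+
    show "z * a \<in> R" if "a \<in> R" for a using that place_mult max_ideal_subset assms by blast
    show "z \<noteq> 0" by fact
    show "T \<subseteq> R" using T unfolding incongruent_def by blast
  qed
  then show ?thesis by blast
qed

text \<open>A generator of the maximal ideal is an element \<open>t\<close> minimizing the index of \<open>t R\<close> in \<open>R\<close>.\<close>

lemma ex_uniformizer: "\<exists>t. t \<noteq> 0 \<and> (\<forall>z. z \<in> max_ideal R \<longleftrightarrow> z / t \<in> R)"
proof -
  define N where "N z = (GREATEST n. \<exists>T. incongruent z T \<and> card T = n)" for z
  have N: "\<exists>T. incongruent z T \<and> card T = N z" "\<And>T. incongruent z T \<Longrightarrow> finite T \<and> card T \<le> N z"
    if z: "z \<in> max_ideal R" "z \<noteq> 0" for z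
  proof -
    obtain B where B: "\<And>T. incongruent z T \<Longrightarrow> finite T \<and> card T \<le> B"
      using incongruent_bound[OF z] by metis
    have ex: "\<exists>T. incongruent z T \<and> card T = 0" by (rule exI[of _ "{}"]) (auto simp: incongruent_def)
    show "\<exists>T. incongruent z T \<and> card T = N z"
      unfolding N_def by (rule GreatestI_nat[of "\<lambda>n. \<exists>T. incongruent z T \<and> card T = n" 0 B]) (use B ex in auto)
    show "finite T \<and> card T \<le> N z" if "incongruent z T" for T
      unfolding N_def using that B by (intro conjI Greatest_le_nat[of _ _ B]) auto
  qed
  obtain t where t: "t \<in> max_ideal R" "t \<noteq> 0"
    and least: "\<And>z. z \<in> max_ideal R \<and> z \<noteq> 0 \<Longrightarrow> N t \<le> N z"
    using ex_has_least_nat[of "\<lambda>z. z \<in> max_ideal R \<and> z \<noteq> 0" _ N] ex_max_ideal by metis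
  have "z / t \<in> R" if z: "z \<in> max_ideal R" for z
  proof (rule ccontr)
    assume nR: "z / t \<notin> R"
    then have z0: "z \<noteq> 0" using place_0 by auto
    have tz: "t / z \<in> R" using place_inverse[of "z / t"] nR by (simp add: inverse_eq_divide)
    obtain T where T: "incongruent z T" "card T = N z" using N(1)[OF z z0] by blast
    have finT: "finite T" using N(2)[OF z z0 T(1)] by blast
    \<comment> \<open>A maximal T represents the class of 0, for otherwise 0 could be added to
      it.\<close>
    have "\<exists>s\<in>T. s / z \<in> R"
    proof (rule ccontr)
      assume none: "\<not> ?thesis"
      have "incongruent z (insert 0 T)"
        unfolding incongruent_def
      proof (intro conjI ballI impI)
        show "insert 0 T \<subseteq> R" using T place_0 by (auto simp: incongruent_def)
        fix a b assume ab: "a \<in> insert 0 T" "b \<in> insert 0 T" "(a - b) / z \<in> R"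
        have "- ((a - b) / z) \<in> R" by (rule place_uminus[OF ab(3)])
        then have ba: "(b - a) / z \<in> R" by (simp add: minus_divide_left)
        consider "a = 0" "b = 0" | "a \<in> T" "b \<in> T" | "a = 0" "b \<in> T" | "a \<in> T" "b = 0" using ab by blast
        then show "a = b"
        proof cases
          case 2
          then show ?thesis using T(1) ab(3) unfolding incongruent_def by blast
        qed (use ab(3) ba none in auto)
      qed
      then have "card (insert 0 T) \<le> N z" using N(2)[OF z z0] by blast
      moreover have "0 \<notin> T" using none place_0 by auto
      ultimately show False using T finT by simp
    qed
    then obtain s where s: "s \<in> T" "s / z \<in> R" by blast
    \<comment> \<open>s and s + z are congruent modulo z but not modulo t. So T enlarged by s + z
      consists of more than \<open>N z\<close> elements incongruent modulo t, against the minimality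
      of \<open>N t\<close>.\<close>
    have new: "s + z \<notin> T"
    proof
      assume "s + z \<in> T"
      moreover have "(s + z - s) / z \<in> R" using z0 place_1 by simp
      ultimately have "s + z = s" using T(1) s(1) unfolding incongruent_def by blast
      then show False using z0 by simp
    qed
    have tz_R: "a / z \<in> R" if "a / t \<in> R" for a
      using place_mult[OF that tz] t by simp
    have aux: "b / t \<notin> R" if b: "b = s + z - c" "c \<in> T" for b c
    proof
      assume *: "b / t \<in> R"
      have "b / z - 1 \<in> R" by (intro place_diff tz_R * place_1)
      then have "(s - c) / z \<in> R" using z0 b by (simp add: field_simps)
      then have "s = c" using T(1) s(1) b(2) unfolding incongruent_def by blast
      then show False using * b nR by simp
    qed
    have "incongruent t (insert (s + z) T)"
      unfolding incongruent_def
    proof (intro conjI ballI impI)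
      show "insert (s + z) T \<subseteq> R"
        using T s place_add[of s z] max_ideal_subset[OF z] by (auto simp: incongruent_def)
      fix a b assume ab: "a \<in> insert (s + z) T" "b \<in> insert (s + z) T" "(a - b) / t \<in> R"
      have "- ((a - b) / t) \<in> R" by (rule place_uminus[OF ab(3)])
      then have ba: "(b - a) / t \<in> R" by (simp add: minus_divide_left)
      show "a = b"
        using ab ba aux[of "a - b" b] aux[of "b - a" a] tz_R[OF ab(3)] T(1) unfolding incongruent_def by blast
    qed
    then have "card (insert (s + z) T) \<le> N t" using N(2)[OF t] by blast
    then have "N z < N t" using new T finT by simp
    then show False using least z z0 by (simp add: leD)
  qed
  moreover have "z \<in> max_ideal R" if "z / t \<in> R" for z
    using max_ideal_mult[OF t(1) that] t by simp
  ultimately show ?thesis using t by blast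
qed

end

section \<open>Normalized discrete valuations\<close>

definition uniformizer :: "'a set \<Rightarrow> 'a" where
  "uniformizer R = (SOME t. t \<noteq> 0 \<and> (\<forall>z. z \<in> max_ideal R \<longleftrightarrow> z / t \<in> R))"

definition place_unit :: "'a set \<Rightarrow> 'a \<Rightarrow> bool" where
  "place_unit R z \<longleftrightarrow> z \<noteq> 0 \<and> z \<in> R \<and> inverse z \<in> R"

definition valuation :: "'a set \<Rightarrow> 'a \<Rightarrow> int" where
  "valuation R z = (THE k. place_unit R (z / uniformizer R powi k))"

text \<open>Order at least k. Dividing by a power of the uniformizer makes this true for z = 0 at
  every k, whereas \<open>valuation\<close> gives 0 no meaningful value.\<close>

definition val_ge :: "'a set \<Rightarrow> int \<Rightarrow> 'a \<Rightarrow> bool" where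
  "val_ge R k z \<longleftrightarrow> z / uniformizer R powi k \<in> R"

context
  fixes R assumes R: "R \<in> places"
begin

private abbreviation (input) "t \<equiv> uniformizer R"

lemma uniformizer: "t \<noteq> 0" "z \<in> max_ideal R \<longleftrightarrow> z / t \<in> R"
  using someI_ex[OF ex_uniformizer[OF R]] unfolding uniformizer_def[symmetric] by blast+

lemma uniformizer_max_ideal: "t \<in> max_ideal R"
  using uniformizer place_1[OF R] by simp

lemma uniformizer_power_notin: "n > 0 \<Longrightarrow> inverse (t ^ n) \<notin> R"
proof
  assume n: "n > 0" "inverse (t ^ n) \<in> R"
  have "t ^ (n - 1) * inverse (t ^ n) \<in> R"
    by (intro place_mult[OF R] place_power[OF R] max_ideal_subset[OF R] uniformizer_max_ideal n)
  moreover have "t ^ n = t ^ (n - 1) * t" using n by (metis Suc_diff_1 power_Suc2)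
  ultimately have "inverse t \<in> R" using uniformizer(1) by (simp add: field_simps)
  then show False using uniformizer_max_ideal uniformizer(1) by (simp add: max_ideal_def)
qed

lemma uniformizer_powi_mem_iff: "t powi k \<in> R \<longleftrightarrow> 0 \<le> k"
proof (cases "0 \<le> k")
  case True
  then show ?thesis
    using place_power[OF R max_ideal_subset[OF R uniformizer_max_ideal], of "nat k"] by (simp add: power_int_def)
next
  case False
  then show ?thesis using uniformizer_power_notin[of "nat (- k)"] by (simp add: power_int_def power_inverse)
qed

lemma place_unit_mult: "place_unit R a \<Longrightarrow> place_unit R b \<Longrightarrow> place_unit R (a * b)"
  unfolding place_unit_def by (auto simp: intro!: place_mult[OF R])

lemma place_unit_inverse: "place_unit R a \<Longrightarrow> place_unit R (inverse a)"
  unfolding place_unit_def by auto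

lemma place_unit_iff: "place_unit R z \<longleftrightarrow> z \<in> R \<and> z \<notin> max_ideal R"
  unfolding place_unit_def max_ideal_def by auto

text \<open>As long as \<open>t ^ k\<close> divides z, the powers \<open>t ^ i\<close> with i < k
  are pairwise incongruent modulo z. The finite index of z R in R therefore bounds k, and the
  largest such k leaves a unit.\<close>

lemma ex_valuation_nonneg:
  assumes z: "z \<in> R" "z \<noteq> 0"
  shows "\<exists>k. place_unit R (z / t ^ k)"
proof (cases "z \<in> max_ideal R")
  case False
  then show ?thesis using z by (intro exI[of _ 0]) (simp add: place_unit_iff)
next
  case True
  obtain B where B: "\<And>T. incongruent R z T \<Longrightarrow> finite T \<and> card T \<le> B"
    using incongruent_bound[OF R True z(2)] by metis
  have bound: "k \<le> B" if k: "z / t ^ k \<in> R" for k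
  proof -
    have diff: "i = j" if ij: "i < k" "j < k" "(t ^ i - t ^ j) / z \<in> R" "i \<le> j" for i j
    proof (rule ccontr)
      assume "i \<noteq> j"
      then have lt: "i < j" using ij by simp
      \<comment> \<open>This product is \<open>(1 - t ^ (j - i)) / t\<close>, so its membership in R
        puts 1 into the maximal ideal.\<close>
      have "(t ^ i - t ^ j) / z * (z / t ^ k) * t ^ (k - i - 1) \<in> R"
        by (intro place_mult[OF R] ij k place_power[OF R] max_ideal_subset[OF R] uniformizer_max_ideal)
      moreover have "t ^ k = t ^ i * t ^ (k - i - 1) * t"
        using ij lt by (simp flip: power_add power_Suc2)
      moreover have "t ^ j = t ^ i * t ^ (j - i)"
        using lt by (simp flip: power_add)
      moreover have "(a - a * d) / z * (z / (a * e * s)) * e = (1 - d) / s"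
        if "a \<noteq> 0" "e \<noteq> 0" "s \<noteq> 0" for a d e s
        using that z by (simp add: field_simps)
      ultimately have "(1 - t ^ (j - i)) / t \<in> R"
        using uniformizer(1) by simp
      then have "1 - t ^ (j - i) \<in> max_ideal R" using uniformizer(2) by blast
      moreover have "t ^ (j - i) = t ^ (j - i - 1) * t" using lt power_minus_mult[of "j - i" t] by simp
      then have "t ^ (j - i) \<in> max_ideal R"
        using max_ideal_mult[OF R uniformizer_max_ideal, of "t ^ (j - i - 1)"] place_power[OF R]
          max_ideal_subset[OF R uniformizer_max_ideal] by simp
      ultimately have "1 - t ^ (j - i) + t ^ (j - i) \<in> max_ideal R" by (rule max_ideal_add[OF R])
      then show False using one_notin_max_ideal[OF R] by simp
    qed
    have diff: "i = j" if ij: "i < k" "j < k" "(t ^ i - t ^ j) / z \<in> R" for i j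
    proof (cases "i \<le> j")
      case True
      then show ?thesis using diff ij by blast
    next
      case False
      moreover have "- ((t ^ i - t ^ j) / z) \<in> R" by (rule place_uminus[OF R ij(3)])
      then have "(t ^ j - t ^ i) / z \<in> R" by (simp add: minus_divide_left)
      ultimately show ?thesis using diff[of j i] ij by simp
    qed
    have "incongruent R z ((\<lambda>i. t ^ i) ` {..<k})"
      unfolding incongruent_def[OF R]
      using diff place_power[OF R max_ideal_subset[OF R uniformizer_max_ideal]] by auto
    then have "card ((\<lambda>i. t ^ i) ` {..<k}) \<le> B" using B by blast
    moreover have "inj_on (\<lambda>i. t ^ i) {..<k}"
      by (rule inj_onI) (use diff place_0[OF R] in auto)
    ultimately show ?thesis by (simp add: card_image)
  qed
  define k where "k = (GREATEST k. z / t ^ k \<in> R)"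
  have ex: "z / t ^ 0 \<in> R" using z by simp
  have k: "z / t ^ k \<in> R" unfolding k_def by (rule GreatestI_nat[of _ 0 B]) (use ex bound in auto)
  have "z / t ^ Suc k \<notin> R"
  proof
    assume "z / t ^ Suc k \<in> R"
    then have "Suc k \<le> k" unfolding k_def using bound by (intro Greatest_le_nat[of _ _ B]) auto
    then show False by simp
  qed
  then have "z / t ^ k \<notin> max_ideal R" using uniformizer(2)[of "z / t ^ k"] by (simp add: field_simps)
  then show ?thesis using k place_unit_iff by blast
qed

lemma ex_valuation:
  assumes z: "z \<noteq> 0"
  shows "\<exists>k. place_unit R (z / t powi k)"
proof (cases "z \<in> R")
  case True
  then show ?thesis using ex_valuation_nonneg[OF _ z] by (metis power_int_of_nat)
next
  case False
  then obtain k where k: "place_unit R (inverse z / t ^ k)"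
    using ex_valuation_nonneg[of "inverse z"] place_inverse[OF R, of z] z by auto
  have "place_unit R (inverse (inverse z / t ^ k))" using place_unit_inverse[OF k] .
  also have "inverse (inverse z / t ^ k) = z / t powi (- int k)" by (simp add: power_int_minus field_simps)
  finally show ?thesis by blast
qed

lemma valuation_eqI:
  assumes z: "z \<noteq> 0" and k: "place_unit R (z / t powi k)"
  shows "valuation R z = k"
proof -
  have le: "l \<le> k" if "place_unit R (z / t powi l)" "place_unit R (z / t powi k)" for k l
  proof -
    have "place_unit R (z / t powi l * inverse (z / t powi k))"
      by (intro place_unit_mult place_unit_inverse that)
    also have "z / t powi l * inverse (z / t powi k) = t powi (k - l)"
      using z uniformizer(1) by (simp add: power_int_diff field_simps)
    finally show ?thesis using uniformizer_powi_mem_iff[of "k - l"] by (simp add: place_unit_def)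
  qed
  show ?thesis unfolding valuation_def by (rule the_equality) (use le k in \<open>auto intro: antisym\<close>)
qed

lemma place_unit_valuation: "z \<noteq> 0 \<Longrightarrow> place_unit R (z / t powi valuation R z)"
  using ex_valuation[of z] valuation_eqI[of z] by auto

lemma valuation_mult: "z \<noteq> 0 \<Longrightarrow> w \<noteq> 0 \<Longrightarrow> valuation R (z * w) = valuation R z + valuation R w"
  using place_unit_mult[OF place_unit_valuation[of z] place_unit_valuation[of w]] uniformizer(1)
  by (intro valuation_eqI) (auto simp: power_int_add)

lemma valuation_1: "valuation R 1 = 0"
  using place_1[OF R] by (intro valuation_eqI) (auto simp: place_unit_def)

lemma valuation_inverse: "z \<noteq> 0 \<Longrightarrow> valuation R (inverse z) = - valuation R z"
  using valuation_mult[of z "inverse z"] valuation_1 by simp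

lemma valuation_divide: "z \<noteq> 0 \<Longrightarrow> w \<noteq> 0 \<Longrightarrow> valuation R (z / w) = valuation R z - valuation R w"
  using valuation_mult[of z "inverse w"] valuation_inverse[of w] by (simp add: field_simps)

lemma valuation_power: "z \<noteq> 0 \<Longrightarrow> valuation R (z ^ n) = int n * valuation R z"
  by (induction n) (auto simp: valuation_1 valuation_mult algebra_simps)

lemma valuation_uminus: "valuation R (- z) = valuation R z"
proof (cases "z = 0")
  case False
  then have "place_unit R (- z / t powi valuation R z)"
    using place_unit_valuation[OF False] place_uminus[OF R] by (auto simp: place_unit_def minus_divide_left[symmetric] simp del: minus_divide_left)
  then show ?thesis using False by (intro valuation_eqI) auto
qed simp

lemma val_ge_iff: "val_ge R k z \<longleftrightarrow> z = 0 \<or> k \<le> valuation R z"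
proof (cases "z = 0")
  case True
  then show ?thesis using place_0[OF R] by (simp add: val_ge_def)
next
  case False
  define u where "u = z / t powi valuation R z"
  have u: "place_unit R u" unfolding u_def by (rule place_unit_valuation[OF False])
  have eq: "z / t powi k = u * t powi (valuation R z - k)"
    using uniformizer(1) by (simp add: u_def power_int_diff)
  have "u * a \<in> R \<longleftrightarrow> a \<in> R" for a
    using place_mult[OF R, of u a] place_mult[OF R, of "inverse u" "u * a"] u
    by (auto simp: place_unit_def mult.assoc[symmetric])
  then show ?thesis unfolding val_ge_def eq using False uniformizer_powi_mem_iff by simp
qed

lemma val_ge_0_iff: "val_ge R 0 z \<longleftrightarrow> z \<in> R"
  by (simp add: val_ge_def)

lemma val_ge_1_iff: "val_ge R 1 z \<longleftrightarrow> z \<in> max_ideal R"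
  by (simp add: val_ge_def uniformizer)

lemma val_ge_add: "val_ge R k z \<Longrightarrow> val_ge R k w \<Longrightarrow> val_ge R k (z + w)"
  unfolding val_ge_def using place_add[OF R] by (simp add: add_divide_distrib)

lemma val_ge_uminus: "val_ge R k z \<Longrightarrow> val_ge R k (- z)"
  by (auto simp: val_ge_iff valuation_uminus)

lemma val_ge_diff: "val_ge R k z \<Longrightarrow> val_ge R k w \<Longrightarrow> val_ge R k (z - w)"
  using val_ge_add[of k z "- w"] val_ge_uminus by simp

lemma val_ge_mult: "val_ge R k z \<Longrightarrow> val_ge R l w \<Longrightarrow> val_ge R (k + l) (z * w)"
  by (cases "z = 0 \<or> w = 0") (auto simp: val_ge_iff valuation_mult)

lemma val_ge_mono: "val_ge R k z \<Longrightarrow> l \<le> k \<Longrightarrow> val_ge R l z"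
  by (auto simp: val_ge_iff)

lemma val_ge_0: "val_ge R k 0"
  by (auto simp: val_ge_iff)

lemma val_ge_K: "c \<in> K \<Longrightarrow> val_ge R 0 c"
  by (simp add: val_ge_0_iff place_K[OF R])

lemma val_ge_K_mult: "c \<in> K \<Longrightarrow> val_ge R k z \<Longrightarrow> val_ge R k (c * z)"
  using val_ge_mult[OF val_ge_K] by fastforce

lemma val_ge_sum: "(\<And>i. i \<in> I \<Longrightarrow> val_ge R k (f i)) \<Longrightarrow> val_ge R k (sum f I)"
  by (induction I rule: infinite_finite_induct) (auto intro: val_ge_0 val_ge_add)

lemma valuation_uniformizer: "valuation R t = 1"
  using uniformizer(1) place_1[OF R] by (intro valuation_eqI) (auto simp: place_unit_def)

lemma valuation_add_eq:
  assumes "a \<noteq> 0" "b \<noteq> 0" "valuation R a < valuation R b"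
  shows "a + b \<noteq> 0" "valuation R (a + b) = valuation R a"
proof -
  show nz: "a + b \<noteq> 0"
  proof
    assume "a + b = 0"
    then have "b = - a" by (simp add: add_eq_0_iff)
    then show False using assms valuation_uminus by simp
  qed
  have "val_ge R (valuation R a) (a + b)" using assms by (intro val_ge_add) (auto simp: val_ge_iff)
  moreover have "\<not> val_ge R (valuation R a + 1) (a + b)"
  proof
    assume "val_ge R (valuation R a + 1) (a + b)"
    then have "val_ge R (valuation R a + 1) (a + b - b)"
      using assms by (intro val_ge_diff) (auto simp: val_ge_iff)
    then show False using assms by (simp add: val_ge_iff)
  qed
  ultimately show "valuation R (a + b) = valuation R a" using nz by (simp add: val_ge_iff)
qed

end

end

section \<open>Residue fields and weak approximation\<close>

context function_field_const
begin

lemma ksubspace_place: "R \<in> places \<Longrightarrow> ksubspace R"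
  unfolding ksubspace_def using place_0 place_add place_mult place_K by blast

lemma ksubspace_max_ideal: "R \<in> places \<Longrightarrow> ksubspace (max_ideal R)"
  unfolding ksubspace_def using max_ideal_add max_ideal_mult place_K by (auto simp: max_ideal_def)

definition residues :: "'a set \<Rightarrow> 'a set" where
  "residues R = (SOME T. finite T \<and> T \<subseteq> R \<and> (\<forall>a\<in>T. \<forall>b\<in>T. a - b \<in> max_ideal R \<longrightarrow> a = b) \<and>
     (\<forall>z\<in>R. \<exists>a\<in>T. z - a \<in> max_ideal R))"

text \<open>Among the sets incongruent modulo a uniformizer, one of maximal cardinality meets every
  class, since an element of a missing class could be added.\<close>

lemma residues:
  assumes R: "R \<in> places"
  shows "finite (residues R)" "residues R \<subseteq> R"
    "\<And>a b. a \<in> residues R \<Longrightarrow> b \<in> residues R \<Longrightarrow> a - b \<in> max_ideal R \<Longrightarrow> a = b"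
    "\<And>z. z \<in> R \<Longrightarrow> \<exists>a\<in>residues R. z - a \<in> max_ideal R"
proof -
  let ?t = "uniformizer R"
  obtain B where B: "\<And>T. incongruent R ?t T \<Longrightarrow> finite T \<and> card T \<le> B"
    using incongruent_bound[OF R uniformizer_max_ideal[OF R] uniformizer(1)[OF R]] by metis
  define n where "n = (GREATEST n. \<exists>T. incongruent R ?t T \<and> card T = n)"
  have ex: "\<exists>T. incongruent R ?t T \<and> card T = 0" by (rule exI[of _ "{}"]) (auto simp: incongruent_def[OF R])
  have "\<exists>T. incongruent R ?t T \<and> card T = n"
    unfolding n_def
    by (rule GreatestI_nat[of "\<lambda>n. \<exists>T. incongruent R ?t T \<and> card T = n" 0 B]) (use B ex in auto)
  then obtain T where T: "incongruent R ?t T" "card T = n" by blast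
  have finT: "finite T" using B T by blast
  have max: "card T' \<le> n" if "incongruent R ?t T'" for T'
    unfolding n_def using that B by (intro Greatest_le_nat[of _ _ B]) auto
  have inc: "incongruent R ?t T' \<longleftrightarrow> T' \<subseteq> R \<and> (\<forall>a\<in>T'. \<forall>b\<in>T'. a - b \<in> max_ideal R \<longrightarrow> a = b)" for T'
    unfolding incongruent_def[OF R] uniformizer(2)[OF R] by blast
  have "\<exists>a\<in>T. z - a \<in> max_ideal R" if z: "z \<in> R" for z
  proof (rule ccontr)
    assume none: "\<not> ?thesis"
    have neg: "a - z \<notin> max_ideal R" if "a \<in> T" for a
      using none that ksubspace_uminus[OF ksubspace_max_ideal[OF R], of "a - z"] by auto
    have "z \<notin> T" using none by (force simp: max_ideal_def)
    then have "card (insert z T) = Suc n" using T finT by simp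
    moreover have "incongruent R ?t (insert z T)"
      using T(1) z none neg unfolding inc by blast
    ultimately show False using max by force
  qed
  then have "\<exists>T. finite T \<and> T \<subseteq> R \<and> (\<forall>a\<in>T. \<forall>b\<in>T. a - b \<in> max_ideal R \<longrightarrow> a = b) \<and>
     (\<forall>z\<in>R. \<exists>a\<in>T. z - a \<in> max_ideal R)"
    using T(1) finT unfolding inc by (intro exI[of _ T] conjI ballI) auto
  from someI_ex[OF this, folded residues_def]
  show "finite (residues R)" "residues R \<subseteq> R"
    "\<And>a b. a \<in> residues R \<Longrightarrow> b \<in> residues R \<Longrightarrow> a - b \<in> max_ideal R \<Longrightarrow> a = b"
    "\<And>z. z \<in> R \<Longrightarrow> \<exists>a\<in>residues R. z - a \<in> max_ideal R"
    by blast+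
qed

text \<open>The degree of the residue field over K, read off as an exponent. The value 0 outside
  \<open>places\<close> lets degrees ignore coefficients at other sets.\<close>

definition place_deg :: "'a set \<Rightarrow> nat" where
  "place_deg R = (if R \<in> places then (THE n. card (residues R) = q ^ n) else 0)"

lemma card_residues:
  assumes R: "R \<in> places"
  shows "card (residues R) = q ^ place_deg R"
proof -
  obtain n where n: "card (residues R) = q ^ n"
    using card_quotient[OF ksubspace_max_ideal[OF R] ksubspace_place[OF R] residues[OF R]] by blast
  moreover have "m = n" if "card (residues R) = q ^ m" for m
    using that n q_ge_2 by (metis One_nat_def Suc_1 Suc_le_lessD power_inject_exp)
  ultimately show ?thesis using R unfolding place_deg_def by (auto intro: theI2)
qed

lemma place_deg_pos: "R \<in> places \<Longrightarrow> place_deg R > 0"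
proof (rule ccontr)
  assume R: "R \<in> places" and "\<not> place_deg R > 0"
  then have "card (residues R) = 1" using card_residues[OF R] by simp
  then obtain a where a: "residues R = {a}" by (auto simp: card_1_singleton_iff)
  have "1 - a \<in> max_ideal R" "0 - a \<in> max_ideal R"
    using residues(4)[OF R, of 1] residues(4)[OF R, of 0] place_1[OF R] place_0[OF R] a by auto
  then have "(1 - a) - (0 - a) \<in> max_ideal R" by (rule ksubspace_diff[OF ksubspace_max_ideal[OF R]])
  then show False using one_notin_max_ideal[OF R] by simp
qed

text \<open>Truncated expansions in the uniformizer: a representative c of the residue field plus t
  times an expansion w of length e. Modulo t the sum determines c, and after division by t it
  determines w.\<close>

lemma ex_residue_system:
  assumes R: "R \<in> places"
  shows "\<exists>T. T \<subseteq> R \<and> finite T \<and> card T = q ^ (e * place_deg R) \<and>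
    (\<forall>a\<in>T. \<forall>b\<in>T. val_ge R (int e) (a - b) \<longrightarrow> a = b)"
proof (induction e)
  case 0
  show ?case by (rule exI[of _ "{0}"]) (simp add: place_0[OF R])
next
  case (Suc e)
  let ?t = "uniformizer R"
  note t = uniformizer(1)[OF R] uniformizer_max_ideal[OF R] max_ideal_subset[OF R uniformizer_max_ideal[OF R]]
  obtain T where T: "T \<subseteq> R" "finite T" "card T = q ^ (e * place_deg R)"
    "\<And>a b. a \<in> T \<Longrightarrow> b \<in> T \<Longrightarrow> val_ge R (int e) (a - b) \<Longrightarrow> a = b" using Suc by blast
  define f where "f = (\<lambda>(c, w). c + ?t * w)"
  have eq: "c = c' \<and> w = w'"
    if c: "c \<in> residues R" "c' \<in> residues R" and w: "w \<in> T" "w' \<in> T"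
      and ge: "val_ge R (int (Suc e)) (c + ?t * w - (c' + ?t * w'))" for c c' w w'
  proof -
    have "(w' - w) * ?t \<in> max_ideal R"
      using T(1) w by (intro max_ideal_mult[OF R t(2)] place_diff[OF R]) auto
    moreover have "val_ge R 1 (c + ?t * w - (c' + ?t * w'))" by (rule val_ge_mono[OF R ge]) simp
    then have "c + ?t * w - (c' + ?t * w') \<in> max_ideal R" using val_ge_1_iff[OF R] by blast
    ultimately have "(w' - w) * ?t + (c + ?t * w - (c' + ?t * w')) \<in> max_ideal R" by (rule max_ideal_add[OF R])
    then have cc: "c = c'" using residues(3)[OF R c] by (simp add: algebra_simps)
    then have "val_ge R (int (Suc e)) (?t * (w - w'))" using ge by (simp add: algebra_simps)
    then have "val_ge R (int e) (w - w')"
      using t(1) valuation_mult[OF R, of ?t "w - w'"] valuation_uniformizer[OF R]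
      by (cases "w = w'") (auto simp: val_ge_iff[OF R])
    then show ?thesis using cc T(4)[OF w] by simp
  qed
  have "inj_on f (residues R \<times> T)"
    by (rule inj_onI) (use eq val_ge_0[OF R] in \<open>force simp: f_def\<close>)
  then have "card (f ` (residues R \<times> T)) = q ^ (Suc e * place_deg R)"
    using card_residues[OF R] T by (simp add: card_image card_cartesian_product power_add)
  moreover have "f ` (residues R \<times> T) \<subseteq> R"
    using T residues(2)[OF R] t by (auto simp: f_def intro!: place_add[OF R] place_mult[OF R])
  moreover have "a = b" if "a \<in> f ` (residues R \<times> T)" "b \<in> f ` (residues R \<times> T)" "val_ge R (int (Suc e)) (a - b)" for a b
    using that eq by (auto simp: f_def)
  ultimately show ?case using residues(1)[OF R] T by (intro exI[of _ "f ` (residues R \<times> T)"]) auto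
qed

text \<open>A discrete valuation ring is a maximal proper subring. If the uniformizer of P were a
  unit of Q, every element would lie in Q. Otherwise an element of Q with a pole at P, multiplied by
  a suitable power of the uniformizer, is a unit of P and hence of Q, yet lies in the maximal ideal
  of Q.\<close>

lemma places_incomparable:
  assumes P: "P \<in> places" and Q: "Q \<in> places" and "P \<subseteq> Q"
  shows "P = Q"
proof -
  let ?t = "uniformizer P"
  note t = uniformizer(1)[OF P] uniformizer_max_ideal[OF P] max_ideal_subset[OF P uniformizer_max_ideal[OF P]]
  have tpow: "?t ^ n \<in> P" for n using place_power[OF P] t by blast
  have unit: "place_unit Q u" if "place_unit P u" for u
    using that assms by (auto simp: place_unit_def)
  have tQ: "?t \<in> max_ideal Q"
  proof (rule ccontr)
    assume nt: "?t \<notin> max_ideal Q"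
    have tinv: "inverse ?t \<in> Q" using nt by (simp add: max_ideal_def)
    have "z \<in> Q" for z
    proof (cases "z = 0")
      case False
      define k where "k = valuation P z"
      have u: "z / ?t powi k \<in> Q"
        using place_unit_valuation[OF P False] unit by (auto simp: place_unit_def k_def)
      have "?t powi k \<in> Q"
        using place_power[OF Q, of ?t "nat k"] place_power[OF Q tinv, of "nat (-k)"] tpow t(3) assms(3)
        by (auto simp: power_int_def power_inverse)
      then have "z / ?t powi k * ?t powi k \<in> Q" using u place_mult[OF Q] by blast
      then show ?thesis using t by simp
    qed (simp add: place_0[OF Q])
    then show False using place_ne_UNIV[OF Q] by blast
  qed
  have "z \<in> P" if z: "z \<in> Q" for z
  proof (rule ccontr)
    assume nz: "z \<notin> P"
    have z0: "z \<noteq> 0" using nz place_0[OF P] by blast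
    have neg: "valuation P z < 0"
      using nz val_ge_0_iff[OF P] val_ge_iff[OF P] z0 by force
    define n where "n = nat (- valuation P z)"
    have n: "n > 0" "valuation P z = - int n" using neg by (auto simp: n_def)
    have u: "place_unit Q (z * ?t ^ n)"
      using unit[OF place_unit_valuation[OF P z0]] n by (simp add: power_int_minus field_simps)
    have "z * ?t ^ (n - 1) * ?t \<in> max_ideal Q"
      using tpow assms(3) by (intro max_ideal_mult[OF Q tQ] place_mult[OF Q] z) auto
    moreover have "z * ?t ^ (n - 1) * ?t = z * ?t ^ n"
      using power_minus_mult[of n ?t] n by (simp add: mult.assoc)
    ultimately have "z * ?t ^ n \<in> max_ideal Q" by metis
    then show False using u by (simp add: place_unit_iff[OF Q])
  qed
  then show ?thesis using assms by blast
qed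

text \<open>Induction on S. When the function u found so far has no pole at the new place Q, a high
  power of some h with a zero at P and a pole at Q is added to it.\<close>

lemma ex_separating:
  assumes P: "P \<in> places" and "finite S" "S \<subseteq> places" "P \<notin> S"
  shows "\<exists>u. u \<noteq> 0 \<and> valuation P u > 0 \<and> (\<forall>Q\<in>S. valuation Q u < 0)"
  using assms(2-)
proof (induction S rule: finite_induct)
  case empty
  then show ?case
    using uniformizer(1)[OF P] valuation_uniformizer[OF P] by (intro exI[of _ "uniformizer P"]) auto
next
  case (insert Q S)
  then obtain u where u: "u \<noteq> 0" "valuation P u > 0" "\<And>Q. Q \<in> S \<Longrightarrow> valuation Q u < 0" by auto
  have Q: "Q \<in> places" "P \<noteq> Q" and S: "S \<subseteq> places" using insert by auto
  obtain a where a: "a \<in> P" "a \<notin> Q" using places_incomparable[OF P Q(1)] Q(2) by blast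
  obtain b where b: "b \<in> Q" "b \<notin> P" using places_incomparable[OF Q(1) P] Q(2) by blast
  have ab0: "a \<noteq> 0" "b \<noteq> 0" using a b place_0 P Q by auto
  have ge: "z \<in> R \<longleftrightarrow> 0 \<le> valuation R z" if "R \<in> places" "z \<noteq> 0" for R z
    using that val_ge_0_iff val_ge_iff by blast
  define h where "h = a / b"
  have h0: "h \<noteq> 0" using ab0 by (simp add: h_def)
  have h: "valuation P h > 0" "valuation Q h < 0"
    using a b ab0 ge[OF P, of a] ge[OF P, of b] ge[OF Q(1), of a] ge[OF Q(1), of b]
    by (auto simp: h_def valuation_divide P Q(1))
  show ?case
  proof (cases "valuation Q u < 0")
    case True
    then show ?thesis using u by blast
  next
    case False
    \<comment> \<open>r exceeds the absolute value of every order of u on S, so \<open>h ^ r\<close>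
      and u never have the same order at these places, and the smaller of the two is the order of
      the sum.\<close>
    define r where "r = Suc (\<Sum>Q\<in>S. nat \<bar>valuation Q u\<bar>)"
    have r: "int r > \<bar>valuation Q u\<bar>" if "Q \<in> S" for Q
    proof -
      have "nat \<bar>valuation Q u\<bar> \<le> (\<Sum>Q\<in>S. nat \<bar>valuation Q u\<bar>)"
        using insert.hyps(1) that by (intro member_le_sum) auto
      then have "nat \<bar>valuation Q u\<bar> < r" by (simp add: r_def)
      then show ?thesis by linarith
    qed
    have hr0: "h ^ r \<noteq> 0" using h0 by simp
    have vhr: "valuation R (h ^ r) = int r * valuation R h" if "R \<in> places" for R
      using valuation_power[OF that h0] .
    have "0 < r" by (simp add: r_def)
    then have rpos: "int r > 0" by simp
    have less: "int r * valuation Q h < 0" using h(2) rpos by (simp add: mult_less_0_iff)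
    have z: "h ^ r + u \<noteq> 0" "valuation Q (h ^ r + u) < 0"
      using valuation_add_eq[OF Q(1) hr0 u(1)] vhr[OF Q(1)] less False by auto
    have "val_ge P 1 (h ^ r + u)"
    proof (intro val_ge_add[OF P])
      have "1 * 1 \<le> int r * valuation P h" using h rpos by (intro mult_mono) auto
      then show "val_ge P 1 (h ^ r)" by (simp add: val_ge_iff[OF P] vhr[OF P])
      show "val_ge P 1 u" using u by (simp add: val_ge_iff[OF P])
    qed
    then have "valuation P (h ^ r + u) > 0" using z(1) by (simp add: val_ge_iff[OF P])
    moreover have "valuation Q' (h ^ r + u) < 0" if Q': "Q' \<in> S" for Q'
    proof -
      have Q'p: "Q' \<in> places" using Q' S by blast
      have ne: "int r * valuation Q' h \<noteq> valuation Q' u"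
      proof
        assume eq: "int r * valuation Q' h = valuation Q' u"
        then have "valuation Q' h \<noteq> 0" using u(3)[OF Q'] by auto
        then have "int r * 1 \<le> int r * \<bar>valuation Q' h\<bar>" by (intro mult_left_mono) auto
        also have "\<dots> = \<bar>valuation Q' u\<bar>" using eq by (metis abs_mult abs_of_nat)
        finally show False using r[OF Q'] by simp
      qed
      show ?thesis
      proof (cases "int r * valuation Q' h < valuation Q' u")
        case True
        then show ?thesis
          using valuation_add_eq[OF Q'p hr0 u(1)] vhr[OF Q'p] u(3)[OF Q'] by auto
      next
        case False
        then show ?thesis
          using valuation_add_eq[OF Q'p u(1) hr0] vhr[OF Q'p] u(3)[OF Q'] ne by (auto simp: add.commute)
      qed
    qed
    ultimately show ?thesis using z by (intro exI[of _ "h ^ r + u"]) auto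
  qed
qed

text \<open>For u with a zero at P and poles at the other places, \<open>1 / (1 + u ^ r)\<close> is
  close to 1 at P and close to 0 elsewhere.\<close>

lemma weak_approximation:
  assumes S: "finite S" "S \<subseteq> places" and P: "P \<in> S"
  shows "\<exists>w. val_ge P (int s) (w - 1) \<and> (\<forall>Q\<in>S - {P}. val_ge Q (int s) w)"
proof -
  have Pp: "P \<in> places" using S P by blast
  have "\<exists>u. u \<noteq> 0 \<and> valuation P u > 0 \<and> (\<forall>Q\<in>S - {P}. valuation Q u < 0)"
    using S by (intro ex_separating[OF Pp]) auto
  then obtain u where u: "u \<noteq> 0" "valuation P u > 0" "\<And>Q. Q \<in> S - {P} \<Longrightarrow> valuation Q u < 0" by blast
  \<comment> \<open>\<open>Suc s\<close> rather than s keeps the exponent positive when s =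
    0.\<close>
  define r where "r = Suc s"
  have le: "int s \<le> int r * a" if "a > 0" for a
  proof -
    have "int s * 1 \<le> int r * a" using that by (intro mult_mono) (auto simp: r_def)
    then show ?thesis by simp
  qed
  have ur0: "u ^ r \<noteq> 0" using u by simp
  have vur: "valuation R (u ^ r) = int r * valuation R u" if "R \<in> places" for R
    using valuation_power[OF that u(1)] .
  have pos: "int r * valuation P u > 0" using u by (simp add: r_def)
  have nz: "1 + u ^ r \<noteq> 0" "valuation P (1 + u ^ r) = 0"
    using valuation_add_eq[OF Pp _ ur0, of 1] valuation_1[OF Pp] vur[OF Pp] pos by auto
  define w where "w = inverse (1 + u ^ r)"
  have "w - 1 = - (u ^ r / (1 + u ^ r))" using nz by (simp add: w_def field_simps)
  moreover have "valuation P (u ^ r / (1 + u ^ r)) = int r * valuation P u"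
    using nz ur0 vur[OF Pp] valuation_divide[OF Pp] by simp
  ultimately have "val_ge P (int s) (w - 1)"
    using le[OF u(2)] by (simp add: val_ge_iff[OF Pp] valuation_uminus[OF Pp])
  moreover have "val_ge Q (int s) w" if Q: "Q \<in> S - {P}" for Q
  proof -
    have Qp: "Q \<in> places" using Q S by blast
    have "int r * valuation Q u < 0" using u(3)[OF Q] by (simp add: r_def mult_less_0_iff)
    then have "valuation Q (u ^ r + 1) = int r * valuation Q u"
      using valuation_add_eq[OF Qp ur0, of 1] valuation_1[OF Qp] vur[OF Qp] by auto
    then have "valuation Q w = int r * (- valuation Q u)"
      using valuation_inverse[OF Qp nz(1)] by (simp add: w_def add.commute)
    then show ?thesis using le[of "- valuation Q u"] u(3)[OF Q] by (simp add: val_ge_iff[OF Qp])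
  qed
  ultimately show ?thesis by blast
qed

end

section \<open>Zeros of a function and existence of places\<close>

context function_field_const
begin

text \<open>Compares residues modulo the divisor of zeros with residues modulo y in
  \<open>R0\<close>, the intersection of the places in S. Weak approximation realizes every choice
  of residues modulo the power e P of each place by an element of \<open>R0\<close>, and different
  choices are incongruent modulo y, so \<open>card_incongruent_le\<close> bounds their
  number.\<close>

lemma zeros_degree_le:
  assumes y: "y \<notin> K" "all_dependent K y (Suc m)"
    and S: "finite S" "S \<subseteq> places" "\<And>P. P \<in> S \<Longrightarrow> valuation P y > 0"
  shows "(\<Sum>P\<in>S. nat (valuation P y) * place_deg P) \<le> m"
proof -
  have y0: "y \<noteq> 0" using y zero_K by blast
  define e where "e P = nat (valuation P y)" for P
  have e: "int (e P) = valuation P y" if "P \<in> S" for P using S(3)[OF that] by (simp add: e_def)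
  define R0 where "R0 = {z. \<forall>P\<in>S. z \<in> P}"
  have R0: "ksubspace R0"
  proof -
    have "ksubspace P" if "P \<in> S" for P using that S(2) ksubspace_place by blast
    then show ?thesis unfolding R0_def ksubspace_def by simp
  qed
  have yP: "y \<in> P" if "P \<in> S" for P
    using that S(2) S(3)[OF that] val_ge_0_iff[of P y] val_ge_iff[of P 0 y] by auto
  have yR0: "y * a \<in> R0" if "a \<in> R0" for a
    using that yP S(2) by (auto simp: R0_def intro!: place_mult)
  have "\<forall>P\<in>S. \<exists>T. T \<subseteq> P \<and> finite T \<and> card T = q ^ (e P * place_deg P) \<and>
    (\<forall>a\<in>T. \<forall>b\<in>T. val_ge P (int (e P)) (a - b) \<longrightarrow> a = b)"
    using ex_residue_system S(2) by blast
  then obtain T where T: "\<And>P. P \<in> S \<Longrightarrow> T P \<subseteq> P" "\<And>P. P \<in> S \<Longrightarrow> finite (T P)"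
    "\<And>P. P \<in> S \<Longrightarrow> card (T P) = q ^ (e P * place_deg P)"
    "\<And>P a b. P \<in> S \<Longrightarrow> a \<in> T P \<Longrightarrow> b \<in> T P \<Longrightarrow> val_ge P (int (e P)) (a - b) \<Longrightarrow> a = b"
    by metis
  \<comment> \<open>Precision of the approximation: an element a of \<open>T P\<close> may have a
    pole at another place Q, and s is so large that the errors \<open>(w P - 1) * a\<close> at P and
    \<open>w P * a\<close> at Q still vanish to the orders e P and e Q.\<close>
  define s where "s = (\<Sum>Q\<in>S. \<Sum>P\<in>S. \<Sum>a\<in>T P. nat (int (e Q) - valuation Q a))"
  have s: "int (e Q) \<le> int s + valuation Q a" if "Q \<in> S" "P \<in> S" "a \<in> T P" for Q P a
  proof -
    have "nat (int (e Q) - valuation Q a) \<le> (\<Sum>a\<in>T P. nat (int (e Q) - valuation Q a))"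
      using T that by (intro member_le_sum) auto
    also have "\<dots> \<le> (\<Sum>P\<in>S. \<Sum>a\<in>T P. nat (int (e Q) - valuation Q a))"
      using that S(1) by (intro member_le_sum[of P S "\<lambda>P. \<Sum>a\<in>T P. nat (int (e Q) - valuation Q a)"]) auto
    also have "\<dots> \<le> s"
      unfolding s_def
      using that S(1) by (intro member_le_sum[of Q S "\<lambda>Q. \<Sum>P\<in>S. \<Sum>a\<in>T P. nat (int (e Q) - valuation Q a)"]) auto
    finally show ?thesis by linarith
  qed
  have "\<forall>P\<in>S. \<exists>w. val_ge P (int s) (w - 1) \<and> (\<forall>Q\<in>S - {P}. val_ge Q (int s) w)"
    using weak_approximation[OF S(1,2)] by blast
  then obtain w where w: "\<And>P. P \<in> S \<Longrightarrow> val_ge P (int s) (w P - 1)"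
    "\<And>P Q. P \<in> S \<Longrightarrow> Q \<in> S \<Longrightarrow> Q \<noteq> P \<Longrightarrow> val_ge Q (int s) (w P)" by (metis DiffI singletonD)
  have ge_self: "val_ge Q (valuation Q a) a" if "Q \<in> S" for Q a
    using that S(2) val_ge_iff by blast
  have w1: "val_ge P (int (e P)) (w P * a - a)" if "P \<in> S" "a \<in> T P" for P a
  proof -
    have Pp: "P \<in> places" using that S by blast
    have "val_ge P (int s + valuation P a) ((w P - 1) * a)"
      using that by (intro val_ge_mult[OF Pp] w ge_self)
    then show ?thesis using val_ge_mono[OF Pp] s that by (simp add: left_diff_distrib)
  qed
  have w2: "val_ge Q (int (e Q)) (w P * a)" if "P \<in> S" "Q \<in> S" "Q \<noteq> P" "a \<in> T P" for P Q a
  proof -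
    have Qp: "Q \<in> places" using that S by blast
    have "val_ge Q (int s + valuation Q a) (w P * a)"
      using that by (intro val_ge_mult[OF Qp] w ge_self) auto
    then show ?thesis using val_ge_mono[OF Qp] s that by blast
  qed
  \<comment> \<open>Glues the local choices into one function, congruent to \<open>\<rho> P\<close>
    at each P.\<close>
  define z where "z \<rho> = (\<Sum>P\<in>S. w P * \<rho> P)" for \<rho>
  define A where "A = Pi\<^sub>E S T"
  have z: "val_ge P (int (e P)) (z \<rho> - \<rho> P)" if "\<rho> \<in> A" "P \<in> S" for \<rho> P
  proof -
    have Pp: "P \<in> places" using that S by blast
    have mem: "\<rho> Q \<in> T Q" if "Q \<in> S" for Q using \<open>\<rho> \<in> A\<close> that by (auto simp: A_def)
    have "z \<rho> - \<rho> P = (w P * \<rho> P - \<rho> P) + (\<Sum>Q\<in>S - {P}. w Q * \<rho> Q)"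
      using that S(1) by (simp add: z_def sum.remove[of S P])
    moreover have "val_ge P (int (e P)) \<dots>"
      using that mem by (intro val_ge_add[OF Pp] w1 val_ge_sum[OF Pp] w2) auto
    ultimately show ?thesis by (simp only:)
  qed
  have eq: "\<rho> = \<rho>'" if \<rho>: "\<rho> \<in> A" "\<rho>' \<in> A" and d: "(z \<rho> - z \<rho>') / y \<in> R0" for \<rho> \<rho>'
  proof -
    have "\<rho> P = \<rho>' P" if "P \<in> S" for P
    proof (rule T(4)[OF that])
      show "\<rho> P \<in> T P" "\<rho>' P \<in> T P" using \<rho> that by (auto simp: A_def)
      have Pp: "P \<in> places" using that S by blast
      have "val_ge P (0 + int (e P)) ((z \<rho> - z \<rho>') / y * y)"
        using d that e[OF that] ge_self[OF that, of y]
        by (intro val_ge_mult[OF Pp]) (auto simp: val_ge_0_iff[OF Pp] R0_def)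
      then have d': "val_ge P (int (e P)) (z \<rho> - z \<rho>')" using y0 by simp
      have "val_ge P (int (e P)) ((z \<rho> - z \<rho>') - (z \<rho> - \<rho> P) + (z \<rho>' - \<rho>' P))"
        by (rule val_ge_add[OF Pp val_ge_diff[OF Pp d' z[OF \<rho>(1) that]] z[OF \<rho>(2) that]])
      then show "val_ge P (int (e P)) (\<rho> P - \<rho>' P)" by simp
    qed
    then show ?thesis using \<rho> unfolding A_def by (intro PiE_ext[OF \<rho>[unfolded A_def]]) auto
  qed
  have zR0: "z \<rho> \<in> R0" if "\<rho> \<in> A" for \<rho>
    unfolding R0_def
  proof safe
    fix P assume P: "P \<in> S"
    have Pp: "P \<in> places" using P S by blast
    have "\<rho> P \<in> P" using that P T by (auto simp: A_def)
    then have "val_ge P 0 (z \<rho> - \<rho> P + \<rho> P)"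
      using z[OF that P] by (intro val_ge_add[OF Pp]) (auto simp: val_ge_0_iff[OF Pp] intro: val_ge_mono[OF Pp, of "int (e P)" _ 0, unfolded val_ge_0_iff[OF Pp]])
    then show "z \<rho> \<in> P" by (simp add: val_ge_0_iff[OF Pp])
  qed
  have inj: "inj_on z A"
    by (rule inj_onI) (use eq ksubspace_0[OF R0] in auto)
  have "card (z ` A) \<le> q ^ m"
    by (rule conjunct2[OF card_incongruent_le[OF R0 yR0 y0 y(2)]]) (use eq zR0 in auto)
  then have "card A \<le> q ^ m" using inj by (simp add: card_image)
  moreover have "card A = (\<Prod>P\<in>S. q ^ (e P * place_deg P))"
    using S(1) T(3) by (simp add: A_def card_PiE)
  moreover have "\<dots> = q ^ (\<Sum>P\<in>S. e P * place_deg P)" by (simp add: power_sum)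
  ultimately have "q ^ (\<Sum>P\<in>S. e P * place_deg P) \<le> q ^ m" by simp
  then show ?thesis unfolding e_def using q_ge_2 by simp
qed

lemma finite_zeros:
  assumes "y \<notin> K" shows "finite {P\<in>places. valuation P y > 0}"
proof (rule ccontr)
  assume inf: "infinite {P\<in>places. valuation P y > 0}"
  obtain n where "all_dependent K y n" using ex_all_dependent assms by blast
  moreover from this have "n \<noteq> 0" by (auto simp: all_dependent_def)
  ultimately obtain m where m: "all_dependent K y (Suc m)" by (cases n) auto
  obtain S where S: "finite S" "card S = Suc m" "S \<subseteq> {P\<in>places. valuation P y > 0}"
    using infinite_arbitrarily_large[OF inf, of "Suc m"] by blast
  have "Suc m = (\<Sum>P\<in>S. 1)" using S by simp
  also have "\<dots> \<le> (\<Sum>P\<in>S. nat (valuation P y) * place_deg P)"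
  proof (rule sum_mono)
    fix P assume "P \<in> S"
    then have "0 < nat (valuation P y) * place_deg P" using S place_deg_pos by auto
    then show "1 \<le> nat (valuation P y) * place_deg P" by linarith
  qed
  also have "\<dots> \<le> m" using S by (intro zeros_degree_le assms m) auto
  finally show False by simp
qed

lemma valuation_K:
  assumes "P \<in> places" "c \<in> K" "c \<noteq> 0" shows "valuation P c = 0"
proof -
  have "0 \<le> valuation P c" "0 \<le> valuation P (inverse c)"
    using assms val_ge_K[OF assms(1)] inverse_K val_ge_iff[OF assms(1)] by (metis, metis inverse_nonzero_iff_nonzero)
  then show ?thesis using valuation_inverse assms by simp
qed

lemma finite_valuation_support:
  assumes "y \<noteq> 0" shows "finite {P\<in>places. valuation P y \<noteq> 0}"
proof (cases "y \<in> K")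
  case True
  then have empty: "{P\<in>places. valuation P y \<noteq> 0} = {}" using valuation_K assms by auto
  show ?thesis unfolding empty by simp
next
  case False
  have "inverse y \<notin> K" using False inverse_K[of "inverse y"] by auto
  moreover have "{P\<in>places. valuation P y \<noteq> 0} \<subseteq>
      {P\<in>places. valuation P y > 0} \<union> {P\<in>places. valuation P (inverse y) > 0}"
    using valuation_inverse assms by auto
  ultimately show ?thesis using finite_zeros False finite_subset by blast
qed

end

text \<open>One step of the descent in Chevalley's extension theorem.\<close>

lemma reduce_degree:
  fixes M :: "'a::field set" and a z :: 'a
  assumes M: "0 \<in> M" "1 \<in> M" "\<And>a b. a \<in> M \<Longrightarrow> b \<in> M \<Longrightarrow> a + b \<in> M" "\<And>a b. a \<in> M \<Longrightarrow> b \<in> M \<Longrightarrow> a * b \<in> M"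
    "\<And>a. a \<in> M \<Longrightarrow> - a \<in> M" "z \<in> M"
    and p: "p \<in> polys_over M" "poly p a * z = 1" "degree p > 0"
    and r: "r \<in> polys_over M" "poly r (inverse a) * z = 1" "degree r \<le> degree p" and a: "a \<noteq> 0"
  shows "\<exists>p'\<in>polys_over M. poly p' a * z = 1 \<and> degree p' < degree p"
proof -
  let ?n = "degree p" and ?m = "degree r"
  have diff: "a - b \<in> M" if "a \<in> M" "b \<in> M" for a b using M(3)[of a "- b"] M(5) that by simp
  \<comment> \<open>By the relation for \<open>inverse a\<close>, c equals z times the sum of
    \<open>coeff r j * inverse a ^ j\<close> over j \<ge> 1. So c times the leading term of p,
    evaluated at a, is \<open>l * z * poly r1 a\<close>, a combination of lower powers whose
    exponents are nonnegative because deg r \<le> deg p. Hence p' takes the value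
    \<open>coeff r 0 + c * poly p a\<close> at a, and z times it is 1.\<close>
  define c where "c = 1 - z * coeff r 0"
  define l where "l = coeff p ?n"
  define p1 where "p1 = p - monom l ?n"
  define r1 where "r1 = (\<Sum>j\<in>{1..?m}. monom (coeff r j) (?n - j))"
  define p' where "p' = [:coeff r 0:] + smult c p1 + smult (l * z) r1"
  have pM: "coeff p i \<in> M" and rM: "coeff r i \<in> M" for i using p(1) r(1) by (auto simp: polys_over_def)
  have cM: "c \<in> M" unfolding c_def by (intro diff M(2,4,6) rM)
  have p1M: "coeff p1 i \<in> M" for i using pM M(1) by (auto simp: p1_def l_def)
  have r1M: "coeff r1 i \<in> M" for i
    unfolding r1_def coeff_sum using M(1) rM by (intro sum_mem M(1,3)) auto
  have "p' \<in> polys_over M"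
    unfolding polys_over_def
  proof safe
    fix i
    have "coeff [:coeff r 0:] i \<in> M" using rM M(1) by (cases i) auto
    then have "coeff [:coeff r 0:] i + c * coeff p1 i + l * z * coeff r1 i \<in> M"
      unfolding l_def by (intro M(3,4,6) cM p1M r1M pM)
    then show "coeff p' i \<in> M" by (simp add: p'_def)
  qed
  moreover have "degree p' < degree p"
  proof -
    have "coeff p' i = 0" if "i > ?n - 1" for i
    proof -
      have i: "i \<ge> ?n" "i > 0" using that p(3) by auto
      have "coeff p1 i = 0" using i by (cases "i = ?n") (auto simp: p1_def l_def coeff_eq_0)
      moreover have "coeff r1 i = 0" unfolding r1_def coeff_sum using i by (intro sum.neutral) auto
      ultimately show ?thesis using i by (simp add: p'_def coeff_pCons split: nat.splits)
    qed
    then have "degree p' \<le> ?n - 1" by (intro degree_le) auto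
    then show ?thesis using p(3) by simp
  qed
  moreover have "poly p' a * z = 1"
  proof -
    have p1: "poly p1 a = poly p a - l * a ^ ?n" by (simp add: p1_def poly_monom)
    have "poly r (inverse a) = (\<Sum>j\<le>?m. coeff r j * inverse a ^ j)" by (rule poly_altdef)
    also have "{..?m} = insert 0 {1..?m}" by auto
    finally have r0: "poly r (inverse a) = coeff r 0 + (\<Sum>j\<in>{1..?m}. coeff r j * inverse a ^ j)" by simp
    have "poly r1 a = (\<Sum>j\<in>{1..?m}. coeff r j * a ^ (?n - j))"
      by (simp add: r1_def poly_sum poly_monom)
    also have "\<dots> = (\<Sum>j\<in>{1..?m}. a ^ ?n * (coeff r j * inverse a ^ j))"
      using r(3) a by (intro sum.cong refl) (auto simp: power_diff field_simps)
    also have "\<dots> = a ^ ?n * (poly r (inverse a) - coeff r 0)"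
      unfolding r0 by (simp add: sum_distrib_left)
    finally have r1: "poly r1 a = a ^ ?n * (poly r (inverse a) - coeff r 0)" .
    have "poly p' a * z = coeff r 0 * z + c * (poly p a * z) - c * l * a ^ ?n * z + l * a ^ ?n * z * (poly r (inverse a) * z - coeff r 0 * z)"
      by (simp add: p'_def p1 r1 algebra_simps)
    also have "\<dots> = coeff r 0 * z + c" unfolding p(2) r(2) by (simp add: c_def algebra_simps)
    finally show ?thesis by (simp add: c_def algebra_simps)
  qed
  ultimately show ?thesis by blast
qed

context function_field_const
begin

text \<open>Zorn's lemma gives a maximal ring M that contains K and z but misses
  \<open>inverse z\<close>. It is a valuation ring by Chevalley's descent, and z is one of its
  non-units.\<close>

lemma ex_place:
  assumes z: "z \<notin> K"
  shows "\<exists>P\<in>places. z \<in> max_ideal P"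
proof -
  have z0: "z \<noteq> 0" using z zero_K by blast
  define ring_at where "ring_at S \<longleftrightarrow> K \<subseteq> S \<and> (\<forall>a\<in>S. \<forall>b\<in>S. a + b \<in> S \<and> a * b \<in> S)" for S
  define F where "F = {S. ring_at S \<and> z \<in> S \<and> inverse z \<notin> S}"
  define adj where "adj M a = {poly p a | p. p \<in> polys_over M}" for M and a :: 'a
  have neg: "- a \<in> M" if "ring_at M" "a \<in> M" for M a
  proof -
    have "- 1 \<in> M" using that uminus_K[OF one_K] by (auto simp: ring_at_def)
    then have "- 1 * a \<in> M" using that unfolding ring_at_def by blast
    then show ?thesis by simp
  qed
  have sum_M: "sum f I \<in> M" if "ring_at M" "\<And>i. i \<in> I \<Longrightarrow> f i \<in> M" for f :: "nat \<Rightarrow> 'a" and I M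
    by (rule sum_mem) (use that zero_K in \<open>auto simp: ring_at_def\<close>)
  have adj: "ring_at (adj M a) \<and> M \<subseteq> adj M a \<and> a \<in> adj M a" if M: "ring_at M" for M a
  proof -
    have M0: "0 \<in> M" "1 \<in> M" using M zero_K one_K by (auto simp: ring_at_def)
    have sub: "M \<subseteq> adj M a"
    proof
      fix b assume "b \<in> M"
      then have "[:b:] \<in> polys_over M" using M0 by (auto simp: polys_over_def coeff_pCons split: nat.splits)
      then show "b \<in> adj M a" unfolding adj_def by (auto intro!: exI[of _ "[:b:]"])
    qed
    moreover have "[:0, 1:] \<in> polys_over M" using M0 by (auto simp: polys_over_def coeff_pCons split: nat.splits)
    then have "a \<in> adj M a" unfolding adj_def by (auto intro!: exI[of _ "[:0, 1:]"])
    moreover have pr: "p + r \<in> polys_over M \<and> p * r \<in> polys_over M" if "p \<in> polys_over M" "r \<in> polys_over M" for p r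
      using that M unfolding polys_over_def by (auto simp: ring_at_def coeff_mult intro!: sum_M[OF M])
    then have "b + c \<in> adj M a \<and> b * c \<in> adj M a" if bc: "b \<in> adj M a" "c \<in> adj M a" for b c
    proof -
      obtain p r where "b = poly p a" "c = poly r a" "p \<in> polys_over M" "r \<in> polys_over M"
        using bc by (auto simp: adj_def)
      then show ?thesis
        using pr[of p r] unfolding adj_def
        by (auto simp flip: poly_add poly_mult)
    qed
    moreover have "K \<subseteq> adj M a" using sub M by (auto simp: ring_at_def)
    ultimately show ?thesis unfolding ring_at_def by blast
  qed
  have "ring_at K" using add_K mult_K by (auto simp: ring_at_def)
  note adjK = adj[OF this, of z]
  have "inverse z \<notin> adj K z"
  proof
    assume "inverse z \<in> adj K z"
    then obtain p where p: "inverse z = poly p z" "p \<in> polys_over K" by (auto simp: adj_def)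
    have "pCons (- 1) p \<in> polys_over K"
      using p(2) uminus_K[OF one_K] by (auto simp: polys_over_def coeff_pCons split: nat.splits)
    moreover have "poly (pCons (- 1) p) z = 0" using p(1) z0 by (simp flip: p(1))
    ultimately show False using transcendental[OF z] by fastforce
  qed
  then have ne: "F \<noteq> {}" using adjK by (auto simp: F_def)
  obtain M where M: "M \<in> F" "\<And>V. V \<in> F \<Longrightarrow> M \<subseteq> V \<Longrightarrow> V = M"
  proof (rule bexE[OF subset_Zorn_nonempty[OF ne]])
    fix C assume C: "C \<noteq> {}" "subset.chain F C"
    have CF: "C \<subseteq> F" using C(2) by (simp add: subset.chain_def)
    have clos: "a + b \<in> \<Union>C \<and> a * b \<in> \<Union>C" if ab: "a \<in> \<Union>C" "b \<in> \<Union>C" for a b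
    proof -
      obtain V Y where XY: "V \<in> C" "a \<in> V" "Y \<in> C" "b \<in> Y" using ab by blast
      then have "V \<subseteq> Y \<or> Y \<subseteq> V" using C(2) unfolding subset.chain_def by blast
      then obtain W where "W \<in> C" "a \<in> W" "b \<in> W" using XY by blast
      moreover have "ring_at W" using CF \<open>W \<in> C\<close> by (auto simp: F_def)
      ultimately show ?thesis unfolding ring_at_def by blast
    qed
    obtain V where "V \<in> C" using C(1) by blast
    moreover have "K \<subseteq> V" "z \<in> V" using CF \<open>V \<in> C\<close> by (auto simp: F_def ring_at_def)
    ultimately have "K \<subseteq> \<Union>C" "z \<in> \<Union>C" by blast+
    moreover have "inverse z \<notin> \<Union>C" using CF by (auto simp: F_def)
    ultimately show "\<Union>C \<in> F" using clos unfolding F_def ring_at_def by blast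
  qed blast
  have rM: "ring_at M" and zM: "z \<in> M" "inverse z \<notin> M" using M(1) by (auto simp: F_def)
  have MK: "0 \<in> M" "1 \<in> M" using rM zero_K one_K by (auto simp: ring_at_def)
  \<comment> \<open>By maximality of M, adjoining an element a outside M produces
    \<open>inverse z\<close>, which is then a polynomial in a over M.\<close>
  have ex: "\<exists>p. p \<in> polys_over M \<and> poly p a * z = 1 \<and> degree p > 0" if a: "a \<notin> M" for a
  proof -
    have "adj M a \<notin> F" using M(2)[of "adj M a"] adj[OF rM, of a] a by blast
    then have "inverse z \<in> adj M a" using adj[OF rM, of a] zM by (auto simp: F_def)
    then obtain p where p: "p \<in> polys_over M" "inverse z = poly p a" by (auto simp: adj_def)
    have "degree p \<noteq> 0"
    proof
      assume "degree p = 0"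
      then obtain b where "p = [:b:]" by (rule degree_eq_zeroE)
      then have "inverse z = coeff p 0" using p(2) by simp
      then show False using p(1) zM by (auto simp: polys_over_def)
    qed
    then show ?thesis using p z0 by (intro exI[of _ p]) (auto simp flip: p(2))
  qed
  have "a \<in> M \<or> inverse a \<in> M" for a
  proof (rule ccontr)
    assume "\<not> ?thesis"
    then have a: "a \<notin> M" "inverse a \<notin> M" by auto
    then have a0: "a \<noteq> 0" using MK by auto
    define good where "good b p \<longleftrightarrow> p \<in> polys_over M \<and> poly p b * z = 1" for b p
    have deg0: "degree p > 0" if "good b p" "b \<notin> M" for b p
    proof (rule ccontr)
      assume "\<not> ?thesis"
      then obtain c where "p = [:c:]" by (auto elim: degree_eq_zeroE)
      then have "c = inverse z" "c \<in> M" using that z0 by (auto simp: good_def polys_over_def coeff_pCons field_simps split: nat.splits)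
      then show False using zM by simp
    qed
    \<comment> \<open>Relations of minimal degree for a and for \<open>inverse a\<close>; the one of
      larger degree can be shortened with the help of the other.\<close>
    obtain p where p: "good a p" "\<And>p'. good a p' \<Longrightarrow> degree p \<le> degree p'"
      using ex[OF a(1)] ex_has_least_nat[of "good a" _ degree] unfolding good_def by metis
    obtain r where r: "good (inverse a) r" "\<And>r'. good (inverse a) r' \<Longrightarrow> degree r \<le> degree r'"
      using ex[OF a(2)] ex_has_least_nat[of "good (inverse a)" _ degree] unfolding good_def by metis
    have clos: "\<And>a b. a \<in> M \<Longrightarrow> b \<in> M \<Longrightarrow> a + b \<in> M" "\<And>a b. a \<in> M \<Longrightarrow> b \<in> M \<Longrightarrow> a * b \<in> M"
      using rM by (auto simp: ring_at_def)
    show False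
    proof (cases "degree r \<le> degree p")
      case True
      have "\<exists>p'\<in>polys_over M. poly p' a * z = 1 \<and> degree p' < degree p"
        using p r True deg0[OF p(1) a(1)] a0 unfolding good_def
        by (intro reduce_degree[of M z p a r] MK clos neg[OF rM] zM) auto
      then show False using p(2) unfolding good_def by force
    next
      case False
      have "\<exists>p'\<in>polys_over M. poly p' (inverse a) * z = 1 \<and> degree p' < degree r"
        using p r False deg0[OF r(1) a(2)] a0 unfolding good_def
        by (intro reduce_degree[of M z r "inverse a" p] MK clos neg[OF rM] zM) auto
      then show False using r(2) unfolding good_def by force
    qed
  qed
  then have "M \<in> places" using rM zM unfolding places_def ring_at_def by blast
  moreover have "z \<in> max_ideal M" using zM by (simp add: max_ideal_def)
  ultimately show ?thesis by blast
qed

end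

section \<open>Riemann's theorem\<close>

abbreviation lookup :: "('b \<Rightarrow>\<^sub>0 'c::zero) \<Rightarrow> 'b \<Rightarrow> 'c" where "lookup \<equiv> Poly_Mapping.lookup"
abbreviation keys :: "('b \<Rightarrow>\<^sub>0 'c::zero) \<Rightarrow> 'b set" where "keys \<equiv> Poly_Mapping.keys"

context function_field_const
begin

section \<open>Divisors, principal divisors and Riemann-Roch spaces\<close>

definition ddeg :: "('a set \<Rightarrow>\<^sub>0 int) \<Rightarrow> int" where
  "ddeg A = (\<Sum>P\<in>keys A. lookup A P * int (place_deg P))"

definition div_le :: "('a set \<Rightarrow>\<^sub>0 int) \<Rightarrow> ('a set \<Rightarrow>\<^sub>0 int) \<Rightarrow> bool" where
  "div_le A B \<longleftrightarrow> (\<forall>P\<in>places. lookup A P \<le> lookup B P)"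

text \<open>The Riemann-Roch space \<open>L(A)\<close>; \<open>val_ge\<close> admits 0 as an
  element.\<close>

definition RR :: "('a set \<Rightarrow>\<^sub>0 int) \<Rightarrow> 'a set" where
  "RR A = {z. \<forall>P\<in>places. val_ge P (- lookup A P) z}"

definition prdiv :: "'a \<Rightarrow> ('a set \<Rightarrow>\<^sub>0 int)" where
  "prdiv y = Abs_poly_mapping (\<lambda>P. if P \<in> places \<and> y \<noteq> 0 then valuation P y else 0)"

text \<open>Applied to \<open>prdiv y\<close> this is the divisor of zeros of y, applied to
  \<open>- prdiv y\<close> the divisor of its poles.\<close>

definition pos_part :: "('a set \<Rightarrow>\<^sub>0 int) \<Rightarrow> ('a set \<Rightarrow>\<^sub>0 int)" where
  "pos_part A = Poly_Mapping.map (max 0) A"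

lemma ddeg_eq: "finite F \<Longrightarrow> keys A \<subseteq> F \<Longrightarrow> ddeg A = (\<Sum>P\<in>F. lookup A P * int (place_deg P))"
  unfolding ddeg_def by (intro sum.mono_neutral_left) (auto simp: in_keys_iff)

lemma ddeg_add: "ddeg (A + B) = ddeg A + ddeg B"
proof -
  let ?F = "keys A \<union> keys B"
  have "keys (A + B) \<subseteq> ?F" by (auto simp: in_keys_iff lookup_add)
  then show ?thesis
    using ddeg_eq[of ?F "A + B"] ddeg_eq[of ?F A] ddeg_eq[of ?F B]
    by (simp add: lookup_add ring_distribs sum.distrib)
qed

lemma ddeg_0 [simp]: "ddeg 0 = 0"
  by (simp add: ddeg_def)

lemma ddeg_uminus: "ddeg (- A) = - ddeg A"
  using ddeg_add[of A "- A"] by simp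

lemma ddeg_diff: "ddeg (A - B) = ddeg A - ddeg B"
  using ddeg_add[of A "- B"] ddeg_uminus by simp

lemma ddeg_sum: "ddeg (\<Sum>i\<in>I. f i) = (\<Sum>i\<in>I. ddeg (f i))"
  by (induction I rule: infinite_finite_induct) (auto simp: ddeg_add)

lemma ddeg_single: "ddeg (Poly_Mapping.single P k) = k * int (place_deg P)"
  by (simp add: ddeg_def lookup_single)

lemma ddeg_mono:
  assumes "div_le A B"
  shows "ddeg A \<le> ddeg B"
proof -
  have "0 \<le> ddeg (B - A)"
    unfolding ddeg_def
  proof (rule sum_nonneg)
    fix P
    show "0 \<le> lookup (B - A) P * int (place_deg P)"
      using assms by (cases "P \<in> places") (auto simp: div_le_def lookup_minus place_deg_def)
  qed
  then show ?thesis by (simp add: ddeg_diff)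
qed

lemma lookup_pos_part: "lookup (pos_part A) P = max 0 (lookup A P)"
  by (simp add: pos_part_def map.rep_eq when_def)

lemma lookup_prdiv: "y \<noteq> 0 \<Longrightarrow> lookup (prdiv y) P = (if P \<in> places then valuation P y else 0)"
  unfolding prdiv_def
proof (subst Abs_poly_mapping_inverse)
  assume "y \<noteq> 0"
  have "{P. (if P \<in> places \<and> y \<noteq> 0 then valuation P y else 0) \<noteq> 0} \<subseteq> {P \<in> places. valuation P y \<noteq> 0}" by auto
  then show "(\<lambda>P. if P \<in> places \<and> y \<noteq> 0 then valuation P y else 0) \<in> {f. finite {x. f x \<noteq> 0}}"
    using finite_valuation_support[OF \<open>y \<noteq> 0\<close>] finite_subset by blast
qed simp

lemma prdiv_inverse: "y \<noteq> 0 \<Longrightarrow> prdiv (inverse y) = - prdiv y"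
  by (intro poly_mapping_eqI) (simp add: lookup_prdiv valuation_inverse)

lemma prdiv_mult: "y \<noteq> 0 \<Longrightarrow> z \<noteq> 0 \<Longrightarrow> prdiv (y * z) = prdiv y + prdiv z"
  by (intro poly_mapping_eqI) (simp add: lookup_prdiv valuation_mult lookup_add)

lemma prdiv_K: "c \<in> K \<Longrightarrow> c \<noteq> 0 \<Longrightarrow> prdiv c = 0"
  by (intro poly_mapping_eqI) (simp add: lookup_prdiv valuation_K)

lemma RR_nz_iff: "z \<noteq> 0 \<Longrightarrow> z \<in> RR A \<longleftrightarrow> div_le 0 (A + prdiv z)"
  by (auto simp: RR_def val_ge_iff div_le_def lookup_add lookup_prdiv)

lemma zero_in_RR: "0 \<in> RR A"
  by (auto simp: RR_def val_ge_0)

lemma ksubspace_RR: "ksubspace (RR A)"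
  unfolding ksubspace_def RR_def using val_ge_add val_ge_K_mult val_ge_0 by blast

lemma RR_mono: "div_le A B \<Longrightarrow> RR A \<subseteq> RR B"
  by (auto simp: RR_def div_le_def intro: val_ge_mono)

text \<open>A function without poles is constant: for z outside K, the inverse of z vanishes at some
  place, and there z has a pole.\<close>

lemma RR_0: "RR 0 = K"
proof
  show "K \<subseteq> RR 0" using val_ge_K by (auto simp: RR_def)
  show "RR 0 \<subseteq> K"
  proof
    fix z assume z: "z \<in> RR 0"
    show "z \<in> K"
    proof (rule ccontr)
      assume "z \<notin> K"
      then have "inverse z \<notin> K" using inverse_K[of "inverse z"] by auto
      then obtain P where "P \<in> places" "inverse z \<in> max_ideal P" using ex_place by blast
      moreover from this have "z \<in> P" using z by (simp add: RR_def val_ge_0_iff)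
      moreover have "z \<noteq> 0" using \<open>z \<notin> K\<close> zero_K by blast
      ultimately show False by (simp add: max_ideal_def)
    qed
  qed
qed

lemma card_le_fibres:
  assumes "finite C" "f ` G \<subseteq> C" "\<And>c. c \<in> C \<Longrightarrow> finite {z\<in>G. f z = c} \<and> card {z\<in>G. f z = c} \<le> N"
  shows "finite G \<and> card G \<le> N * card C"
proof -
  have G: "G = (\<Union>c\<in>C. {z\<in>G. f z = c})" using assms by auto
  have "finite G" by (subst G) (use assms in auto)
  moreover have "card G \<le> (\<Sum>c\<in>C. card {z\<in>G. f z = c})"
    by (subst G) (intro card_UN_le assms)
  moreover have "\<dots> \<le> of_nat (card C) * N" using assms by (intro sum_bounded_above) auto
  ultimately show ?thesis by (simp add: mult.commute)
qed

text \<open>With k the pole order newly allowed at P, the residue of z times the k-th power of the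
  uniformizer maps the larger space to the residue field, and two elements with the same residue
  differ by an element of \<open>L(A)\<close>.\<close>

lemma RR_step:
  assumes P: "P \<in> places" and fin: "finite (RR A)"
  shows "finite (RR (A + Poly_Mapping.single P 1)) \<and>
    card (RR (A + Poly_Mapping.single P 1)) \<le> card (RR A) * q ^ place_deg P"
proof -
  define k where "k = lookup A P + 1"
  define B where "B = A + Poly_Mapping.single P 1"
  let ?t = "uniformizer P powi k"
  have t0: "?t \<noteq> 0" using uniformizer(1)[OF P] by simp
  have vt: "val_ge P k ?t"
    using uniformizer(1)[OF P] place_1[OF P] by (simp add: val_ge_def)
  have lookB: "lookup B Q = (if Q = P then k else lookup A Q)" for Q
    by (simp add: B_def k_def lookup_add lookup_single)
  have tz: "z * ?t \<in> P" if "z \<in> RR B" for z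
  proof -
    have "val_ge P (- k + k) (z * ?t)"
      using that P lookB by (intro val_ge_mult[OF P] vt) (auto simp: RR_def)
    then show ?thesis by (simp add: val_ge_0_iff[OF P])
  qed
  define f where "f z = (SOME a. a \<in> residues P \<and> z * ?t - a \<in> max_ideal P)" for z
  have f: "f z \<in> residues P" "z * ?t - f z \<in> max_ideal P" if "z \<in> RR B" for z
    using someI_ex[of "\<lambda>a. a \<in> residues P \<and> z * ?t - a \<in> max_ideal P"] residues(4)[OF P tz[OF that]]
    unfolding f_def by blast+
  have diff: "z - w \<in> RR A" if "z \<in> RR B" "w \<in> RR B" "f z = f w" for z w
  proof -
    have zw: "z - w \<in> RR B" by (rule ksubspace_diff[OF ksubspace_RR that(1,2)])
    have "(z * ?t - f z) - (w * ?t - f w) \<in> max_ideal P"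
      by (intro ksubspace_diff[OF ksubspace_max_ideal[OF P]] f that)
    then have "val_ge P 1 ((z - w) * ?t)" using that(3) val_ge_1_iff[OF P] by (simp add: left_diff_distrib)
    moreover have "val_ge P (- k) (inverse ?t)"
      using place_1[OF P] uniformizer(1)[OF P] by (simp add: val_ge_def power_int_minus)
    ultimately have "val_ge P (1 + - k) ((z - w) * ?t * inverse ?t)" by (rule val_ge_mult[OF P])
    moreover have "(z - w) * ?t * inverse ?t = z - w" using t0 by (simp add: mult.assoc)
    ultimately have "val_ge P (1 + - k) (z - w)" by (simp only:)
    then have "val_ge P (- lookup A P) (z - w)" by (simp add: k_def)
    then show ?thesis using zw lookB unfolding RR_def by (auto split: if_splits)
  qed
  have "finite (RR B) \<and> card (RR B) \<le> card (RR A) * card (residues P)"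
  proof (rule card_le_fibres[of _ f])
    show "finite (residues P)" by (rule residues(1)[OF P])
    show "f ` RR B \<subseteq> residues P" using f by blast
    fix c
    show "finite {z \<in> RR B. f z = c} \<and> card {z \<in> RR B. f z = c} \<le> card (RR A)"
    proof (cases "{z \<in> RR B. f z = c} = {}")
      case True
      show ?thesis unfolding True by simp
    next
      case False
      then obtain w where w: "w \<in> RR B" "f w = c" by blast
      have "inj_on (\<lambda>z. z - w) {z \<in> RR B. f z = c}" by (auto simp: inj_on_def)
      moreover have "(\<lambda>z. z - w) ` {z \<in> RR B. f z = c} \<subseteq> RR A" using diff w by auto
      ultimately show ?thesis using fin card_inj_on_le inj_on_finite by blast
    qed
  qed
  then show ?thesis using card_residues[OF P] by (simp add: B_def)
qed

text \<open>Adds one place at a time; the degree difference decreases strictly because places have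
  positive degree.\<close>

lemma RR_card_le:
  assumes "div_le A B" "finite (RR A)"
  shows "finite (RR B) \<and> card (RR B) \<le> card (RR A) * q ^ nat (ddeg B - ddeg A)"
  using assms
proof (induction "nat (ddeg B - ddeg A)" arbitrary: A rule: less_induct)
  case less
  show ?case
  proof (cases "\<exists>P\<in>places. lookup A P < lookup B P")
    case False
    then have "div_le B A" by (auto simp: div_le_def not_less)
    then have "RR A = RR B" "ddeg A = ddeg B"
      using less.prems RR_mono[of A B] RR_mono[of B A] ddeg_mono[of A B] ddeg_mono[of B A] by auto
    then show ?thesis using less.prems by simp
  next
    case True
    then obtain P where P: "P \<in> places" "lookup A P < lookup B P" by blast
    define A' where "A' = A + Poly_Mapping.single P 1"
    have le: "div_le A' B"
      using less.prems(1) P by (auto simp: A'_def div_le_def lookup_add lookup_single when_def)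
    have deg: "ddeg A' = ddeg A + int (place_deg P)" by (simp add: A'_def ddeg_add ddeg_single)
    have pos: "place_deg P > 0" by (rule place_deg_pos[OF P(1)])
    have degB: "ddeg A' \<le> ddeg B" by (rule ddeg_mono[OF le])
    have step: "finite (RR A')" "card (RR A') \<le> card (RR A) * q ^ place_deg P"
      using RR_step[OF P(1) less.prems(2)] by (auto simp: A'_def)
    have IH: "finite (RR B)" "card (RR B) \<le> card (RR A') * q ^ nat (ddeg B - ddeg A')"
      using less.hyps[of A'] le step(1) deg pos degB by auto
    have "card (RR B) \<le> (card (RR A) * q ^ place_deg P) * q ^ nat (ddeg B - ddeg A')"
      using IH(2) step(2) by (meson le_trans mult_le_mono1)
    also have "\<dots> = card (RR A) * q ^ (place_deg P + nat (ddeg B - ddeg A'))"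
      by (simp add: power_add)
    also have "place_deg P + nat (ddeg B - ddeg A') = nat (ddeg B - ddeg A)"
      using deg degB by simp
    finally show ?thesis using IH(1) by blast
  qed
qed

lemma div_le_pos_part: "div_le A (pos_part A)" "div_le 0 (pos_part A)"
  by (auto simp: div_le_def lookup_pos_part)

lemma finite_RR: "finite (RR A)"
  using RR_card_le[OF div_le_pos_part(2)[of A]] RR_mono[OF div_le_pos_part(1)[of A]] RR_0 finite_K
  by (auto intro: finite_subset)

section \<open>Dimensions of Riemann-Roch spaces\<close>

definition ell :: "('a set \<Rightarrow>\<^sub>0 int) \<Rightarrow> nat" where
  "ell A = (THE n. card (RR A) = q ^ n)"

lemma power_q_inj: "q ^ m = q ^ n \<Longrightarrow> m = n"
  using q_ge_2 by (metis One_nat_def Suc_1 Suc_le_lessD power_inject_exp)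

lemma power_q_le: "q ^ m \<le> q ^ n \<longleftrightarrow> m \<le> n"
  using q_ge_2 by simp

lemma card_RR: "card (RR A) = q ^ ell A"
proof -
  have "ksubspace {0}" by (auto simp: ksubspace_def)
  then have "\<exists>n. card (RR A) = q ^ n"
    by (rule card_quotient[OF _ ksubspace_RR finite_RR order_refl]) auto
  then obtain n where n: "card (RR A) = q ^ n" ..
  have "ell A = n"
    unfolding ell_def by (rule the_equality) (simp add: n, metis n power_q_inj)
  then show ?thesis using n by simp
qed

lemma ell_le: "div_le A B \<Longrightarrow> int (ell B) \<le> int (ell A) + ddeg B - ddeg A"
proof -
  assume le: "div_le A B"
  have "q ^ ell B \<le> q ^ (ell A + nat (ddeg B - ddeg A))"
    using RR_card_le[OF le finite_RR] by (simp add: card_RR power_add)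
  then have "ell B \<le> ell A + nat (ddeg B - ddeg A)" by (simp only: power_q_le)
  then show ?thesis using ddeg_mono[OF le] by simp
qed

lemma ell_0: "ell 0 = 1"
  using card_RR[of 0] RR_0 power_q_inj[of 1 "ell 0"] by simp

lemma ell_pos_imp: "ell A \<ge> 1 \<Longrightarrow> \<exists>z\<in>RR A. z \<noteq> 0"
proof (rule ccontr)
  assume "ell A \<ge> 1" "\<not> (\<exists>z\<in>RR A. z \<noteq> 0)"
  then have "RR A = {0}" using zero_in_RR by blast
  then have "q ^ ell A = 1" by (simp flip: card_RR)
  then show False using power_q_inj[of "ell A" 0] \<open>ell A \<ge> 1\<close> by simp
qed

text \<open>Division by y carries one space bijectively onto the other.\<close>

lemma ell_prdiv:
  assumes "y \<noteq> 0" shows "ell (A + prdiv y) = ell A"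
proof -
  have "bij_betw (\<lambda>z. z / y) (RR A) (RR (A + prdiv y))"
  proof (rule bij_betwI[of _ _ _ "\<lambda>z. z * y"])
    have inv: "prdiv (z / y) = prdiv z - prdiv y" if "z \<noteq> 0" for z
      using that assms prdiv_mult[of z "inverse y"] prdiv_inverse[of y] by (simp add: field_simps)
    show "(\<lambda>z. z / y) \<in> RR A \<rightarrow> RR (A + prdiv y)"
    proof
      fix z assume "z \<in> RR A"
      then show "z / y \<in> RR (A + prdiv y)"
        using assms inv by (cases "z = 0") (auto simp: RR_nz_iff zero_in_RR)
    qed
    show "(\<lambda>z. z * y) \<in> RR (A + prdiv y) \<rightarrow> RR A"
    proof
      fix z assume "z \<in> RR (A + prdiv y)"
      then show "z * y \<in> RR A"
        using assms prdiv_mult[of z y] by (cases "z = 0") (auto simp: RR_nz_iff zero_in_RR algebra_simps)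
    qed
  qed (use assms in auto)
  then have "q ^ ell (A + prdiv y) = q ^ ell A" using bij_betw_same_card card_RR by metis
  then show ?thesis by (rule power_q_inj)
qed

definition dmul :: "nat \<Rightarrow> ('a set \<Rightarrow>\<^sub>0 int) \<Rightarrow> ('a set \<Rightarrow>\<^sub>0 int)" where
  "dmul l B = (\<Sum>j<l. B)"

lemma lookup_dmul: "lookup (dmul l B) P = int l * lookup B P"
  unfolding dmul_def lookup_sum by simp

lemma ddeg_dmul: "ddeg (dmul l B) = int l * ddeg B"
  unfolding dmul_def ddeg_sum by simp

text \<open>The elements \<open>y\<^sup>j u\<^sub>i\<close> with \<open>j \<le> l\<close> and \<open>i < m\<close> are linearly independent over \<open>K\<close> and their
  poles are bounded by \<open>l (y)\<^sub>\<infinity> + C\<close>.\<close>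

lemma ell_dmul_poles_ge:
  assumes y: "y \<notin> K" "\<not> all_dependent K y m"
  defines "B \<equiv> pos_part (- prdiv y)"
  obtains C where "div_le 0 C" "\<And>l. m * (l + 1) \<le> ell (dmul l B + C)"
proof -
  have y0: "y \<noteq> 0" using y zero_K by blast
  obtain us where us: "\<And>p. (\<forall>i<m. p i \<in> polys_over K) \<Longrightarrow> (\<Sum>i<m. poly (p i) y * us i) = 0 \<Longrightarrow> (\<forall>i<m. p i = 0)"
  proof -
    from y(2) have "\<exists>us. \<not> (\<exists>p. (\<forall>i<m. p i \<in> polys_over K) \<and> (\<exists>i<m. p i \<noteq> 0) \<and> (\<Sum>i<m. poly (p i) y * us i) = 0)"
      unfolding all_dependent_def by (simp only: not_all)
    then obtain us where "\<not> (\<exists>p. (\<forall>i<m. p i \<in> polys_over K) \<and> (\<exists>i<m. p i \<noteq> 0) \<and> (\<Sum>i<m. poly (p i) y * us i) = 0)"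
      by (rule exE)
    then show ?thesis by (intro that[of us]) blast
  qed
  \<comment> \<open>C bounds the poles of all \<open>us i\<close> simultaneously.\<close>
  define C where "C = (\<Sum>i<m. pos_part (- prdiv (us i)))"
  have lookC: "lookup C P = (\<Sum>i<m. max 0 (- lookup (prdiv (us i)) P))" for P
    by (simp add: C_def lookup_sum lookup_pos_part)
  have C0: "div_le 0 C" by (auto simp: div_le_def lookC intro: sum_nonneg)
  have usC: "us i \<in> RR C" if "i < m" for i
  proof (cases "us i = 0")
    case True
    then show ?thesis by (simp add: zero_in_RR)
  next
    case False
    have le: "- lookup (prdiv (us i)) P \<le> lookup C P" for P
    proof -
      have "- lookup (prdiv (us i)) P \<le> max 0 (- lookup (prdiv (us i)) P)" by simp
      also have "\<dots> \<le> lookup C P"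
        unfolding lookC using that
        by (intro member_le_sum[of i "{..<m}" "\<lambda>i. max 0 (- lookup (prdiv (us i)) P)"]) auto
      finally show ?thesis .
    qed
    have "0 \<le> lookup C P + lookup (prdiv (us i)) P" for P using le[of P] by linarith
    then have "div_le 0 (C + prdiv (us i))" by (simp add: div_le_def lookup_add)
    then show ?thesis by (simp add: RR_nz_iff[OF False])
  qed
  have mem: "y ^ j * us i \<in> RR (dmul l B + C)" if "i < m" "j \<le> l" for i j l
    unfolding RR_def
  proof safe
    fix P assume P: "P \<in> places"
    have "val_ge P (- (int l * lookup B P)) (y ^ j)"
    proof -
      have "- (int l * lookup B P) \<le> int j * valuation P y"
      proof (cases "valuation P y \<ge> 0")
        case True
        then have "lookup B P = 0" using P y0 by (simp add: B_def lookup_pos_part lookup_prdiv)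
        then show ?thesis using True by simp
      next
        case False
        then have "lookup B P = - valuation P y" using P y0 by (simp add: B_def lookup_pos_part lookup_prdiv)
        moreover have "int l * valuation P y \<le> int j * valuation P y"
          using False that by (intro mult_right_mono_neg) auto
        ultimately show ?thesis by simp
      qed
      then show ?thesis using y0 by (simp add: val_ge_iff[OF P] valuation_power[OF P])
    qed
    moreover have "val_ge P (- lookup C P) (us i)" using usC[OF that(1)] P by (simp add: RR_def)
    ultimately have "val_ge P (- (int l * lookup B P) + - lookup C P) (y ^ j * us i)"
      by (rule val_ge_mult[OF P])
    then show "val_ge P (- lookup (dmul l B + C) P) (y ^ j * us i)"
      by (simp add: lookup_add lookup_dmul)
  qed
  have "m * (l + 1) \<le> ell (dmul l B + C)" for l
  proof -
    \<comment> \<open>The arrays a hold the coefficients of m polynomials of degree at most l;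
      \<open>F\<close> below is injective because the \<open>us i\<close> satisfy no nontrivial
      relation over \<open>K[y]\<close>.\<close>
    define pol where "pol a i = (\<Sum>j\<le>l. monom (a (i, j)) j)" for a :: "nat \<times> nat \<Rightarrow> 'a" and i :: nat
    define F where "F a = (\<Sum>i<m. poly (pol a i) y * us i)" for a
    let ?D = "({..<m} \<times> {..l}) \<rightarrow>\<^sub>E K"
    have coeff: "coeff (pol a i) j = (if j \<le> l then a (i, j) else 0)" for a i j
      by (simp add: pol_def coeff_sum)
    have "inj_on F ?D"
    proof (rule inj_onI)
      fix a b assume ab: "a \<in> ?D" "b \<in> ?D" "F a = F b"
      have "(\<Sum>i<m. poly (pol a i - pol b i) y * us i) = 0"
        using ab(3) by (simp add: F_def left_diff_distrib sum_subtractf)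
      moreover have "\<forall>i<m. pol a i - pol b i \<in> polys_over K"
        using ab(1,2) zero_K by (auto simp: polys_over_def coeff intro!: diff_K)
      ultimately have eq: "\<forall>i<m. pol a i - pol b i = 0" using us[of "\<lambda>i. pol a i - pol b i"] by blast
      have "a (i, j) = b (i, j)" if "i < m" "j \<le> l" for i j
      proof -
        have "coeff (pol a i - pol b i) j = 0" using eq that by simp
        then show ?thesis using that by (simp add: coeff)
      qed
      then show "a = b" by (intro PiE_ext[OF ab(1,2)]) auto
    qed
    moreover have "F ` ?D \<subseteq> RR (dmul l B + C)"
    proof safe
      fix a assume a: "a \<in> ?D"
      have "F a = (\<Sum>i<m. \<Sum>j\<le>l. a (i, j) * (y ^ j * us i))"
        by (simp add: F_def pol_def poly_sum poly_monom sum_distrib_right mult.assoc)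
      also have "\<dots> \<in> RR (dmul l B + C)"
        using a by (intro ksubspace_sum ksubspace_mult ksubspace_RR mem) auto
      finally show "F a \<in> RR (dmul l B + C)" .
    qed
    ultimately have "card ?D \<le> card (RR (dmul l B + C))" using card_inj_on_le finite_RR by blast
    moreover have "card ?D = q ^ (m * (l + 1))" by (simp add: card_funcsetE card_cartesian_product)
    ultimately show ?thesis by (simp only: card_RR power_q_le)
  qed
  then show ?thesis using that C0 by blast
qed

section \<open>Degrees of zeros and poles of a function\<close>

lemma ddeg_pos_part_prdiv_le:
  assumes y: "y \<notin> K" "all_dependent K y (Suc m)"
  shows "ddeg (pos_part (prdiv y)) \<le> int m"
proof -
  have y0: "y \<noteq> 0" using y zero_K by blast
  define S where "S = {P\<in>places. valuation P y > 0}"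
  have S: "finite S" using finite_zeros[OF y(1)] by (simp add: S_def)
  have "keys (pos_part (prdiv y)) \<subseteq> S"
    using y0 by (auto simp: S_def in_keys_iff lookup_pos_part lookup_prdiv split: if_splits)
  then have "ddeg (pos_part (prdiv y)) = (\<Sum>P\<in>S. lookup (pos_part (prdiv y)) P * int (place_deg P))"
    by (rule ddeg_eq[OF S])
  also have "\<dots> = int (\<Sum>P\<in>S. nat (valuation P y) * place_deg P)"
    using y0 unfolding of_nat_sum by (intro sum.cong refl) (auto simp: S_def lookup_pos_part lookup_prdiv)
  also have "\<dots> \<le> int m" unfolding of_nat_le_iff by (rule zeros_degree_le[OF y S]) (auto simp: S_def)
  finally show ?thesis .
qed

text \<open>The dimensions along \<open>dmul l B + C\<close> grow in l at least with slope m and at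
  most with slope the degree of the pole divisor B.\<close>

lemma le_ddeg_poles:
  assumes y: "y \<notin> K" "\<not> all_dependent K y m"
  shows "int m \<le> ddeg (pos_part (- prdiv y))"
proof (rule ccontr)
  let ?B = "pos_part (- prdiv y)"
  assume "\<not> ?thesis"
  then have less: "ddeg ?B + 1 \<le> int m" by simp
  obtain C where C: "div_le 0 C" "\<And>l. m * (l + 1) \<le> ell (dmul l ?B + C)"
    using ell_dmul_poles_ge[OF y] by blast
  \<comment> \<open>From m (l + 1) \<le> 1 + l deg B + deg C and deg B + 1 \<le> m follows l + deg B
    \<le> deg C, which this l violates.\<close>
  define l where "l = nat (ddeg C) + 1"
  have C0: "0 \<le> ddeg C" "0 \<le> ddeg ?B" using ddeg_mono[OF C(1)] ddeg_mono[OF div_le_pos_part(2)] by auto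
  have "div_le 0 (dmul l ?B + C)"
    using C(1) by (auto simp: div_le_def lookup_add lookup_dmul lookup_pos_part)
  then have "int (ell (dmul l ?B + C)) \<le> 1 + (int l * ddeg ?B + ddeg C)"
    using ell_le[of 0] by (fastforce simp: ell_0 ddeg_add ddeg_dmul)
  moreover have "(ddeg ?B + 1) * (int l + 1) \<le> int m * (int l + 1)" using less by (intro mult_right_mono) auto
  moreover have "int m * (int l + 1) \<le> int (ell (dmul l ?B + C))"
    using of_nat_mono[OF C(2)[of l], where 'a = int] by (simp add: algebra_simps)
  ultimately have "(ddeg ?B + 1) * (int l + 1) \<le> 1 + (int l * ddeg ?B + ddeg C)" by linarith
  then have "int l + ddeg ?B \<le> ddeg C" by (simp add: algebra_simps)
  then show False using C0 by (simp add: l_def)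
qed

text \<open>m is the degree of the function field over \<open>K(y)\<close>, one less than the least
  n with \<open>all_dependent K y n\<close>. That n is not 1, since a relation for the single
  element 1 would be a nonzero polynomial vanishing at y.\<close>

lemma ex_degree:
  assumes "y \<notin> K"
  obtains m where "m \<ge> 1" "all_dependent K y (Suc m)" "\<not> all_dependent K y m"
proof -
  define n where "n = (LEAST n. all_dependent K y n)"
  have n: "all_dependent K y n" unfolding n_def using ex_all_dependent[OF assms] by (rule LeastI_ex)
  have least: "\<not> all_dependent K y k" if "k < n" for k using that not_less_Least unfolding n_def by blast
  have "n \<noteq> 0" using n by (auto simp: all_dependent_def)
  moreover have "n \<noteq> 1"
  proof
    assume "n = 1"
    then have "all_dependent K y 1" using n by simp
    from this[unfolded all_dependent_def, THEN spec, of "\<lambda>_. 1"]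
    obtain p where "p 0 \<in> polys_over K \<and> p 0 \<noteq> 0 \<and> poly (p 0) y = 0" by (auto simp: less_Suc_eq)
    then show False using transcendental[OF assms] by blast
  qed
  ultimately show ?thesis using n least by (intro that[of "n - 1"]) auto
qed

lemma pos_part_diff: "pos_part A - pos_part (- A) = A"
  by (intro poly_mapping_eqI) (simp add: lookup_minus lookup_pos_part)

text \<open>A cycle of inequalities, with m' the degree belonging to \<open>inverse y\<close>: zeros
  of y \<le> m \<le> poles of y = zeros of \<open>inverse y\<close> \<le> m' \<le> poles of
  \<open>inverse y\<close> = zeros of y.\<close>

lemma ddeg_poles:
  assumes y: "y \<notin> K" "all_dependent K y (Suc m)" "\<not> all_dependent K y m"
  shows "ddeg (pos_part (prdiv y)) = int m" "ddeg (pos_part (- prdiv y)) = int m"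
proof -
  have y0: "y \<noteq> 0" using y zero_K by blast
  have iy: "inverse y \<notin> K" using y inverse_K[of "inverse y"] by auto
  obtain m' where m': "all_dependent K (inverse y) (Suc m')" "\<not> all_dependent K (inverse y) m'"
    using ex_degree[OF iy] by blast
  have "ddeg (pos_part (prdiv y)) \<le> int m" by (rule ddeg_pos_part_prdiv_le[OF y(1,2)])
  moreover have "int m \<le> ddeg (pos_part (- prdiv y))" by (rule le_ddeg_poles[OF y(1,3)])
  moreover have "ddeg (pos_part (- prdiv y)) \<le> int m'"
    using ddeg_pos_part_prdiv_le[OF iy m'(1)] by (simp add: prdiv_inverse y0)
  moreover have "int m' \<le> ddeg (pos_part (prdiv y))"
    using le_ddeg_poles[OF iy m'(2)] by (simp add: prdiv_inverse y0)
  ultimately show "ddeg (pos_part (prdiv y)) = int m" "ddeg (pos_part (- prdiv y)) = int m" by linarith+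
qed

lemma ddeg_prdiv:
  assumes "y \<noteq> 0" shows "ddeg (prdiv y) = 0"
proof (cases "y \<in> K")
  case True
  then show ?thesis using prdiv_K assms by simp
next
  case False
  obtain m where "all_dependent K y (Suc m)" "\<not> all_dependent K y m" using ex_degree[OF False] by blast
  from ddeg_poles[OF False this] have "ddeg (pos_part (prdiv y) - pos_part (- prdiv y)) = 0"
    by (simp add: ddeg_diff)
  then show ?thesis by (simp add: pos_part_diff)
qed

lemma ddeg_ell_mono: "div_le A B \<Longrightarrow> ddeg A - int (ell A) \<le> ddeg B - int (ell B)"
  using ell_le[of A B] by simp

text \<open>Multiples of a fixed pole divisor B satisfy the bound \<open>ddeg C\<close> by counting.
  An effective divisor can be moved below a large multiple of B by a principal divisor, which
  changes neither degree nor dimension, and degree minus dimension is monotone.\<close>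

lemma ddeg_ell_bounded: "\<exists>\<gamma>. \<forall>A. ddeg A - int (ell A) \<le> \<gamma>"
proof -
  obtain y where y: "y \<notin> K" using K_ne_UNIV by blast
  obtain m where m: "m \<ge> 1" "all_dependent K y (Suc m)" "\<not> all_dependent K y m"
    using ex_degree[OF y] by blast
  define B where "B = pos_part (- prdiv y)"
  have degB: "ddeg B = int m" unfolding B_def by (rule ddeg_poles[OF y m(2,3)])
  obtain C where C: "div_le 0 C" "\<And>l. m * (l + 1) \<le> ell (dmul l B + C)"
    using ell_dmul_poles_ge[OF y m(3)] unfolding B_def by blast
  have lB: "ddeg (dmul l B) - int (ell (dmul l B)) \<le> ddeg C" for l
  proof -
    have "div_le (dmul l B) (dmul l B + C)" using C(1) by (auto simp: div_le_def lookup_add)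
    then have "int (ell (dmul l B + C)) \<le> int (ell (dmul l B)) + ddeg C"
      using ell_le[of "dmul l B" "dmul l B + C"] by (simp add: ddeg_add)
    moreover have "int m * (int l + 1) \<le> int (ell (dmul l B + C))"
      using of_nat_mono[OF C(2)[of l], where 'a = int] by (simp add: algebra_simps)
    ultimately have "int m * (int l + 1) \<le> int (ell (dmul l B)) + ddeg C" by linarith
    then show ?thesis by (simp add: ddeg_dmul degB algebra_simps)
  qed
  have "ddeg A - int (ell A) \<le> ddeg C" for A
  proof -
    define A1 where "A1 = pos_part A"
    \<comment> \<open>l is so large that \<open>RR (dmul l B - A1)\<close> contains some z \<noteq>
      0, and then \<open>A1 - prdiv z\<close> lies below \<open>dmul l B\<close>.\<close>
    define l where "l = nat (ddeg C + ddeg A1) + 1"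
    have l: "int l > ddeg C + ddeg A1" by (simp add: l_def)
    have A1: "div_le 0 A1" "div_le A A1" using div_le_pos_part by (auto simp: A1_def)
    have "div_le (dmul l B - A1) (dmul l B)" using A1(1) by (auto simp: div_le_def lookup_minus)
    from ell_le[OF this] have "int (ell (dmul l B)) \<le> int (ell (dmul l B - A1)) + ddeg A1"
      by (simp add: ddeg_diff)
    moreover have "int l * 1 \<le> int l * int m" using m(1) by (intro mult_left_mono) auto
    ultimately have "1 \<le> ell (dmul l B - A1)"
      using lB[of l] l by (simp add: ddeg_dmul degB)
    then obtain z where z: "z \<in> RR (dmul l B - A1)" "z \<noteq> 0" using ell_pos_imp by blast
    have "div_le (A1 - prdiv z) (dmul l B)"
      using z by (auto simp: RR_nz_iff div_le_def lookup_add lookup_minus algebra_simps)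
    from ddeg_ell_mono[OF this] have "ddeg (A1 - prdiv z) - int (ell (A1 - prdiv z)) \<le> ddeg C"
      using lB[of l] by linarith
    moreover have "A1 - prdiv z = A1 + prdiv (inverse z)" using prdiv_inverse[OF z(2)] by simp
    moreover have "ell (A1 + prdiv (inverse z)) = ell A1" using z by (intro ell_prdiv) auto
    moreover have "ddeg (A1 - prdiv z) = ddeg A1" using ddeg_prdiv[OF z(2)] by (simp add: ddeg_diff)
    ultimately have "ddeg A1 - int (ell A1) \<le> ddeg C" by metis
    then show ?thesis using ddeg_ell_mono[OF A1(2)] by linarith
  qed
  then show ?thesis by blast
qed

text \<open>G is the maximum of degree minus dimension, attained at A0; it is the genus minus 1.
  Once \<open>RR (A - A0)\<close> is nonzero, A is equivalent to a divisor above A0, and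
  monotonicity forces equality.\<close>

theorem Riemann: "\<exists>G c. \<forall>A. ddeg A \<ge> c \<longrightarrow> int (ell A) = ddeg A - G"
proof -
  obtain \<gamma> where \<gamma>: "\<And>A. ddeg A - int (ell A) \<le> \<gamma>" using ddeg_ell_bounded by blast
  \<comment> \<open>Reflecting the bounded integer into the natural numbers turns the maximum into a
    least value.\<close>
  define f where "f A = nat (\<gamma> - (ddeg A - int (ell A)))" for A
  obtain A0 where A0: "\<And>A. f A0 \<le> f A" using ex_has_least_nat[of "\<lambda>_. True" 0 f] by auto
  define G where "G = ddeg A0 - int (ell A0)"
  have le: "ddeg A - int (ell A) \<le> G" for A
    using A0[of A] \<gamma>[of A] \<gamma>[of A0] by (simp add: f_def G_def)
  have "int (ell A) = ddeg A - G" if A: "ddeg A \<ge> ddeg A0 + G + 1" for A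
  proof -
    have "1 \<le> ell (A - A0)" using le[of "A - A0"] A by (simp add: ddeg_diff)
    then obtain z where z: "z \<in> RR (A - A0)" "z \<noteq> 0" using ell_pos_imp by blast
    have "div_le A0 (A + prdiv z)"
      using z by (auto simp: RR_nz_iff div_le_def lookup_add lookup_minus algebra_simps)
    from ddeg_ell_mono[OF this] have "G \<le> ddeg A - int (ell A)"
      using ddeg_prdiv[OF z(2)] ell_prdiv[OF z(2), of A] by (simp add: G_def ddeg_add)
    then show ?thesis using le[of A] by simp
  qed
  then show ?thesis by blast
qed

end

section \<open>Counting positive divisors\<close>

context function_field_const
begin

definition effective :: "nat \<Rightarrow> 'a set multiset set" where
  "effective n = {D. set_mset D \<subseteq> places \<and> (\<Sum>P\<in>#D. place_deg P) = n}"

definition mdiv :: "'a set multiset \<Rightarrow> ('a set \<Rightarrow>\<^sub>0 int)" where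
  "mdiv D = (\<Sum>P\<in>#D. Poly_Mapping.single P 1)"

section \<open>Divisor classes\<close>

definition divclass :: "('a set \<Rightarrow>\<^sub>0 int) \<Rightarrow> ('a set \<Rightarrow>\<^sub>0 int) set" where
  "divclass A = (\<lambda>z. A + prdiv z) ` (- {0})"

text \<open>The restriction to \<open>places\<close> matters: coefficients at other sets do not
  affect the degree and would produce infinitely many classes.\<close>

definition Pic :: "int \<Rightarrow> ('a set \<Rightarrow>\<^sub>0 int) set set" where
  "Pic n = divclass ` {A. keys A \<subseteq> places \<and> ddeg A = n}"

lemma lookup_mdiv: "lookup (mdiv D) P = int (count D P)"
  unfolding mdiv_def by (induction D) (auto simp: lookup_add lookup_single)

lemma ddeg_mdiv: "ddeg (mdiv D) = int (\<Sum>P\<in>#D. place_deg P)"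
  unfolding mdiv_def by (induction D) (auto simp: ddeg_add ddeg_single)

lemma mdiv_inject: "mdiv D = mdiv E \<longleftrightarrow> D = E"
proof
  assume "mdiv D = mdiv E"
  then have "int (count D P) = int (count E P)" for P by (metis lookup_mdiv)
  then show "D = E" by (intro multiset_eqI) simp
qed simp

lemma keys_mdiv: "keys (mdiv D) = set_mset D"
  by (auto simp: in_keys_iff lookup_mdiv)

lemma ex_mdiv:
  assumes "keys A \<subseteq> places" "div_le 0 A"
  obtains D where "set_mset D \<subseteq> places" "mdiv D = A"
proof -
  have nn: "0 \<le> lookup A P" for P
  proof (cases "P \<in> places")
    case True
    then show ?thesis using assms(2) by (simp add: div_le_def)
  next
    case False
    then have "P \<notin> keys A" using assms(1) by blast
    then show ?thesis by (simp add: in_keys_iff)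
  qed
  define D where "D = Abs_multiset (\<lambda>P. nat (lookup A P))"
  have "finite {P. 0 < nat (lookup A P)}"
    by (rule finite_subset[of _ "keys A"]) (auto simp: in_keys_iff)
  then have "count D P = nat (lookup A P)" for P unfolding D_def by (subst count_Abs_multiset) auto
  then have "mdiv D = A" using nn by (intro poly_mapping_eqI) (simp add: lookup_mdiv)
  then show ?thesis using that assms keys_mdiv by metis
qed

text \<open>If the residue field at P has at most \<open>q ^ d\<close> elements, two of the first
  \<open>q ^ d + 1\<close> powers of an element z of P agree modulo P, so P is a zero of some
  \<open>z ^ i - z ^ j\<close>. These differences are nonconstant and have finitely many zeros, and
  every place contains y or \<open>inverse y\<close>.\<close>

lemma finite_places_deg_le: "finite {P\<in>places. place_deg P \<le> d}"
proof -
  obtain y where y: "y \<notin> K" using K_ne_UNIV by blast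
  have y': "inverse y \<notin> K" using y inverse_K[of "inverse y"] by auto
  define N where "N = q ^ d"
  have diff_notin: "z ^ i - z ^ j \<notin> K" if "z \<notin> K" "i < j" for z i j
  proof
    assume c: "z ^ i - z ^ j \<in> K"
    define p where "p = monom 1 i - monom 1 j - [:z ^ i - z ^ j:]"
    have "coeff [:z ^ i - z ^ j:] k \<in> K" for k using c zero_K by (cases k) auto
    then have "p \<in> polys_over K"
      unfolding polys_over_def p_def using zero_K one_K
      by (auto simp only: mem_Collect_eq coeff_diff coeff_monom split: if_splits intro!: diff_K)
    moreover have "poly p z = 0" by (simp add: p_def poly_monom)
    moreover have "coeff p j \<noteq> 0" using that by (auto simp: p_def coeff_pCons split: nat.splits)
    then have "p \<noteq> 0" by auto
    ultimately show False using transcendental[OF that(1)] by blast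
  qed
  define Z where "Z z = (\<Union>j\<le>N. \<Union>i<j. {P\<in>places. valuation P (z ^ i - z ^ j) > 0})" for z
  have finZ: "finite (Z z)" if "z \<notin> K" for z
    unfolding Z_def by (intro finite_UN_I finite_zeros diff_notin that) auto
  have inZ: "P \<in> Z z" if P: "P \<in> places" "place_deg P \<le> d" and z: "z \<notin> K" "z \<in> P" for P z
  proof -
    define f where "f i = (SOME a. a \<in> residues P \<and> z ^ i - a \<in> max_ideal P)" for i
    have f: "f i \<in> residues P \<and> z ^ i - f i \<in> max_ideal P" for i
      unfolding f_def by (rule someI_ex) (use residues(4)[OF P(1) place_power[OF P(1) z(2)]] in blast)
    have "card (f ` {..N}) \<le> card (residues P)"
      using f residues(1)[OF P(1)] by (intro card_mono) auto
    also have "\<dots> \<le> N" unfolding card_residues[OF P(1)] N_def power_q_le by (rule P)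
    also have "N < card {..N}" by simp
    finally have "\<not> inj_on f {..N}" by (rule pigeonhole)
    then obtain i j where ij: "i < j" "j \<le> N" "f i = f j"
      unfolding inj_on_def by (metis atMost_iff linorder_neqE_nat)
    have "(z ^ i - f i) - (z ^ j - f j) \<in> max_ideal P"
      by (rule ksubspace_diff[OF ksubspace_max_ideal[OF P(1)] conjunct2[OF f] conjunct2[OF f]])
    then have "val_ge P 1 (z ^ i - z ^ j)" using ij val_ge_1_iff[OF P(1)] by simp
    moreover have "z ^ i - z ^ j \<noteq> 0" using diff_notin[OF z(1) ij(1)] zero_K by metis
    ultimately have "valuation P (z ^ i - z ^ j) > 0" by (simp add: val_ge_iff[OF P(1)])
    then show ?thesis using ij P unfolding Z_def by blast
  qed
  have "{P\<in>places. place_deg P \<le> d} \<subseteq> Z y \<union> Z (inverse y)"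
    using inZ[OF _ _ y] inZ[OF _ _ y'] place_inverse by blast
  then show ?thesis using finZ[OF y] finZ[OF y'] finite_subset by blast
qed

lemma finite_effective: "finite (effective n)"
proof -
  define F where "F = {P\<in>places. place_deg P \<le> n}"
  have "effective n \<subseteq> mset ` {xs. set xs \<subseteq> F \<and> length xs \<le> n}"
  proof
    fix D assume D: "D \<in> effective n"
    obtain xs where xs: "D = mset xs" by (metis ex_mset)
    have sum: "sum_list (map place_deg xs) = n" "set xs \<subseteq> places"
      using D xs by (auto simp: effective_def sum_mset_sum_list[symmetric])
    \<comment> \<open>Each place has degree at least 1, so a divisor of degree n involves at most n
      places, counted with multiplicity.\<close>
    have "length xs \<le> sum_list (map place_deg xs)"
      using sum_list_mono[of xs "\<lambda>_. 1" place_deg] sum(2) place_deg_pos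
      by (fastforce simp: sum_list_triv)
    moreover have "set xs \<subseteq> F"
      using sum member_le_sum_list[of _ "map place_deg xs"] by (auto simp: F_def)
    ultimately show "D \<in> mset ` {xs. set xs \<subseteq> F \<and> length xs \<le> n}" using sum xs by auto
  qed
  moreover have "finite F" unfolding F_def by (rule finite_places_deg_le)
  then have "finite (mset ` {xs. set xs \<subseteq> F \<and> length xs \<le> n})"
    by (intro finite_imageI finite_lists_length_le)
  ultimately show ?thesis by (rule finite_subset)
qed

lemma divclass_self: "A \<in> divclass A"
  using prdiv_K[OF one_K] by (auto simp: divclass_def intro!: image_eqI[of _ _ 1])

lemma divclass_eq:
  assumes "B \<in> divclass A" shows "divclass B = divclass A"
proof -
  obtain w where w: "w \<noteq> 0" "B = A + prdiv w" using assms by (auto simp: divclass_def)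
  have sub: "divclass (A + prdiv w) \<subseteq> divclass A" if "w \<noteq> 0" for A w
    using that by (auto simp: divclass_def add.assoc simp flip: prdiv_mult)
  have "divclass (B + prdiv (inverse w)) \<subseteq> divclass B" using w by (intro sub) auto
  moreover have "B + prdiv (inverse w) = A" using w by (simp add: prdiv_inverse)
  ultimately show ?thesis using sub[OF w(1), of A] w(2) by (metis subset_antisym)
qed

lemma keys_divclass:
  assumes "keys A \<subseteq> places" "B \<in> divclass A"
  shows "keys B \<subseteq> places" "ddeg B = ddeg A"
proof -
  obtain w where w: "w \<noteq> 0" "B = A + prdiv w" using assms by (auto simp: divclass_def)
  have "lookup B P = 0" if "P \<notin> places" for P
    using that assms(1) w by (auto simp: lookup_add lookup_prdiv in_keys_iff subset_iff)
  then show "keys B \<subseteq> places" by (auto simp: in_keys_iff)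
  show "ddeg B = ddeg A" using w by (simp add: ddeg_add ddeg_prdiv)
qed

text \<open>The positive divisors in the class of \<open>A\<close> are the divisors \<open>A + (z)\<close> with
  \<open>0 \<noteq> z \<in> L(A)\<close>, and \<open>z\<close> is determined up to a factor in \<open>K\<close>.\<close>

lemma card_effective_class:
  assumes A: "keys A \<subseteq> places"
  shows "card {D. set_mset D \<subseteq> places \<and> mdiv D \<in> divclass A} * (q - 1) = q ^ ell A - 1"
proof -
  define E where "E = {D. set_mset D \<subseteq> places \<and> mdiv D \<in> divclass A}"
  define S where "S = RR A - {0}"
  define f where "f z = (THE D. mdiv D = A + prdiv z)" for z
  have f_eq: "f z = D" if "mdiv D = A + prdiv z" for z D
    unfolding f_def using that by (intro the_equality) (simp_all flip: mdiv_inject)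
  have f: "mdiv (f z) = A + prdiv z" "f z \<in> E" if "z \<in> S" for z
  proof -
    have z: "z \<noteq> 0" "div_le 0 (A + prdiv z)" using that RR_nz_iff by (auto simp: S_def)
    then have cl: "A + prdiv z \<in> divclass A" by (auto simp: divclass_def)
    from keys_divclass(1)[OF A cl] z(2) obtain D where D: "set_mset D \<subseteq> places" "mdiv D = A + prdiv z"
      by (rule ex_mdiv)
    then show "mdiv (f z) = A + prdiv z" "f z \<in> E" using f_eq[OF D(2)] cl by (auto simp: E_def)
  qed
  have fin: "finite S" using finite_RR by (simp add: S_def)
  have surj: "\<exists>z\<in>S. f z = D" if D: "D \<in> E" for D
  proof -
    obtain z where z: "z \<noteq> 0" "mdiv D = A + prdiv z" using D by (auto simp: E_def divclass_def)
    have "div_le 0 (mdiv D)" by (simp add: div_le_def lookup_mdiv)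
    then have "z \<in> S" using z by (simp add: S_def RR_nz_iff)
    then show ?thesis using f_eq[OF z(2)] by blast
  qed
  have finE: "finite E" by (rule finite_surj[OF fin, of _ f]) (use surj in auto)
  have fibre: "card {z\<in>S. f z = D} = q - 1" if D: "D \<in> E" for D
  proof -
    obtain w where w: "w \<in> S" "f w = D" using surj[OF D] by blast
    have w0: "w \<noteq> 0" using w by (simp add: S_def)
    have "{z\<in>S. f z = D} = (\<lambda>c. c * w) ` (K - {0})"
    proof (intro equalityI subsetI)
      fix z assume z: "z \<in> {z\<in>S. f z = D}"
      then have z0: "z \<noteq> 0" by (simp add: S_def)
      have "A + prdiv z = A + prdiv w" using f(1)[of z] f(1)[OF w(1)] z w by auto
      then have "prdiv (z * inverse w) = 0" using z0 w0 by (simp add: prdiv_mult prdiv_inverse)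
      then have "z * inverse w \<in> K" using RR_nz_iff[of "z * inverse w" 0] z0 w0 RR_0 by (simp add: div_le_def)
      then show "z \<in> (\<lambda>c. c * w) ` (K - {0})"
        using z0 w0 by (intro image_eqI[of _ _ "z * inverse w"]) auto
    next
      fix z assume "z \<in> (\<lambda>c. c * w) ` (K - {0})"
      then obtain c where c: "z = c * w" "c \<in> K" "c \<noteq> 0" by auto
      then have "prdiv z = prdiv w" using w0 by (simp add: prdiv_mult prdiv_K)
      moreover have "z \<in> S" using c w ksubspace_mult[OF ksubspace_RR] by (auto simp: S_def)
      ultimately show "z \<in> {z\<in>S. f z = D}" using f(1)[OF w(1)] w(2) by (auto intro: f_eq)
    qed
    moreover have "inj_on (\<lambda>c. c * w) (K - {0})" using w0 by (auto simp: inj_on_def)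
    ultimately show ?thesis using finite_K zero_K by (simp add: card_image)
  qed
  have "card S = (\<Sum>D\<in>E. card {z\<in>S. f z = D})"
  proof -
    have "S = (\<Union>D\<in>E. {z\<in>S. f z = D})" using f by auto
    then have "card S = card (\<Union>D\<in>E. {z\<in>S. f z = D})" by simp
    also have "\<dots> = (\<Sum>D\<in>E. card {z\<in>S. f z = D})" using fin finE by (intro card_UN_disjoint) auto
    finally show ?thesis .
  qed
  also have "\<dots> = card E * (q - 1)" using fibre by simp
  finally show ?thesis unfolding E_def[symmetric] using card_RR finite_RR zero_in_RR by (simp add: S_def)
qed

lemma card_Pic_shift:
  assumes B: "keys B \<subseteq> places"
  shows "card (Pic (n + ddeg B)) = card (Pic n)"
proof -
  have shift: "divclass (A + B) = (\<lambda>C. C + B) ` divclass A" for A B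
    by (auto simp: divclass_def image_image algebra_simps)
  have "bij_betw (\<lambda>V. (\<lambda>C. C + B) ` V) (Pic n) (Pic (n + ddeg B))"
  proof (rule bij_betwI[of _ _ _ "\<lambda>V. (\<lambda>C. C + - B) ` V"])
    have key: "keys (A + C) \<subseteq> places" if "keys A \<subseteq> places" "keys C \<subseteq> places" for A C :: "'a set \<Rightarrow>\<^sub>0 int"
      using that by (meson Un_least keys_add order_trans)
    have neg: "keys (- B) \<subseteq> places" using B by (auto simp: in_keys_iff)
    show "(\<lambda>V. (\<lambda>C. C + B) ` V) \<in> Pic n \<rightarrow> Pic (n + ddeg B)"
      unfolding Pic_def using key[OF _ B] by (auto simp: ddeg_add simp flip: shift)
    have "divclass (A + - B) \<in> Pic n" if "keys A \<subseteq> places" "ddeg A = n + ddeg B" for A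
      unfolding Pic_def using key[OF that(1) neg] that by (auto simp: ddeg_add ddeg_uminus simp del: add_uminus_conv_diff)
    then show "(\<lambda>V. (\<lambda>C. C + - B) ` V) \<in> Pic (n + ddeg B) \<rightarrow> Pic n"
      unfolding Pic_def[of "n + ddeg B"] by (auto simp del: add_uminus_conv_diff simp flip: shift)
  qed (auto simp: image_image)
  then show ?thesis by (simp add: bij_betw_same_card)
qed

theorem card_effective:
  obtains c m :: nat and G :: int and h :: "nat \<Rightarrow> nat" where "m \<ge> 1" "h 0 \<ge> 1" "\<And>n. h (n + m) = h n"
    "\<And>n. n \<ge> c \<Longrightarrow> real (card (effective n)) * (real q - 1) = real (h n) * (real q powi (int n - G) - 1)"
proof -
  obtain G c0 where R: "\<And>A. ddeg A \<ge> c0 \<Longrightarrow> int (ell A) = ddeg A - G" using Riemann by metis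
  \<comment> \<open>From degree c on, Riemann's formula holds and dimensions are positive, so that
    every class contains a positive divisor and finiteness of \<open>Pic\<close> follows from that
    of \<open>effective\<close>.\<close>
  define c where "c = nat (max c0 (G + 1))"
  obtain y where y: "y \<notin> K" using K_ne_UNIV by blast
  obtain m where m: "m \<ge> 1" "all_dependent K y (Suc m)" "\<not> all_dependent K y m"
    using ex_degree[OF y] by blast
  define B where "B = pos_part (- prdiv y)"
  have y0: "y \<noteq> 0" using y zero_K by blast
  have degB: "ddeg B = int m" unfolding B_def by (rule ddeg_poles[OF y m(2,3)])
  have keyB: "keys B \<subseteq> places"
    using y0 by (auto simp: B_def in_keys_iff lookup_pos_part lookup_prdiv split: if_splits)
  define h where "h n = card (Pic (int n))" for n :: nat
  have per: "h (n + m) = h n" for n using card_Pic_shift[OF keyB, of "int n"] by (simp add: h_def degB)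
  have ell: "int (ell A) = int n - G" "ell A \<ge> 1" if "ddeg A = int n" "n \<ge> c" for A n
  proof -
    have "int n \<ge> c0" "int n \<ge> G + 1" using that(2) by (simp_all add: c_def)
    then show "int (ell A) = int n - G" "ell A \<ge> 1" using R[of A] that(1) by linarith+
  qed
  have eff: "\<exists>D. D \<in> effective n \<and> mdiv D \<in> V" if V: "V \<in> Pic (int n)" and n: "n \<ge> c" for V n
  proof -
    obtain A where A: "keys A \<subseteq> places" "ddeg A = int n" "V = divclass A" using V by (auto simp: Pic_def)
    obtain z where z: "z \<in> RR A" "z \<noteq> 0" using ell_pos_imp[OF ell(2)[OF A(2) n]] by blast
    have cl: "A + prdiv z \<in> divclass A" using z by (auto simp: divclass_def)
    obtain D where D: "set_mset D \<subseteq> places" "mdiv D = A + prdiv z"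
      using ex_mdiv[OF keys_divclass(1)[OF A(1) cl]] z RR_nz_iff by metis
    then have "int (\<Sum>P\<in>#D. place_deg P) = int n"
      using ddeg_mdiv[of D] keys_divclass(2)[OF A(1) cl] A(2) by (simp only:)
    then have "(\<Sum>P\<in>#D. place_deg P) = n" by (simp only: of_nat_eq_iff)
    then show ?thesis using D cl A by (auto simp: effective_def)
  qed
  have classX: "V = divclass A" if "V \<in> Pic k" "A \<in> V" for V A k
    using that divclass_eq by (auto simp: Pic_def)
  have finPic: "finite (Pic (int n))" if nc: "n \<ge> c" for n
  proof (rule finite_subset[OF _ finite_imageI[OF finite_effective]])
    show "Pic (int n) \<subseteq> (\<lambda>D. divclass (mdiv D)) ` effective n"
    proof
      fix V assume V: "V \<in> Pic (int n)"
      then obtain D where "D \<in> effective n" "mdiv D \<in> V" using eff[OF _ nc] by blast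
      then show "V \<in> (\<lambda>D. divclass (mdiv D)) ` effective n" using classX[OF V] by blast
    qed
  qed
  \<comment> \<open>Finiteness is established only from degree c on. Periodicity transports the
    class number of degree c m, which is positive because of the class of \<open>dmul c B\<close>,
    back to degree 0.\<close>
  have h0: "h 0 \<ge> 1"
  proof -
    have "h (k * m) = h 0" for k
    proof (induction k)
      case (Suc k)
      then show ?case using per[of "k * m"] by (simp add: add.commute)
    qed simp
    then have "h 0 = card (Pic (int (c * m)))" by (simp add: h_def)
    moreover have "c \<le> c * m" using m(1) by simp
    then have "finite (Pic (int (c * m)))" by (rule finPic)
    moreover have "keys (dmul c B) \<subseteq> places"
      using keyB by (auto simp: in_keys_iff lookup_dmul subset_iff)
    then have "divclass (dmul c B) \<in> Pic (int (c * m))" by (auto simp: Pic_def ddeg_dmul degB)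
    ultimately show ?thesis by (metis One_nat_def Suc_leI card_gt_0_iff empty_iff)
  qed
  have "real (card (effective n)) * (real q - 1) = real (h n) * (real q powi (int n - G) - 1)" if n: "n \<ge> c" for n
  proof -
    define Ex where "Ex V = {D. set_mset D \<subseteq> places \<and> mdiv D \<in> V}" for V
    have "effective n = (\<Union>V\<in>Pic (int n). Ex V)"
    proof (intro equalityI subsetI)
      fix D assume D: "D \<in> effective n"
      then have "divclass (mdiv D) \<in> Pic (int n)"
        unfolding Pic_def by (intro imageI) (auto simp: effective_def keys_mdiv ddeg_mdiv)
      then show "D \<in> (\<Union>V\<in>Pic (int n). Ex V)" using D divclass_self by (auto simp: Ex_def effective_def)
    next
      fix D assume "D \<in> (\<Union>V\<in>Pic (int n). Ex V)"
      then obtain A where A: "keys A \<subseteq> places" "ddeg A = int n" "set_mset D \<subseteq> places" "mdiv D \<in> divclass A"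
        by (auto simp: Pic_def Ex_def)
      have "int (\<Sum>P\<in>#D. place_deg P) = int n"
        using keys_divclass(2)[OF A(1,4)] ddeg_mdiv[of D] A(2) by (simp only:)
      then have "(\<Sum>P\<in>#D. place_deg P) = n" by (simp only: of_nat_eq_iff)
      then show "D \<in> effective n" using A(3) by (auto simp: effective_def)
    qed
    moreover have "card (\<Union>V\<in>Pic (int n). Ex V) = (\<Sum>V\<in>Pic (int n). card (Ex V))"
    proof (intro card_UN_disjoint finPic n ballI impI)
      fix V assume V: "V \<in> Pic (int n)"
      show "finite (Ex V)"
        by (rule finite_subset[OF _ finite_effective[of n]]) (use V \<open>effective n = _\<close> in blast)
      fix Y assume Y: "Y \<in> Pic (int n)" "V \<noteq> Y"
      show "Ex V \<inter> Ex Y = {}" using classX[OF V] classX[OF Y(1)] Y(2) by (auto simp: Ex_def)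
    qed
    ultimately have card: "card (effective n) = (\<Sum>V\<in>Pic (int n). card (Ex V))" by simp
    have cardX: "real (card (Ex V)) * (real q - 1) = real q powi (int n - G) - 1" if V: "V \<in> Pic (int n)" for V
    proof -
      obtain A where A: "keys A \<subseteq> places" "ddeg A = int n" "V = divclass A" using V by (auto simp: Pic_def)
      have "real (card (Ex V)) * (real q - 1) = real (card (Ex V) * (q - 1))" using q_ge_2 by (simp add: of_nat_diff)
      also have "card (Ex V) * (q - 1) = q ^ ell A - 1" unfolding Ex_def A(3) by (rule card_effective_class[OF A(1)])
      also have "real (q ^ ell A - 1) = real q powi (int (ell A)) - 1" using q_ge_2 by (simp add: of_nat_diff)
      finally show ?thesis by (simp add: ell(1)[OF A(2) n])
    qed
    show ?thesis using cardX by (simp add: card h_def sum_distrib_right)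
  qed
  then show ?thesis using that[OF m(1) h0 per] by blast
qed

end

section \<open>Function fields over finite constant fields\<close>

interpretation FR: domain "field_ring :: 'a::field ring"
  by (rule field.axioms(1)[OF field_from_type_algebra])

lemma field_ring_simps [simp]:
  "carrier field_ring = UNIV" "\<one>\<^bsub>field_ring\<^esub> = 1" "\<zero>\<^bsub>field_ring\<^esub> = 0"
  "a \<otimes>\<^bsub>field_ring\<^esub> b = a * b" "a \<oplus>\<^bsub>field_ring\<^esub> b = a + b"
  by (simp_all add: ring_of_type_algebra_def)

lemma field_ring_uminus [simp]: "\<ominus>\<^bsub>field_ring\<^esub> a = - a"
  by (rule FR.minus_equality) auto

lemma field_ring_inverse [simp]: "a \<noteq> 0 \<Longrightarrow> inv\<^bsub>field_ring\<^esub> a = inverse a"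
  by (rule FR.comm_inv_char) auto

lemma field_ring_power [simp]: "a [^]\<^bsub>field_ring\<^esub> (n::nat) = a ^ n"
  by (induction n) (auto simp: mult.commute)

lemma poly_Poly_append:
  fixes x :: "'a::comm_ring_1"
  shows "poly (Poly (xs @ ys)) x = poly (Poly xs) x + x ^ length xs * poly (Poly ys) x"
  by (induction xs) (auto simp: algebra_simps)

text \<open>Coefficient lists start with the leading coefficient in \<open>FR.eval\<close> and with
  the constant one in \<open>Poly\<close>.\<close>

lemma field_ring_eval: "FR.eval p x = poly (Poly (rev p)) x"
  by (induction p) (auto simp: poly_Poly_append mult.commute)

lemma algebraic_iff:
  assumes K: "subfield K field_ring"
  shows "FR.algebraic K z \<longleftrightarrow> (\<exists>p\<in>polys_over K. p \<noteq> 0 \<and> poly p z = 0)"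
proof
  have K0: "0 \<in> K" using subringE(2)[OF subfieldE(1)[OF K]] by simp
  assume "FR.algebraic K z"
  then obtain l where l: "l \<in> carrier (univ_poly field_ring K)" "l \<noteq> []" "FR.eval l z = 0"
    using FR.algebraicE[OF subfieldE(1)[OF K], of z] by (auto simp: over_def)
  then have lK: "set l \<subseteq> K" "hd l \<noteq> 0"
    by (auto simp: univ_poly_carrier[symmetric] polynomial_def)
  have "nth_default 0 (rev l) i \<in> K" for i
    using lK K0 by (auto simp: nth_default_def rev_nth intro!: subsetD[OF lK(1)] nth_mem)
  then have "Poly (rev l) \<in> polys_over K" by (simp add: polys_over_def coeff_Poly_eq)
  moreover have "coeff (Poly (rev l)) (length l - 1) \<noteq> 0"
    using l(2) lK(2) by (simp add: coeff_Poly_eq nth_default_def rev_nth hd_conv_nth)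
  then have "Poly (rev l) \<noteq> 0" by (metis coeff_0)
  ultimately show "\<exists>p\<in>polys_over K. p \<noteq> 0 \<and> poly p z = 0"
    using l(3) unfolding field_ring_eval by blast
next
  assume "\<exists>p\<in>polys_over K. p \<noteq> 0 \<and> poly p z = 0"
  then obtain p where p: "p \<in> polys_over K" "p \<noteq> 0" "poly p z = 0" by blast
  define l where "l = rev (coeffs p)"
  have "set l \<subseteq> K"
  proof
    fix c assume "c \<in> set l"
    then obtain i where "i < length (coeffs p)" "coeffs p ! i = c" by (auto simp: l_def in_set_conv_nth)
    then show "c \<in> K" using p(1) by (auto simp: polys_over_def coeffs_nth[OF p(2)] length_coeffs[OF p(2)])
  qed
  moreover have "l \<noteq> []" using p(2) by (simp add: l_def)
  moreover have "hd l \<noteq> 0" using p(2) by (simp add: l_def hd_rev last_coeffs_eq_coeff_degree)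
  ultimately have "l \<in> carrier (univ_poly field_ring K)"
    by (auto simp: univ_poly_carrier[symmetric] polynomial_def)
  moreover have "FR.eval l z = \<zero>\<^bsub>field_ring\<^esub>" by (simp add: field_ring_eval l_def p(3))
  ultimately show "FR.algebraic K z"
    using FR.algebraicI[of l K z] \<open>l \<noteq> []\<close> by (simp add: over_def)
qed

lemma polys_over_ring:
  assumes "0 \<in> K" "1 \<in> K" "\<And>a b. a \<in> K \<Longrightarrow> b \<in> K \<Longrightarrow> a + b \<in> K" "\<And>a b. a \<in> K \<Longrightarrow> b \<in> K \<Longrightarrow> a * b \<in> K"
    "\<And>a. a \<in> K \<Longrightarrow> - a \<in> K" "p \<in> polys_over K" "r \<in> polys_over K"
  shows "p + r \<in> polys_over K" "p * r \<in> polys_over K" "- p \<in> polys_over K"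
  using assms by (auto simp: polys_over_def coeff_mult intro!: sum_mem)

section \<open>Fields generated by one element over K\<close>

lemma generate_field_fraction:
  assumes K: "subfield K field_ring" and e: "e \<in> generate_field field_ring (K \<union> {y})"
  shows "\<exists>p\<in>polys_over K. \<exists>r\<in>polys_over K. poly r y \<noteq> 0 \<and> e = poly p y / poly r y"
proof -
  have K01: "0 \<in> K" "1 \<in> K" using subringE(2,3)[OF subfieldE(1)[OF K]] by simp_all
  have Kop: "\<And>a b. a \<in> K \<Longrightarrow> b \<in> K \<Longrightarrow> a + b \<in> K" "\<And>a b. a \<in> K \<Longrightarrow> b \<in> K \<Longrightarrow> a * b \<in> K"
    "\<And>a. a \<in> K \<Longrightarrow> - a \<in> K"
    using subringE(5,6,7)[OF subfieldE(1)[OF K]] by simp_all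
  note ring = polys_over_ring[OF K01 Kop]
  have const: "[:c:] \<in> polys_over K" if "c \<in> K" for c
    using that K01 by (auto simp: polys_over_def coeff_pCons split: nat.splits)
  have one: "1 \<in> polys_over K" using const[OF K01(2)] by (simp add: one_pCons)
  from e show ?thesis
  proof (induction rule: generate_field.induct)
    case one
    then show ?case using \<open>1 \<in> polys_over K\<close> by (intro bexI[of _ 1]) auto
  next
    case (incl h)
    have "[:0, 1:] \<in> polys_over K" using K01 by (auto simp: polys_over_def coeff_pCons split: nat.splits)
    then have "\<exists>p\<in>polys_over K. h = poly p y"
      using incl const by (elim UnE) (force intro: bexI[of _ "[:h:]"], force intro: bexI[of _ "[:0, 1:]"])
    then obtain p where "p \<in> polys_over K" "h = poly p y" ..
    then show ?case using one by (intro bexI[of _ p] bexI[of _ 1]) auto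
  next
    case (a_inv h)
    then obtain p r where "p \<in> polys_over K" "r \<in> polys_over K" "poly r y \<noteq> 0" "h = poly p y / poly r y" by blast
    then show ?case using ring(3)[of p p] by (intro bexI[of _ "- p"] bexI[of _ r]) auto
  next
    case (m_inv h)
    then obtain p r where "p \<in> polys_over K" "r \<in> polys_over K" "poly r y \<noteq> 0" "h = poly p y / poly r y" by blast
    then show ?case using m_inv.hyps(2) by (intro bexI[of _ r] bexI[of _ p]) auto
  next
    case (eng_add h1 h2)
    then obtain p r p' r' where h: "p \<in> polys_over K" "r \<in> polys_over K" "poly r y \<noteq> 0" "h1 = poly p y / poly r y"
      "p' \<in> polys_over K" "r' \<in> polys_over K" "poly r' y \<noteq> 0" "h2 = poly p' y / poly r' y" by blast
    have "h1 + h2 = poly (p * r' + p' * r) y / poly (r * r') y" using h by (simp add: add_frac_eq)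
    then show ?case
      using h ring by (intro bexI[of _ "p * r' + p' * r"] bexI[of _ "r * r'"]) auto
  next
    case (eng_mult h1 h2)
    then obtain p r p' r' where h: "p \<in> polys_over K" "r \<in> polys_over K" "poly r y \<noteq> 0" "h1 = poly p y / poly r y"
      "p' \<in> polys_over K" "r' \<in> polys_over K" "poly r' y \<noteq> 0" "h2 = poly p' y / poly r' y" by blast
    then show ?case
      by (intro bexI[of _ "p * p'"] bexI[of _ "r * r'"]) (auto intro: ring)
  qed
qed

lemma common_denominator:
  assumes K: "subfield K field_ring" and c: "\<And>i. i < n \<Longrightarrow> c i \<in> generate_field field_ring (K \<union> {y})"
  shows "\<exists>r\<in>polys_over K. poly r y \<noteq> 0 \<and> (\<forall>i<n::nat. \<exists>p\<in>polys_over K. poly p y = c i * poly r y)"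
  using c
proof (induction n)
  case 0
  have "0 \<in> K" "1 \<in> K" using subringE(2,3)[OF subfieldE(1)[OF K]] by simp_all
  then have "1 \<in> polys_over K" by (auto simp: polys_over_def coeff_1 split: if_splits)
  then show ?case by (intro bexI[of _ 1]) auto
next
  case (Suc n)
  have K01: "0 \<in> K" "1 \<in> K" using subringE(2,3)[OF subfieldE(1)[OF K]] by simp_all
  have Kop: "\<And>a b. a \<in> K \<Longrightarrow> b \<in> K \<Longrightarrow> a + b \<in> K" "\<And>a b. a \<in> K \<Longrightarrow> b \<in> K \<Longrightarrow> a * b \<in> K"
    "\<And>a. a \<in> K \<Longrightarrow> - a \<in> K"
    using subringE(5,6,7)[OF subfieldE(1)[OF K]] by simp_all
  note ring = polys_over_ring[OF K01 Kop]
  obtain r where r: "r \<in> polys_over K" "poly r y \<noteq> 0" "\<And>i. i < n \<Longrightarrow> \<exists>p\<in>polys_over K. poly p y = c i * poly r y"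
    using Suc by fastforce
  obtain p' r' where r': "p' \<in> polys_over K" "r' \<in> polys_over K" "poly r' y \<noteq> 0" "c n = poly p' y / poly r' y"
    using generate_field_fraction[OF K Suc.prems[of n]] by auto
  have "\<exists>p\<in>polys_over K. poly p y = c i * poly (r * r') y" if i: "i < Suc n" for i
  proof (cases "i = n")
    case True
    then show ?thesis using r r' by (intro bexI[of _ "p' * r"]) (auto intro: ring)
  next
    case False
    then obtain p where "p \<in> polys_over K" "poly p y = c i * poly r y" using r(3) i by (metis less_SucE)
    then show ?thesis using r' by (intro bexI[of _ "p * r'"]) (auto intro: ring)
  qed
  then show ?case using r r' by (intro bexI[of _ "r * r'"]) (auto intro: ring)
qed

text \<open>\<open>FR.combine\<close> stops at the shorter list; the default 0 pads missing
  coefficients.\<close>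

lemma combine_eq_sum:
  "FR.combine Ks Us = (\<Sum>i<length Us. (if i < length Ks then Ks ! i else 0) * Us ! i)"
proof (induction Ks Us rule: FR.combine.induct)
  case (1 k Ks u Us)
  then show ?case by (simp add: sum.lessThan_Suc_shift del: sum.lessThan_Suc cong: if_cong)
qed auto

text \<open>The exchange property. Clearing denominators in an equation for y over
  \<open>K(x)\<close> gives a polynomial relation between x and y over K, which is then read as an
  equation for x over \<open>K(y)\<close>; it stays nontrivial because y is transcendental over
  K.\<close>

lemma algebraic_swap:
  assumes K: "subfield K field_ring"
    and y: "\<And>p. p \<in> polys_over K \<Longrightarrow> p \<noteq> 0 \<Longrightarrow> poly p y \<noteq> 0"
    and alg: "FR.algebraic (generate_field field_ring (K \<union> {x})) y"
  shows "FR.algebraic (generate_field field_ring (K \<union> {y})) x"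
proof -
  let ?F = "\<lambda>x. generate_field field_ring (K \<union> {x})"
  have sub: "subfield (?F x) field_ring" for x by (rule field.generate_field_is_subfield[OF field_from_type_algebra]) simp
  have KF: "K \<subseteq> ?F y" "y \<in> ?F y" by (auto intro: generate_field.incl)
  have FK: "a + b \<in> ?F y" "a * b \<in> ?F y" if "a \<in> ?F y" "b \<in> ?F y" for a b
    using that subringE(6,7)[OF subfieldE(1)[OF sub]] by fastforce+
  have F0: "0 \<in> ?F y" "1 \<in> ?F y" using subringE(2,3)[OF subfieldE(1)[OF sub]] by fastforce+
  have K0: "0 \<in> K" using subringE(2)[OF subfieldE(1)[OF K]] by simp
  obtain P where P: "P \<in> polys_over (?F x)" "P \<noteq> 0" "poly P y = 0" using alg algebraic_iff[OF sub] by blast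
  define n where "n = Suc (degree P)"
  have "coeff P i \<in> ?F x" for i using P(1) by (simp add: polys_over_def)
  from common_denominator[OF K this, of n "\<lambda>i. i"]
  obtain r where r: "r \<in> polys_over K" "poly r x \<noteq> 0" "\<And>i. i < n \<Longrightarrow> \<exists>p\<in>polys_over K. poly p x = coeff P i * poly r x"
    by blast
  then obtain A where A: "\<And>i. i < n \<Longrightarrow> A i \<in> polys_over K" "\<And>i. i < n \<Longrightarrow> poly (A i) x = coeff P i * poly r x"
    by metis
  define N where "N = Suc (\<Sum>i<n. degree (A i))"
  have degA: "degree (A i) < N" if "i < n" for i
    using member_le_sum[of i "{..<n}" "\<lambda>i. degree (A i)"] that by (simp add: N_def)
  \<comment> \<open>\<open>A i\<close> is the coefficient of \<open>y ^ i\<close>, a polynomial in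
    x; \<open>Bp j\<close> collects the coefficients of \<open>x ^ j\<close> into a polynomial in
    y.\<close>
  define Bp where "Bp j = (\<Sum>i<n. monom (coeff (A i) j) i)" for j
  have Bp: "Bp j \<in> polys_over K" for j
    using A(1) K0 by (auto simp: Bp_def polys_over_def coeff_sum)
  define Q where "Q = (\<Sum>j<N. monom (poly (Bp j) y) j)"
  have coeffQ: "coeff Q j = (if j < N then poly (Bp j) y else 0)" for j by (simp add: Q_def coeff_sum)
  have "poly (Bp j) y \<in> ?F y" for j
  proof -
    have "poly (Bp j) y = (\<Sum>i\<le>degree (Bp j). coeff (Bp j) i * y ^ i)" by (rule poly_altdef)
    also have "y ^ i \<in> ?F y" for i
    proof (induction i)
      case (Suc i)
      show ?case unfolding power_Suc by (rule FK(2)[OF KF(2) Suc])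
    qed (unfold power_0, rule F0(2))
    then have "(\<Sum>i\<le>degree (Bp j). coeff (Bp j) i * y ^ i) \<in> ?F y"
      using Bp[of j] KF by (intro sum_mem FK F0) (auto simp: polys_over_def)
    finally show ?thesis .
  qed
  then have "Q \<in> polys_over (?F y)" using F0 by (simp add: polys_over_def coeffQ)
  moreover have "poly Q x = 0"
  proof -
    have "poly Q x = (\<Sum>j<N. (\<Sum>i<n. coeff (A i) j * y ^ i) * x ^ j)"
      by (simp add: Q_def Bp_def poly_sum poly_monom)
    also have "\<dots> = (\<Sum>i<n. (\<Sum>j<N. coeff (A i) j * x ^ j) * y ^ i)"
      unfolding sum_distrib_right by (subst sum.swap) (simp add: mult_ac)
    also have "\<dots> = (\<Sum>i<n. poly (A i) x * y ^ i)"
    proof (intro sum.cong refl, goal_cases)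
      case (1 i)
      have "(\<Sum>j<N. coeff (A i) j * x ^ j) = (\<Sum>j\<le>degree (A i). coeff (A i) j * x ^ j)"
        using degA[of i] 1 by (intro sum.mono_neutral_right) (auto simp: coeff_eq_0)
      then show ?case by (simp add: poly_altdef)
    qed
    also have "\<dots> = poly r x * (\<Sum>i<n. coeff P i * y ^ i)"
      by (simp add: A(2) sum_distrib_left mult_ac)
    also have "(\<Sum>i<n. coeff P i * y ^ i) = poly P y"
      by (simp add: poly_altdef n_def lessThan_Suc_atMost)
    finally show ?thesis using P(3) by simp
  qed
  moreover have "Q \<noteq> 0"
  proof
    assume "Q = 0"
    let ?i = "degree P"
    have i: "?i < n" by (simp add: n_def)
    have "poly (A ?i) x \<noteq> 0" using A(2)[OF i] P(2) r(2) by simp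
    then have "A ?i \<noteq> 0" by auto
    then obtain j where j: "coeff (A ?i) j \<noteq> 0" by (metis leading_coeff_0_iff)
    then have "j < N" using degA[OF i] le_degree[OF j] by simp
    then have "poly (Bp j) y = 0" using \<open>Q = 0\<close> coeffQ[of j] by simp
    then have "Bp j = 0" using y[OF Bp[of j]] by blast
    then have "coeff (Bp j) ?i = 0" by simp
    then show False using i j by (simp add: Bp_def coeff_sum)
  qed
  ultimately show ?thesis using algebraic_iff[OF sub] by blast
qed

text \<open>With n the dimension over \<open>K(y)\<close>, any n + 1 elements are dependent, and a
  common denominator moves the coefficients into \<open>K[y]\<close>.\<close>

lemma finite_dimension_all_dependent:
  assumes K: "subfield K field_ring"
    and fin: "FR.finite_dimension (generate_field field_ring (K \<union> {y})) UNIV"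
  shows "\<exists>n. all_dependent K y n"
proof -
  let ?F = "generate_field field_ring (K \<union> {y})"
  have sub: "subfield ?F field_ring" by (rule field.generate_field_is_subfield[OF field_from_type_algebra]) simp
  have F0: "0 \<in> ?F" using subringE(2)[OF subfieldE(1)[OF sub]] by simp
  obtain n where n: "FR.dimension n ?F UNIV" using fin by (auto simp: FR.finite_dimension_def)
  have "\<exists>p. (\<forall>i<Suc n. p i \<in> polys_over K) \<and> (\<exists>i<Suc n. p i \<noteq> 0) \<and> (\<Sum>i<Suc n. poly (p i) y * us i) = 0" for us
  proof -
    define Us where "Us = map us [0..<Suc n]"
    have "\<not> FR.independent ?F Us"
      using FR.independent_length_le_dimension[OF sub n, of Us] by (auto simp: Us_def simp del: upt_Suc)
    then obtain Ks where Ks: "set Ks \<subseteq> ?F" "FR.combine Ks Us = 0" "\<not> set (take (length Us) Ks) \<subseteq> {0}"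
      using FR.trivial_combine_imp_independent[OF sub, of Us] by auto
    define c where "c i = (if i < length Ks then Ks ! i else 0)" for i
    have cF: "c i \<in> ?F" for i using Ks(1) F0 by (auto simp: c_def)
    have sum: "(\<Sum>i<Suc n. c i * us i) = 0"
    proof -
      have "(\<Sum>i<Suc n. c i * us i) = (\<Sum>i<length Us. c i * Us ! i)"
        by (intro sum.cong) (auto simp: Us_def simp del: upt_Suc)
      then show ?thesis using Ks(2) by (simp add: combine_eq_sum c_def)
    qed
    obtain a where a: "a \<in> set (take (length Us) Ks)" "a \<noteq> 0" using Ks(3) by blast
    then obtain i where "i < length (take (length Us) Ks)" "take (length Us) Ks ! i = a"
      by (auto simp: in_set_conv_nth)
    then have i: "i < Suc n" "c i \<noteq> 0" using a(2) by (auto simp: c_def Us_def simp del: upt_Suc)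
    obtain r where r: "r \<in> polys_over K" "poly r y \<noteq> 0" "\<And>i. i < Suc n \<Longrightarrow> \<exists>p\<in>polys_over K. poly p y = c i * poly r y"
      using common_denominator[OF K cF, of "Suc n" "\<lambda>i. i"] by blast
    then obtain p where p: "\<And>i. i < Suc n \<Longrightarrow> p i \<in> polys_over K" "\<And>i. i < Suc n \<Longrightarrow> poly (p i) y = c i * poly r y"
      by metis
    have "(\<Sum>i<Suc n. poly (p i) y * us i) = poly r y * (\<Sum>i<Suc n. c i * us i)"
      unfolding sum_distrib_left by (intro sum.cong refl) (simp add: p(2) mult_ac)
    then have "(\<Sum>i<Suc n. poly (p i) y * us i) = 0" using sum by simp
    moreover have "p i \<noteq> 0" using p(2)[OF i(1)] i(2) r(2) by auto
    ultimately show ?thesis using p(1) i(1) by blast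
  qed
  then show ?thesis unfolding all_dependent_def by blast
qed

text \<open>Finiteness over \<open>K(y)\<close> for an arbitrary y outside K comes from a tower with
  middle field \<open>K(y)(x)\<close>: x is algebraic over \<open>K(y)\<close> by exchange, and the
  finitely many generators are algebraic over \<open>K(x)\<close>, hence over the middle
  field.\<close>

lemma function_field_imp_const:
  assumes ff: "function_field K" and fin: "finite K"
  shows "function_field_const K"
proof -
  have K: "subfield K field_ring" using ff by (simp add: function_field_def)
  obtain S where S: "finite S" "generate_field field_ring (K \<union> S) = UNIV" using ff by (auto simp: function_field_def)
  let ?F = "\<lambda>x. generate_field field_ring (K \<union> {x})"
  obtain x where x: "FR.transcendental K x" "\<And>y. FR.algebraic (?F x) y" using ff by (auto simp: function_field_def)
  have full: "\<And>y. FR.algebraic K y \<Longrightarrow> y \<in> K" using ff by (auto simp: function_field_def)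
  note ring = subringE[OF subfieldE(1)[OF K], simplified]
  have trans: "poly p y \<noteq> 0" if "y \<notin> K" "p \<in> polys_over K" "p \<noteq> 0" for y p
    using full[of y] that algebraic_iff[OF K, of y] by blast
  have xK: "x \<notin> K" using FR.algebraic_self[OF subfieldE(1)[OF K], of x] x(1) by (auto simp: over_def)
  have dep: "\<exists>n. all_dependent K y n" if y: "y \<notin> K" for y
  proof (rule finite_dimension_all_dependent[OF K])
    have sub: "subfield (?F z) field_ring" for z by (rule field.generate_field_is_subfield[OF field_from_type_algebra]) simp
    have xalg: "FR.algebraic (?F y) x"
      by (rule algebraic_swap[OF K _ x(2)]) (rule trans[OF y])
    define G where "G = FR.simple_extension (?F y) x"
    have G: "subfield G field_ring"
      unfolding G_def using FR.simple_extension_is_subfield[OF sub[of y], of x] xalg by (simp add: over_def)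
    have GF: "?F y \<subseteq> G" unfolding G_def by (rule FR.simple_extension_incl) auto
    have xG: "x \<in> G" unfolding G_def by (rule FR.simple_extension_mem[OF subfieldE(1)[OF sub]]) simp
    have KG: "K \<subseteq> G" using GF by (auto intro: generate_field.incl)
    have FxG: "?F x \<subseteq> G" using KG xG by (intro field.generate_field_min_subfield1[OF field_from_type_algebra _ G]) auto
    obtain xs where xs: "set xs = S" using S(1) finite_list by blast
    have alg: "(FR.algebraic over G) s" for s
      using FR.algebraic_mono[OF FxG, of s] x(2) by (simp add: over_def)
    have "FR.finite_dimension (?F y) G"
      unfolding G_def using FR.finite_dimension_simple_extension[OF sub[of y], of x] xalg by (simp add: over_def)
    moreover have "FR.finite_dimension G (FR.finite_extension G xs)"
      by (rule FR.finite_extension_finite_dimension(1)[OF G _ alg]) simp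
    moreover have "FR.finite_extension G xs = UNIV"
    proof -
      have "subfield (FR.finite_extension G xs) field_ring"
        by (rule FR.finite_extension_is_subfield[OF G _ alg]) simp
      moreover have "K \<subseteq> FR.finite_extension G xs" "S \<subseteq> FR.finite_extension G xs"
        using KG FR.finite_extension_incl[of G xs] FR.finite_extension_mem[OF subfieldE(1)[OF G], of xs] xs by auto
      ultimately have "generate_field field_ring (K \<union> S) \<subseteq> FR.finite_extension G xs"
        by (intro field.generate_field_min_subfield1[OF field_from_type_algebra]) auto
      then show ?thesis using S(2) by auto
    qed
    ultimately show "FR.finite_dimension (?F y) UNIV"
      using FR.telescopic_base_dim(1)[OF sub[of y] G] by simp
  qed
  have inv: "inverse a \<in> K" if "a \<in> K" for a
    using that FR.subfield_m_inv(1)[OF K, of a] ring by (cases "a = 0") auto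
  show ?thesis
    by unfold_locales (use ring fin trans dep xK inv in auto)
qed

section \<open>Residue degrees as dimensions of residue fields\<close>

lemma (in ring) card_dimension:
  assumes K: "subfield K R" "finite K" and n: "dimension n K E"
  shows "finite E \<and> card E = card K ^ n"
  using n K
proof (induction n K E rule: dimension.induct)
  case (Suc_dim v E n K)
  note K = Suc_dim.prems
  note E = space_subgroup_props[OF K(1) Suc_dim.hyps(3)]
  note Kp = subringE[OF subfieldE(1)[OF K(1)]]
  have vR: "v \<in> carrier R" by fact
  have KR: "\<And>k. k \<in> K \<Longrightarrow> k \<in> carrier R" and ER: "\<And>e. e \<in> E \<Longrightarrow> e \<in> carrier R"
    using Kp(1) E(1) by blast+
  have line: "line_extension K v E = (\<lambda>(k, e). k \<otimes> v \<oplus> e) ` (K \<times> E)"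
    by (auto simp: line_extension_mem_iff; blast)
  have "inj_on (\<lambda>(k, e). k \<otimes> v \<oplus> e) (K \<times> E)"
  proof (rule inj_onI, safe)
    fix k e k' e' assume ke: "k \<in> K" "e \<in> E" "k' \<in> K" "e' \<in> E" and eq: "k \<otimes> v \<oplus> e = k' \<otimes> v \<oplus> e'"
    have c: "k \<otimes> v \<in> carrier R" "k' \<otimes> v \<in> carrier R" "e \<in> carrier R" "e' \<in> carrier R"
      using ke vR KR ER by auto
    have "(k \<ominus> k') \<otimes> v = e' \<ominus> e"
    proof -
      have "(k \<ominus> k') \<otimes> v = k \<otimes> v \<ominus> k' \<otimes> v"
        using ke KR vR by (simp add: a_minus_def l_distr l_minus)
      also have "\<dots> = (k \<otimes> v \<oplus> e) \<ominus> e \<ominus> k' \<otimes> v" using c by algebra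
      also have "\<dots> = (k' \<otimes> v \<oplus> e') \<ominus> e \<ominus> k' \<otimes> v" by (simp only: eq)
      also have "\<dots> = e' \<ominus> e" using c by algebra
      finally show ?thesis .
    qed
    moreover have "e' \<ominus> e \<in> E" using ke E(3,4) by (simp add: a_minus_def)
    ultimately have mem: "(k \<ominus> k') \<otimes> v \<in> E" by simp
    have "k \<ominus> k' \<in> K" using ke Kp(5,7) by (simp add: a_minus_def)
    then have "k \<ominus> k' = \<zero>" using E(6)[of "k \<ominus> k'" v] mem vR Suc_dim.hyps(2) by blast
    then show kk: "k = k'" using ke KR by simp
    show "e = e'" using eq c unfolding kk by simp
  qed
  then show ?case unfolding line using Suc_dim.IH K by (simp add: card_image card_cartesian_product)
qed simp

context
  fixes K :: "'a::field set"
  assumes ff: "function_field K" and fin: "finite K"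
begin

interpretation function_field_const K
  by (rule function_field_imp_const[OF ff fin])

lemma subfield_K: "subfield K field_ring"
  using ff by (simp add: function_field_def)

lemma subring_place: "R \<in> places \<Longrightarrow> subring R field_ring"
  by (rule FR.subringI) (auto intro: place_1 place_uminus place_mult place_add)

lemma prime_divisors_eq: "prime_divisors K = places"
proof (intro equalityI subsetI)
  fix R assume "R \<in> prime_divisors K"
  then have R: "subring R field_ring" "K \<subseteq> R" "R \<noteq> UNIV" "\<forall>z. z \<in> R \<or> inverse z \<in> R"
    by (auto simp: prime_divisors_def)
  then show "R \<in> places" using subringE(6,7)[OF R(1)] by (simp add: places_def)
next
  fix R assume R: "R \<in> places"
  have "K \<noteq> R"
  proof
    assume "K = R"
    then have "z \<in> K" for z using place_inverse[OF R, of z] inverse_K[of "inverse z"] by auto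
    then show False using K_ne_UNIV by blast
  qed
  then show "R \<in> prime_divisors K"
    using R subring_place[OF R] place_ne_UNIV[OF R] by (auto simp: prime_divisors_def places_def)
qed

lemma maximal_ideal_of_eq:
  assumes R: "R \<in> places"
  shows "maximal_ideal_of R = max_ideal R"
proof -
  have unit: "z \<in> Units (field_ring\<lparr>carrier := R\<rparr>) \<longleftrightarrow> z \<in> R \<and> z \<noteq> 0 \<and> inverse z \<in> R" for z
  proof -
    have "inverse z = x" if "x * z = 1" for x using that by (metis inverse_unique mult.commute)
    moreover have "z \<noteq> 0" if "x * z = 1" for x using that by auto
    ultimately show ?thesis by (auto simp: Units_def intro!: bexI[of _ "inverse z"])
  qed
  show ?thesis
  proof (rule Set.set_eqI)
    fix z
    have "z \<in> max_ideal R \<longleftrightarrow> z \<in> R \<and> (z = 0 \<or> inverse z \<notin> R)"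
      using max_ideal_subset[OF R, of z] by (simp add: max_ideal_def) blast
    then show "z \<in> maximal_ideal_of R \<longleftrightarrow> z \<in> max_ideal R"
      unfolding maximal_ideal_of_def Diff_iff unit by blast
  qed
qed

text \<open>Both numbers are the exponent of q in the cardinality of the residue field: its elements
  are the distinct cosets of \<open>residues R\<close>, and \<open>card_dimension\<close> counts
  them through the dimension over the image of K.\<close>

lemma prime_degree_eq:
  assumes R: "R \<in> places"
  shows "prime_degree K R = place_deg R"
proof -
  define S where "S = field_ring\<lparr>carrier := R\<rparr>"
  define M where "M = max_ideal R"
  define Q where "Q = S Quot M"
  define h where "h a = M +>\<^bsub>S\<^esub> a" for a
  have Q: "residue_field R = Q"
    by (simp add: residue_field_def maximal_ideal_of_eq[OF R] Q_def S_def M_def)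
  have S_simps: "carrier S = R" "\<And>a b. a \<otimes>\<^bsub>S\<^esub> b = a * b" "\<And>a b. a \<oplus>\<^bsub>S\<^esub> b = a + b" "\<one>\<^bsub>S\<^esub> = 1" "\<zero>\<^bsub>S\<^esub> = 0"
    by (simp_all add: S_def)
  have ringS: "ring S" unfolding S_def by (rule FR.subring_is_ring[OF subring_place[OF R]])
  have h_eq: "h a = {m + a | m. m \<in> M}" for a
    by (auto simp: h_def a_r_coset_def' S_simps)
  have M_diff: "a - b \<in> M" "a + b \<in> M" if "a \<in> M" "b \<in> M" for a b
    using that ksubspace_diff[OF ksubspace_max_ideal[OF R]] max_ideal_add[OF R] by (auto simp: M_def)
  have M0: "0 \<in> M" by (simp add: M_def max_ideal_def)
  have h_iff: "h a = h b \<longleftrightarrow> a - b \<in> M" for a b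
  proof
    assume "h a = h b"
    moreover have "0 + a \<in> h a" using M0 unfolding h_eq by blast
    ultimately obtain m where "m \<in> M" "a = m + b" unfolding h_eq by auto
    then show "a - b \<in> M" by simp
  next
    assume ab: "a - b \<in> M"
    have "x + a = (x + (a - b)) + b" "x + b = (x - (a - b)) + a" for x by simp_all
    then show "h a = h b" unfolding h_eq using M_diff[OF _ ab] by (blast)
  qed
  have ideal: "ideal M S"
  proof (rule idealI[OF ringS])
    show "subgroup M (add_monoid S)"
    proof (rule group.subgroupI)
      show "group (add_monoid S)" by (rule abelian_group.a_group[OF ring.axioms(1)[OF ringS]])
      show "M \<subseteq> carrier (add_monoid S)" using max_ideal_subset[OF R] by (auto simp: M_def S_simps)
      show "M \<noteq> {}" using M0 by blast
      show "a \<otimes>\<^bsub>add_monoid S\<^esub> b \<in> M" if "a \<in> M" "b \<in> M" for a b using M_diff that by (simp add: S_simps)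
      show "inv\<^bsub>add_monoid S\<^esub> a \<in> M" if "a \<in> M" for a
      proof -
        interpret S: ring S by (rule ringS)
        have "a \<in> R" using that max_ideal_subset[OF R] by (simp add: M_def)
        then have "\<ominus>\<^bsub>S\<^esub> a = - a" using place_uminus[OF R] by (intro S.minus_equality) (auto simp: S_simps)
        then show ?thesis using M_diff(1)[OF M0 that] by (simp add: a_inv_def)
      qed
    qed
  qed (use max_ideal_mult[OF R] in \<open>auto simp: S_simps M_def mult.commute\<close>)
  interpret Q: ring Q unfolding Q_def by (rule ideal.quotient_is_ring[OF ideal])
  interpret h: ring_hom_ring S Q h
    unfolding Q_def h_def[abs_def] by (rule ideal.rcos_ring_hom_ring[OF ideal])
  have carrier: "carrier Q = h ` residues R"
  proof -
    have "carrier Q = h ` R" by (auto simp: Q_def FactRing_def A_RCOSETS_defs h_def a_r_coset_def S_simps)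
    also have "h ` R = h ` residues R"
    proof (intro equalityI subsetI)
      fix c assume "c \<in> h ` R"
      then obtain z where z: "z \<in> R" "c = h z" by blast
      then obtain a where "a \<in> residues R" "z - a \<in> M" using residues(4)[OF R] by (auto simp: M_def)
      then show "c \<in> h ` residues R" using h_iff z by blast
    qed (use residues(2)[OF R] in blast)
    finally show ?thesis .
  qed
  have "inj_on h (residues R)"
    using residues(3)[OF R] unfolding inj_on_def h_iff M_def by blast
  then have card: "card (carrier Q) = q ^ place_deg R" and finQ: "finite (carrier Q)"
    using card_residues[OF R] residues(1)[OF R] by (simp_all add: carrier card_image)
  have subK: "subfield K S"
  proof (rule ring.subfield_iff(1)[OF ringS])
    have "S\<lparr>carrier := K\<rparr> = field_ring\<lparr>carrier := K\<rparr>" by (simp add: S_def)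
    then show "field (S\<lparr>carrier := K\<rparr>)" using FR.subfield_iff(2)[OF subfield_K] by simp
    show "K \<subseteq> carrier S" using place_K[OF R] by (auto simp: S_simps)
  qed
  have "\<one>\<^bsub>Q\<^esub> \<noteq> \<zero>\<^bsub>Q\<^esub>"
  proof
    assume "\<one>\<^bsub>Q\<^esub> = \<zero>\<^bsub>Q\<^esub>"
    then have "h 1 = M" by (simp add: Q_def FactRing_def h_def S_simps)
    then have "0 + 1 \<in> M" using M0 unfolding h_eq by blast
    then show False using one_notin_max_ideal[OF R] by (simp add: M_def)
  qed
  from h.img_is_subfield[OF subK this] have inj: "inj_on h K" and sub: "subfield (h ` K) Q" .
  obtain Us where Us: "set Us = carrier Q" using finite_list[OF finQ] by blast
  have "Q.Span (h ` K) Us = carrier Q"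
    using Q.Span_in_carrier[OF subfieldE(3)[OF sub], of Us] Q.Span_base_incl[OF sub, of Us] Us by auto
  then have "Q.finite_dimension (h ` K) (carrier Q)"
    using Q.Span_finite_dimension[OF sub, of Us] Us by simp
  then have dim: "Q.dimension (Q.dim (h ` K) (carrier Q)) (h ` K) (carrier Q)"
    using Q.finite_dimensionE[OF sub] by (simp add: over_def)
  have "card (carrier Q) = card (h ` K) ^ Q.dim (h ` K) (carrier Q)"
    using Q.card_dimension[OF sub _ dim] finite_K by simp
  then have "q ^ place_deg R = q ^ Q.dim (h ` K) (carrier Q)" using card inj by (simp add: card_image)
  then have "place_deg R = Q.dim (h ` K) (carrier Q)" by (rule power_q_inj)
  moreover have "prime_degree K R = Q.dim (h ` K) (carrier Q)"
    unfolding prime_degree_def Q by (simp add: maximal_ideal_of_eq[OF R] h_def[abs_def] S_def M_def)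
  ultimately show ?thesis by simp
qed

lemma positive_divisors_eq: "positive_divisors K = {D. set_mset D \<subseteq> places}"
  by (simp add: positive_divisors_def prime_divisors_eq)

lemma divisor_degree_eq: "D \<in> positive_divisors K \<Longrightarrow> divisor_degree K D = (\<Sum>P\<in>#D. place_deg P)"
  unfolding divisor_degree_def positive_divisors_eq
  by (intro arg_cong[where f = sum_mset] image_mset_cong) (auto simp: prime_degree_eq)

lemma divisors_of_degree:
  obtains c m :: nat and G :: int and h :: "nat \<Rightarrow> nat" where "m \<ge> 1" "h 0 \<ge> 1" "\<And>n. h (n + m) = h n"
    "\<And>n. finite {D\<in>positive_divisors K. divisor_degree K D = n}"
    "\<And>n. n \<ge> c \<Longrightarrow> real (card {D\<in>positive_divisors K. divisor_degree K D = n}) * (real (card K) - 1) =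
      real (h n) * (real (card K) powi (int n - G) - 1)"
proof -
  have eq: "{D\<in>positive_divisors K. divisor_degree K D = n} = effective n" for n
    using divisor_degree_eq by (auto simp: effective_def positive_divisors_eq)
  show ?thesis
    by (rule card_effective) (rule that[unfolded eq, OF _ _ _ finite_effective])
qed

lemma card_K_ge_2: "card K \<ge> 2"
  by (rule q_ge_2)

end

section \<open>The proximity function\<close>

text \<open>Trades a logarithmic singularity for an inverse square root, whose integral is
  elementary.\<close>

lemma ln_one_plus_le_sqrt:
  assumes "t > (0::real)" shows "ln (1 + t) \<le> 2 * sqrt t"
proof -
  have "1 + t \<le> (1 + sqrt t)\<^sup>2" using assms by (simp add: power2_eq_square algebra_simps)
  then have "ln (1 + t) \<le> ln ((1 + sqrt t)\<^sup>2)" using assms by (subst ln_le_cancel_iff) (auto intro: add_pos_nonneg)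
  also have "\<dots> = 2 * ln (1 + sqrt t)" using assms by (subst ln_realpow) (auto intro: add_pos_nonneg)
  also have "\<dots> \<le> 2 * sqrt t" using ln_add_one_self_le_self[of "sqrt t"] assms by simp
  finally show ?thesis .
qed

text \<open>The primitive changes its form at \<beta> but stays continuous, so the fundamental
  theorem applies with one exceptional point.\<close>

lemma has_integral_inverse_sqrt_abs:
  fixes a b \<beta> :: real
  assumes "a \<le> \<beta>" "\<beta> \<le> b"
  shows "((\<lambda>x. 1 / sqrt \<bar>x - \<beta>\<bar>) has_integral (2 * sqrt (b - \<beta>) + 2 * sqrt (\<beta> - a))) {a..b}"
proof -
  define g where "g x = (if x \<le> \<beta> then - 2 * sqrt (\<beta> - x) else 2 * sqrt (x - \<beta>))" for x
  have "continuous_on {a..b} g"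
    unfolding g_def
  proof (rule continuous_on_subset[OF _ subset_UNIV], rule continuous_on_cases_le[where h = "\<lambda>x. x"])
  qed (auto intro!: continuous_intros)
  moreover have "(g has_vector_derivative 1 / sqrt \<bar>x - \<beta>\<bar>) (at x)" if x: "x \<in> {a<..<b} - {\<beta>}" for x
  proof (cases "x < \<beta>")
    case True
    have "((\<lambda>x. - 2 * sqrt (\<beta> - x)) has_real_derivative 1 / sqrt \<bar>x - \<beta>\<bar>) (at x)"
      using True by (auto intro!: derivative_eq_intros simp: field_simps)
    then have "(g has_real_derivative 1 / sqrt \<bar>x - \<beta>\<bar>) (at x)"
      by (rule has_field_derivative_transform_within_open[of _ _ _ "{..<\<beta>}"]) (use True in \<open>auto simp: g_def\<close>)
    then show ?thesis by (simp add: has_real_derivative_iff_has_vector_derivative)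
  next
    case False
    then have "x > \<beta>" using x by simp
    have "((\<lambda>x. 2 * sqrt (x - \<beta>)) has_real_derivative 1 / sqrt \<bar>x - \<beta>\<bar>) (at x)"
      using \<open>x > \<beta>\<close> by (auto intro!: derivative_eq_intros simp: field_simps)
    then have "(g has_real_derivative 1 / sqrt \<bar>x - \<beta>\<bar>) (at x)"
      by (rule has_field_derivative_transform_within_open[of _ _ _ "{\<beta><..}"]) (use \<open>x > \<beta>\<close> in \<open>auto simp: g_def\<close>)
    then show ?thesis by (simp add: has_real_derivative_iff_has_vector_derivative)
  qed
  ultimately have "((\<lambda>x. 1 / sqrt \<bar>x - \<beta>\<bar>) has_integral (g b - g a)) {a..b}"
    using assms by (intro fundamental_theorem_of_calculus_interior_strong[of "{\<beta>}"]) auto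
  moreover have "g b - g a = 2 * sqrt (b - \<beta>) + 2 * sqrt (\<beta> - a)"
    using assms by (auto simp: g_def)
  ultimately show ?thesis by simp
qed

text \<open>Jordan's inequality, from the concavity of sin.\<close>

lemma abs_sin_ge:
  assumes "\<bar>v\<bar> \<le> pi / 2" shows "\<bar>sin v\<bar> \<ge> 2 * \<bar>v\<bar> / pi"
proof -
  have *: "sin v \<ge> 2 * v / pi" if v: "0 \<le> v" "v \<le> pi / 2" for v
  proof -
    have "concave_on {0..pi/2} sin"
      by (rule f''_le0_imp_concave[where f' = cos and f'' = "\<lambda>x. - sin x"])
        (auto intro!: derivative_eq_intros sin_ge_zero)
    moreover define t where "t = 2 * v / pi"
    have "0 \<le> t" "t \<le> 1" using v by (auto simp: t_def field_simps)
    ultimately have "sin ((1 - t) *\<^sub>R 0 + t *\<^sub>R (pi / 2)) \<ge> (1 - t) * sin 0 + t * sin (pi / 2)"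
      by (intro concave_onD) auto
    then show ?thesis by (simp add: t_def)
  qed
  show ?thesis
    using *[of "\<bar>v\<bar>"] assms by (cases "v \<ge> 0") auto
qed

text \<open>The range of \<beta> corresponds to cosines between 0 and 1/2. It keeps half the sum of
  the angles between \<open>pi / 6\<close> and \<open>3 * pi / 4\<close>, where sin is at least 1/2;
  Jordan's inequality handles half the difference.\<close>

lemma abs_cos_diff_ge:
  assumes \<beta>: "pi / 3 \<le> \<beta>" "\<beta> \<le> pi / 2" and \<theta>: "0 \<le> \<theta>" "\<theta> \<le> pi"
  shows "\<bar>cos \<theta> - cos \<beta>\<bar> \<ge> \<bar>\<theta> - \<beta>\<bar> / pi"
proof -
  have s1: "sin ((\<theta> + \<beta>) / 2) \<ge> 1 / 2"
  proof (cases "(\<theta> + \<beta>) / 2 \<le> pi / 2")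
    case True
    have "sin (pi / 6) \<le> sin ((\<theta> + \<beta>) / 2)"
      using True assms by (subst sin_mono_le_eq) auto
    then show ?thesis by (simp add: sin_30)
  next
    case False
    define v where "v = pi - (\<theta> + \<beta>) / 2"
    have "\<theta> + \<beta> \<le> pi + pi / 2" "\<theta> + \<beta> \<ge> pi" using assms False by (linarith, simp)
    moreover have "2 * v = 2 * pi - (\<theta> + \<beta>)" by (simp add: v_def)
    ultimately have "pi / 6 \<le> v" "v \<le> pi / 2" using pi_gt_zero by linarith+
    then have "sin (pi / 6) \<le> sin v" using pi_gt_zero by (subst sin_mono_le_eq) linarith+
    moreover have "sin v = sin ((\<theta> + \<beta>) / 2)" by (simp add: v_def)
    ultimately have "sin (pi / 6) \<le> sin ((\<theta> + \<beta>) / 2)" by simp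
    then show ?thesis by (simp add: sin_30)
  qed
  have s2: "\<bar>sin ((\<beta> - \<theta>) / 2)\<bar> \<ge> 2 * \<bar>(\<beta> - \<theta>) / 2\<bar> / pi"
    using assms by (intro abs_sin_ge) auto
  have "\<bar>cos \<theta> - cos \<beta>\<bar> = 2 * (\<bar>sin ((\<theta> + \<beta>) / 2)\<bar> * \<bar>sin ((\<beta> - \<theta>) / 2)\<bar>)"
    by (simp add: cos_diff_cos abs_mult)
  moreover have "1 / 2 * (2 * \<bar>(\<beta> - \<theta>) / 2\<bar> / pi) \<le> \<bar>sin ((\<theta> + \<beta>) / 2)\<bar> * \<bar>sin ((\<beta> - \<theta>) / 2)\<bar>"
    using s1 s2 by (intro mult_mono) auto
  ultimately show ?thesis by (simp add: abs_minus_commute)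
qed

text \<open>Singular at \<beta> and at its mirror image \<open>2 * pi - \<beta>\<close>, the two
  angles at which a circle around 0 meets a vertical line.\<close>

definition inv_sqrt_pair :: "real \<Rightarrow> real \<Rightarrow> real" where
  "inv_sqrt_pair \<beta> \<theta> = 1 / sqrt \<bar>\<theta> - \<beta>\<bar> + 1 / sqrt \<bar>\<theta> - (2 * pi - \<beta>)\<bar>"

lemma inv_sqrt_pair_integral:
  assumes "0 \<le> \<beta>" "\<beta> \<le> 2 * pi"
  shows "inv_sqrt_pair \<beta> integrable_on {0..2*pi}" "integral {0..2*pi} (inv_sqrt_pair \<beta>) \<le> 8 * sqrt (2 * pi)"
proof -
  have 1: "((\<lambda>x. 1 / sqrt \<bar>x - \<beta>\<bar>) has_integral (2 * sqrt (2*pi - \<beta>) + 2 * sqrt (\<beta> - 0))) {0..2*pi}"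
    using assms by (intro has_integral_inverse_sqrt_abs)
  have 2: "((\<lambda>x. 1 / sqrt \<bar>x - (2*pi - \<beta>)\<bar>) has_integral (2 * sqrt (2*pi - (2*pi - \<beta>)) + 2 * sqrt ((2*pi - \<beta>) - 0))) {0..2*pi}"
    using assms by (intro has_integral_inverse_sqrt_abs) auto
  have I: "(inv_sqrt_pair \<beta> has_integral (2 * sqrt (2*pi - \<beta>) + 2 * sqrt (\<beta> - 0) +
      (2 * sqrt (2*pi - (2*pi - \<beta>)) + 2 * sqrt ((2*pi - \<beta>) - 0)))) {0..2*pi}"
    unfolding inv_sqrt_pair_def by (rule has_integral_add[OF 1 2])
  show "inv_sqrt_pair \<beta> integrable_on {0..2*pi}" using I by (rule has_integral_integrable)
  have "integral {0..2*pi} (inv_sqrt_pair \<beta>) = 4 * sqrt (2*pi - \<beta>) + 4 * sqrt \<beta>"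
    using integral_unique[OF I] by simp
  moreover have "sqrt (2*pi - \<beta>) \<le> sqrt (2*pi)" "sqrt \<beta> \<le> sqrt (2*pi)" using assms by auto
  ultimately show "integral {0..2*pi} (inv_sqrt_pair \<beta>) \<le> 8 * sqrt (2 * pi)" by linarith
qed

text \<open>The distance of a point of the circle from the line Re s = a is at least
  \<open>1 / pi\<close> times its angular distance to one of the two intersection points. The
  condition r \<ge> 2 puts \<open>arccos (a / r)\<close> into the range of
  \<open>abs_cos_diff_ge\<close>.\<close>

lemma ln_one_plus_inverse_le:
  assumes r: "r \<ge> 2" and a: "a = 0 \<or> a = (1::real)" and \<theta>: "0 \<le> \<theta>" "\<theta> \<le> 2 * pi" and ne: "r * cos \<theta> \<noteq> a"
  shows "ln (1 + 1 / \<bar>r * cos \<theta> - a\<bar>) \<le> 2 * sqrt pi * inv_sqrt_pair (arccos (a / r)) \<theta>"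
proof -
  define \<beta> where "\<beta> = arccos (a / r)"
  have ar: "0 \<le> a / r" "a / r \<le> 1 / 2" using r a by auto
  have cos\<beta>: "cos \<beta> = a / r" unfolding \<beta>_def using ar(1) r a by (intro cos_arccos) auto
  have \<beta>: "pi / 3 \<le> \<beta>" "\<beta> \<le> pi / 2"
  proof -
    have "arccos (1 / 2) \<le> arccos (a / r)" using ar by (intro arccos_le_arccos) auto
    moreover have "arccos (1 / 2) = pi / 3" using arccos_cos[of "pi / 3"] by (simp add: cos_60)
    ultimately show "pi / 3 \<le> \<beta>" by (simp add: \<beta>_def)
    show "\<beta> \<le> pi / 2" unfolding \<beta>_def by (rule arccos_le_pi2[OF ar(1)]) (use r a in auto)
  qed
  have eq: "r * cos \<theta> - a = r * (cos \<theta> - cos \<beta>)" using r by (simp add: cos\<beta> algebra_simps)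
  have "\<bar>cos \<theta> - cos \<beta>\<bar> \<ge> \<bar>\<theta> - \<beta>\<bar> / pi \<or> \<bar>cos \<theta> - cos \<beta>\<bar> \<ge> \<bar>\<theta> - (2 * pi - \<beta>)\<bar> / pi"
  proof (cases "\<theta> \<le> pi")
    case True
    then show ?thesis using abs_cos_diff_ge[OF \<beta> \<theta>(1)] by blast
  next
    case False
    then have "\<bar>cos (2 * pi - \<theta>) - cos \<beta>\<bar> \<ge> \<bar>(2 * pi - \<theta>) - \<beta>\<bar> / pi"
      using \<theta> by (intro abs_cos_diff_ge[OF \<beta>]) auto
    moreover have "\<bar>(2 * pi - \<theta>) - \<beta>\<bar> = \<bar>\<theta> - (2 * pi - \<beta>)\<bar>" by arith
    moreover have "cos (2 * pi - \<theta>) = cos \<theta>" by simp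
    ultimately show ?thesis by metis
  qed
  then obtain d where d: "d = \<bar>\<theta> - \<beta>\<bar> \<or> d = \<bar>\<theta> - (2 * pi - \<beta>)\<bar>" "d / pi \<le> \<bar>cos \<theta> - cos \<beta>\<bar>" by blast
  have c0: "cos \<theta> \<noteq> cos \<beta>" using ne eq by auto
  have d0: "d > 0"
  proof -
    have "\<theta> \<noteq> \<beta>" "\<theta> \<noteq> 2 * pi - \<beta>" using c0 by auto
    then show ?thesis using d(1) by auto
  qed
  have "d / pi \<le> \<bar>r * cos \<theta> - a\<bar>"
  proof -
    have "1 * \<bar>cos \<theta> - cos \<beta>\<bar> \<le> r * \<bar>cos \<theta> - cos \<beta>\<bar>" using r by (intro mult_right_mono) auto
    then show ?thesis using d(2) r by (simp add: eq abs_mult)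
  qed
  then have "1 / \<bar>r * cos \<theta> - a\<bar> \<le> 1 / (d / pi)"
    using d0 ne by (intro divide_left_mono mult_pos_pos divide_pos_pos) auto
  then have "ln (1 + 1 / \<bar>r * cos \<theta> - a\<bar>) \<le> ln (1 + pi / d)"
    using ne d0 by (subst ln_le_cancel_iff) (auto intro: add_pos_nonneg)
  also have "\<dots> \<le> 2 * sqrt (pi / d)" using d0 by (intro ln_one_plus_le_sqrt) auto
  also have "\<dots> = 2 * sqrt pi * (1 / sqrt d)" by (simp add: real_sqrt_divide)
  also have "\<dots> \<le> 2 * sqrt pi * inv_sqrt_pair \<beta> \<theta>"
    using d(1) by (intro mult_left_mono) (auto simp: inv_sqrt_pair_def)
  finally show ?thesis by (simp add: \<beta>_def)
qed

lemma ln_plus_le: "0 \<le> x \<Longrightarrow> x \<le> y \<Longrightarrow> 1 \<le> y \<Longrightarrow> ln_plus x \<le> ln y"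
  unfolding ln_plus_def by (cases "x = 0") (auto simp: ln_ge_zero)

lemma finite_cos_eq:
  assumes "r > 0" shows "finite {\<theta>\<in>{0..2*pi}. r * cos \<theta> = a}"
proof (cases "{\<theta>\<in>{0..2*pi}. r * cos \<theta> = a} = {}")
  case True
  then show ?thesis by (metis finite.emptyI)
next
  case False
  then obtain t where t: "r * cos t = a" by blast
  define \<beta> where "\<beta> = arccos (a / r)"
  have "{\<theta>\<in>{0..2*pi}. r * cos \<theta> = a} \<subseteq> {\<beta>, 2 * pi - \<beta>}"
  proof
    fix \<theta> assume \<theta>: "\<theta> \<in> {\<theta>\<in>{0..2*pi}. r * cos \<theta> = a}"
    have c: "a / r = cos \<theta>" using \<theta> assms by auto
    show "\<theta> \<in> {\<beta>, 2 * pi - \<beta>}"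
    proof (cases "\<theta> \<le> pi")
      case True
      then have "arccos (cos \<theta>) = \<theta>" using \<theta> by (intro arccos_cos) auto
      then show ?thesis by (simp add: \<beta>_def c)
    next
      case False
      have "arccos (cos (2 * pi - \<theta>)) = 2 * pi - \<theta>" using False \<theta> by (intro arccos_cos) auto
      then show ?thesis by (simp add: \<beta>_def c)
    qed
  qed
  then show ?thesis by (rule finite_subset) auto
qed

lemma proximity_nonneg: "proximity r f \<ge> 0"
proof -
  have "integral {0..2 * pi} (\<lambda>\<theta>. ln_plus (norm (f (of_real r * exp (\<i> * of_real \<theta>))))) \<ge> 0"
    by (cases "(\<lambda>\<theta>. ln_plus (norm (f (of_real r * exp (\<i> * of_real \<theta>))))) integrable_on {0..2 * pi}")
      (auto intro: Henstock_Kurzweil_Integration.integral_nonneg simp: ln_plus_def not_integrable_integral)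
  then show ?thesis by (simp add: proximity_def)
qed

text \<open>No measurability of the integrand is needed: the integral of a nonintegrable function is \<open>0\<close>.\<close>

lemma proximity_le:
  fixes f :: "complex \<Rightarrow> complex"
  assumes C: "C \<ge> 1" and B: "B \<ge> 0"
    and bound: "\<And>s. Re s \<noteq> 0 \<Longrightarrow> Re s \<noteq> 1 \<Longrightarrow>
      norm (f s) \<le> C * exp (B * \<bar>Re s\<bar>) * (1 + 1 / \<bar>Re s\<bar>) * (1 + 1 / \<bar>Re s - 1\<bar>)"
    and r: "r \<ge> 2"
  shows "proximity r f \<le> ln C + B * r + 32 * pi"
proof -
  define \<phi> where "\<phi> \<theta> = ln_plus (norm (f (of_real r * exp (\<i> * of_real \<theta>))))" for \<theta>
  define g where "g \<theta> = (ln C + B * r) + 2 * sqrt pi * (inv_sqrt_pair (arccos (0 / r)) \<theta> + inv_sqrt_pair (arccos (1 / r)) \<theta>)" for \<theta>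
  \<comment> \<open>The angles at which the circle meets one of the two lines, where
    \<open>bound\<close> says nothing.\<close>
  define E where "E = {\<theta>\<in>{0..2*pi}. r * cos \<theta> = 0} \<union> {\<theta>\<in>{0..2*pi}. r * cos \<theta> = 1}"
  have negl: "negligible E" unfolding E_def using r by (intro negligible_finite finite_UnI finite_cos_eq) auto
  have le: "\<phi> \<theta> \<le> g \<theta>" if \<theta>: "\<theta> \<in> {0..2*pi} - E" for \<theta>
  proof -
    define x where "x = r * cos \<theta>"
    have x: "x \<noteq> 0" "x \<noteq> 1" using \<theta> by (auto simp: E_def x_def)
    have Re: "Re (of_real r * exp (\<i> * of_real \<theta>)) = x"
      by (simp add: x_def Re_exp)
    define Y where "Y = C * exp (B * \<bar>x\<bar>) * (1 + 1 / \<bar>x\<bar>) * (1 + 1 / \<bar>x - 1\<bar>)"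
    have pos: "1 + 1 / \<bar>x\<bar> \<ge> 1" "1 + 1 / \<bar>x - 1\<bar> \<ge> 1" "exp (B * \<bar>x\<bar>) \<ge> 1" using B by auto
    have "1 * 1 * 1 * 1 \<le> Y" unfolding Y_def using pos C by (intro mult_mono) auto
    moreover have "norm (f (of_real r * exp (\<i> * of_real \<theta>))) \<le> Y"
      using bound[of "of_real r * exp (\<i> * of_real \<theta>)"] x unfolding Re Y_def by blast
    ultimately have "\<phi> \<theta> \<le> ln Y" unfolding \<phi>_def by (intro ln_plus_le) auto
    also have "ln Y = ln C + B * \<bar>x\<bar> + ln (1 + 1 / \<bar>x\<bar>) + ln (1 + 1 / \<bar>x - 1\<bar>)"
      unfolding Y_def using C pos by (simp add: ln_mult_pos add_pos_nonneg)
    also have "\<bar>x\<bar> \<le> r"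
      using mult_left_mono[OF abs_cos_le_one[of \<theta>], of r] r by (simp add: x_def abs_mult)
    then have "B * \<bar>x\<bar> \<le> B * r" using B by (rule mult_left_mono)
    also have "ln (1 + 1 / \<bar>x\<bar>) \<le> 2 * sqrt pi * inv_sqrt_pair (arccos (0 / r)) \<theta>"
      using ln_one_plus_inverse_le[OF r, of 0 \<theta>] \<theta> x by (simp add: x_def)
    also have "ln (1 + 1 / \<bar>x - 1\<bar>) \<le> 2 * sqrt pi * inv_sqrt_pair (arccos (1 / r)) \<theta>"
      using ln_one_plus_inverse_le[OF r, of 1 \<theta>] \<theta> x by (simp add: x_def)
    finally show ?thesis by (simp add: g_def algebra_simps)
  qed
  have arc: "0 \<le> arccos (a / r)" "arccos (a / r) \<le> 2 * pi" if "a = 0 \<or> a = 1" for a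
  proof -
    have "0 \<le> a / r" "a / r \<le> 1" using that r by auto
    then have "0 \<le> arccos (a / r) \<and> arccos (a / r) \<le> pi" by (intro arccos_bounded) linarith+
    then show "0 \<le> arccos (a / r)" "arccos (a / r) \<le> 2 * pi" by auto
  qed
  note I0 = inv_sqrt_pair_integral[OF arc[of 0]] and I1 = inv_sqrt_pair_integral[OF arc[of 1]]
  have g_int: "g integrable_on {0..2*pi}"
    unfolding g_def using I0 I1 by (intro integrable_add integrable_on_mult_right integrable_const_ivl) auto
  have "integral {0..2*pi} g = (ln C + B * r) * (2 * pi) + 2 * sqrt pi *
      (integral {0..2*pi} (inv_sqrt_pair (arccos (0 / r))) + integral {0..2*pi} (inv_sqrt_pair (arccos (1 / r))))"
  proof -
    have "integral {0..2*pi} g = integral {0..2*pi} (\<lambda>_. ln C + B * r) + integral {0..2*pi}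
        (\<lambda>\<theta>. 2 * sqrt pi * (inv_sqrt_pair (arccos (0 / r)) \<theta> + inv_sqrt_pair (arccos (1 / r)) \<theta>))"
      unfolding g_def using I0 I1
      by (intro Henstock_Kurzweil_Integration.integral_add integrable_add integrable_on_mult_right integrable_const_ivl) auto
    also have "integral {0..2*pi} (\<lambda>\<theta>. 2 * sqrt pi * (inv_sqrt_pair (arccos (0 / r)) \<theta> + inv_sqrt_pair (arccos (1 / r)) \<theta>))
        = 2 * sqrt pi * (integral {0..2*pi} (inv_sqrt_pair (arccos (0 / r))) + integral {0..2*pi} (inv_sqrt_pair (arccos (1 / r))))"
      using I0 I1 by (subst integral_mult_right) (simp add: Henstock_Kurzweil_Integration.integral_add)
    finally show ?thesis by (simp add: mult.commute)
  qed
  also have "\<dots> \<le> (ln C + B * r) * (2 * pi) + 2 * sqrt pi * (8 * sqrt (2 * pi) + 8 * sqrt (2 * pi))"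
    using I0 I1 by (intro add_left_mono mult_left_mono add_mono) auto
  \<comment> \<open>\<open>2 * sqrt pi\<close> times \<open>16 * sqrt (2 * pi)\<close> is
    \<open>32 * sqrt 2 * pi\<close>; with sqrt 2 \<le> 2 this becomes 32 times the length
    \<open>2 * pi\<close> of the interval.\<close>
  also have "\<dots> = (ln C + B * r) * (2 * pi) + 32 * sqrt 2 * pi" by (simp add: real_sqrt_mult)
  also have "\<dots> \<le> (ln C + B * r) * (2 * pi) + 32 * 2 * pi"
  proof -
    have "sqrt 2 \<le> 2" by (rule real_le_lsqrt) auto
    then show ?thesis by simp
  qed
  finally have gi: "integral {0..2*pi} g \<le> (ln C + B * r + 32) * (2 * pi)" by (simp add: algebra_simps)
  have "integral {0..2*pi} \<phi> \<le> (ln C + B * r + 32) * (2 * pi)"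
  proof (cases "\<phi> integrable_on {0..2*pi}")
    case True
    \<comment> \<open>Changing \<phi> on a negligible set leaves its integral unchanged and makes it
      dominated by g everywhere.\<close>
    define \<psi> where "\<psi> \<theta> = (if \<theta> \<in> E then g \<theta> else \<phi> \<theta>)" for \<theta>
    have "integral {0..2*pi} \<phi> = integral {0..2*pi} \<psi>"
      by (rule integral_spike[OF negl]) (simp add: \<psi>_def)
    also have "\<dots> \<le> integral {0..2*pi} g"
      using le by (intro integral_le g_int integrable_spike[OF True negl]) (auto simp: \<psi>_def)
    finally show ?thesis using gi by simp
  next
    case False
    moreover have "0 \<le> (ln C + B * r + 32) * (2 * pi)" using C B r by (intro mult_nonneg_nonneg add_nonneg_nonneg) auto
    ultimately show ?thesis by (simp add: not_integrable_integral)
  qed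
  then have "proximity r f \<le> ln C + B * r + 32"
    unfolding proximity_def \<phi>_def[symmetric] by (simp add: field_simps)
  moreover have "32 \<le> 32 * pi" using pi_ge_two by simp
  ultimately show ?thesis by linarith
qed

section \<open>Counting function of a periodic meromorphic function\<close>

text \<open>The singularities of the zeta-function in the variable \<open>s\<close> lie on the lines \<open>Re s = 0\<close> and
  \<open>Re s = 1\<close>, where they repeat with period \<open>m \<eta>\<close>.\<close>

locale periodic_meromorphic =
  fixes f :: "complex \<Rightarrow> complex" and \<eta> C B :: real and m :: nat
  assumes \<eta>: "\<eta> > 0" and m: "m > 0"
    and periodic: "f (z + \<i> * of_real (real m * \<eta>)) = f z"
    and pole: "is_pole f z \<Longrightarrow> (Re z = 0 \<or> Re z = 1) \<and> (\<exists>k::int. Im z = of_int k * \<eta>)"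
    and mero: "f meromorphic_on UNIV"
    and pole_1: "is_pole f 1"
    and C: "C \<ge> 1" and B: "B \<ge> 0"
    and bound: "Re s \<noteq> 0 \<Longrightarrow> Re s \<noteq> 1 \<Longrightarrow>
      norm (f s) \<le> C * exp (B * \<bar>Re s\<bar>) * (1 + 1 / \<bar>Re s\<bar>) * (1 + 1 / \<bar>Re s - 1\<bar>)"
begin

definition poles :: "real \<Rightarrow> complex set" where "poles t = {z. norm z \<le> t \<and> is_pole f z}"

definition mult :: "complex \<Rightarrow> nat" where "mult z = nat (- zorder f z)"

lemma poles_subset:
  assumes "t \<ge> 0"
  shows "poles t \<subseteq> (\<lambda>(x, k). Complex x (of_int k * \<eta>)) ` ({0, 1} \<times> {-\<lfloor>t / \<eta>\<rfloor>..\<lfloor>t / \<eta>\<rfloor>})"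
proof
  fix z assume z: "z \<in> poles t"
  then obtain k where k: "Im z = of_int k * \<eta>" "Re z \<in> {0, 1}" using pole[of z] by (auto simp: poles_def)
  have "\<bar>of_int k\<bar> * \<eta> \<le> t"
    using z abs_Im_le_cmod[of z] \<eta> by (auto simp: poles_def k(1) abs_mult)
  then have "\<bar>of_int k\<bar> \<le> t / \<eta>" using \<eta> by (simp add: field_simps)
  then have "k \<le> \<lfloor>t / \<eta>\<rfloor>" "- k \<le> \<lfloor>t / \<eta>\<rfloor>" by (auto simp: le_floor_iff)
  then show "z \<in> (\<lambda>(x, k). Complex x (of_int k * \<eta>)) ` ({0, 1} \<times> {-\<lfloor>t / \<eta>\<rfloor>..\<lfloor>t / \<eta>\<rfloor>})"
    using k by (intro image_eqI[of _ _ "(Re z, k)"]) (auto simp: complex_eq_iff)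
qed

lemma finite_poles: "finite (poles t)"
proof (cases "t \<ge> 0")
  case True
  then show ?thesis using poles_subset[OF True] by (rule_tac finite_subset) auto
next
  case False
  then have "poles t = {}" by (auto simp: poles_def dest: order_trans[OF norm_ge_zero])
  then show ?thesis by simp
qed

lemma card_poles_le:
  assumes "t \<ge> 0" shows "real (card (poles t)) \<le> 4 * t / \<eta> + 2"
proof -
  have "card (poles t) \<le> card (({0, 1::real} \<times> {-\<lfloor>t / \<eta>\<rfloor>..\<lfloor>t / \<eta>\<rfloor>}))"
    by (rule surj_card_le[OF _ poles_subset[OF assms]]) auto
  also have "\<dots> = 2 * nat (2 * \<lfloor>t / \<eta>\<rfloor> + 1)" by (simp add: card_cartesian_product)
  finally have "real (card (poles t)) \<le> real (2 * nat (2 * \<lfloor>t / \<eta>\<rfloor> + 1))" by (rule of_nat_mono)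
  also have "\<dots> = 4 * of_int \<lfloor>t / \<eta>\<rfloor> + 2" using assms \<eta> by simp
  also have "\<dots> \<le> 4 * (t / \<eta>) + 2"
    by (intro add_right_mono mult_left_mono of_int_floor_le) auto
  finally show ?thesis by simp
qed

lemma periodic_int: "f (z + \<i> * of_real (real m * \<eta>) * of_int j) = f z"
proof (induction j rule: int_induct[where k = 0])
  case (step1 i)
  then show ?case using periodic[of "z + \<i> * of_real (real m * \<eta>) * of_int i"] by (simp add: algebra_simps)
next
  case (step2 i)
  then show ?case using periodic[of "z + \<i> * of_real (real m * \<eta>) * of_int (i - 1)"] by (simp add: algebra_simps)
qed simp

lemma mult_periodic: "mult (z + \<i> * of_real (real m * \<eta>) * of_int j) = mult z"
proof -
  let ?w = "\<i> * of_real (real m * \<eta>) * of_int j"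
  have "zorder f (z + ?w) = zorder (\<lambda>u. f (u + (z + ?w))) 0" by (rule zorder_shift)
  also have "(\<lambda>u. f (u + (z + ?w))) = (\<lambda>u. f (u + z))" using periodic_int[of _ j] by (simp add: add.assoc[symmetric])
  also have "zorder (\<lambda>u. f (u + z)) 0 = zorder f z" by (rule zorder_shift[symmetric])
  finally show ?thesis by (simp add: mult_def)
qed

lemma is_pole_periodic: "is_pole f (z + \<i> * of_real (real m * \<eta>) * of_int j) \<longleftrightarrow> is_pole f z"
proof -
  let ?w = "\<i> * of_real (real m * \<eta>) * of_int j"
  have "(\<lambda>u. f (z + ?w + u)) = (\<lambda>u. f (z + u))" using periodic_int[of "z + _" j] by (simp add: add_ac)
  then show ?thesis using is_pole_shift_0[of f "z + ?w"] is_pole_shift_0[of f z] by (simp only:)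
qed

text \<open>Every pole is a translate by a multiple of the period of a point of the finite set S,
  which has m points on each of the two lines.\<close>

lemma mult_bounded: "\<exists>M\<ge>1. \<forall>z. is_pole f z \<longrightarrow> mult z \<le> M"
proof -
  define S where "S = (\<lambda>(x, k). Complex x (of_int k * \<eta>)) ` ({0, 1} \<times> {0..<int m})"
  have fin: "finite S" by (auto simp: S_def)
  have "mult z \<le> 1 + (\<Sum>z\<in>S. mult z)" if z: "is_pole f z" for z
  proof -
    obtain k where k: "Im z = of_int k * \<eta>" "Re z \<in> {0, 1}" using pole[OF z] by auto
    define z0 where "z0 = Complex (Re z) (of_int (k mod int m) * \<eta>)"
    have "z = z0 + \<i> * of_real (real m * \<eta>) * of_int (k div int m)"
    proof -
      have "k = k mod int m + int m * (k div int m)" by simp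
      then have "real_of_int k = of_int (k mod int m) + real m * of_int (k div int m)"
        by (metis of_int_add of_int_mult of_int_of_nat_eq)
      then show ?thesis by (simp add: complex_eq_iff z0_def k(1) algebra_simps)
    qed
    then have "mult z = mult z0" using mult_periodic by metis
    moreover have "z0 \<in> S" using k m by (auto simp: S_def z0_def intro!: image_eqI[of _ _ "(Re z, k mod int m)"])
    then have "mult z0 \<le> (\<Sum>z\<in>S. mult z)" using fin by (intro member_le_sum) auto
    ultimately show ?thesis by simp
  qed
  then show ?thesis by (intro exI[of _ "1 + (\<Sum>z\<in>S. mult z)"]) auto
qed

lemma mult_pos: "is_pole f z \<Longrightarrow> mult z \<ge> 1"
proof -
  assume z: "is_pole f z"
  have "isolated_singularity_at f z" by (rule meromorphic_on_isolated_singularity[of f z]) (rule meromorphic_on_subset[OF mero], simp)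
  then have "zorder f z < 0" using z by (rule isolated_pole_imp_neg_zorder)
  then show ?thesis by (simp add: mult_def)
qed

text \<open>Interchanges sum and integral: a pole z \<noteq> 0 contributes the integral of 1 / t
  from \<open>norm z\<close> to r, once for each unit of its multiplicity.\<close>

lemma integrated_pole_count_eq:
  assumes r: "r > 0"
  shows "integrated_pole_count r f =
    (\<Sum>z\<in>poles r - {0}. real (mult z) * (ln r - ln (norm z))) + real (pole_count 0 f) * ln r"
proof -
  have pc: "pole_count t f = (\<Sum>z\<in>poles t. mult z)" for t by (simp add: pole_count_def poles_def mult_def)
  have diff: "(real (pole_count t f) - real (pole_count 0 f)) / t =
      (\<Sum>z\<in>poles r - {0}. real (mult z) * (if t \<in> {norm z..r} then 1 / t else 0))" if t: "t \<in> {0..r}" for t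
  proof -
    have sub: "poles 0 \<subseteq> poles t" using t by (auto simp: poles_def)
    have "real (pole_count t f) - real (pole_count 0 f) = (\<Sum>z\<in>poles t - poles 0. real (mult z))"
      using sum_diff[OF finite_poles sub, of "\<lambda>z. real (mult z)"] by (simp add: pc)
    also have "poles t - poles 0 = {z \<in> poles r - {0}. norm z \<le> t}"
      using t by (auto simp: poles_def)
    also have "(\<Sum>z\<in>\<dots>. real (mult z)) = (\<Sum>z\<in>poles r - {0}. if norm z \<le> t then real (mult z) else 0)"
      using finite_poles by (intro sum.inter_filter) auto
    finally have "(real (pole_count t f) - real (pole_count 0 f)) / t =
        (\<Sum>z\<in>poles r - {0}. (if norm z \<le> t then real (mult z) else 0) / t)"
      by (simp add: sum_divide_distrib)
    also have "\<dots> = (\<Sum>z\<in>poles r - {0}. real (mult z) * (if t \<in> {norm z..r} then 1 / t else 0))"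
      using t by (intro sum.cong refl) auto
    finally show ?thesis .
  qed
  have "((\<lambda>t. real (mult z) * (if t \<in> {norm z..r} then 1 / t else 0)) has_integral
      real (mult z) * (ln r - ln (norm z))) {0..r}" if z: "z \<in> poles r - {0}" for z
  proof (rule has_integral_mult_right)
    have nz: "0 < norm z" "norm z \<le> r" using z by (auto simp: poles_def)
    have "((\<lambda>t. 1 / t) has_integral (ln r - ln (norm z))) {norm z..r}"
      using nz by (intro fundamental_theorem_of_calculus)
        (auto intro!: derivative_eq_intros simp: has_real_derivative_iff_has_vector_derivative[symmetric] field_simps
          intro: less_le_trans[OF nz(1)])
    then show "((\<lambda>t. if t \<in> {norm z..r} then 1 / t else 0) has_integral (ln r - ln (norm z))) {0..r}"
      using nz by (subst has_integral_restrict) auto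
  qed
  then have "((\<lambda>t. \<Sum>z\<in>poles r - {0}. real (mult z) * (if t \<in> {norm z..r} then 1 / t else 0)) has_integral
      (\<Sum>z\<in>poles r - {0}. real (mult z) * (ln r - ln (norm z)))) {0..r}"
    using finite_poles by (intro has_integral_sum) auto
  then have "((\<lambda>t. (real (pole_count t f) - real (pole_count 0 f)) / t) has_integral
      (\<Sum>z\<in>poles r - {0}. real (mult z) * (ln r - ln (norm z)))) {0..r}"
    by (rule has_integral_eq[rotated]) (use diff in simp)
  then show ?thesis by (simp add: integrated_pole_count_def integral_unique)
qed

section \<open>Growth of the counting function and of the characteristic\<close>

lemma integrated_pole_count_upper:
  "\<exists>c1 c2. c1 > 0 \<and> c2 > 0 \<and> (\<forall>r\<ge>2. integrated_pole_count r f \<le> c1 * (r + 1) * (ln r + c2))"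
proof -
  obtain M where M: "M \<ge> 1" "\<And>z. is_pole f z \<Longrightarrow> mult z \<le> M" using mult_bounded by blast
  \<comment> \<open>Poles other than 0 have modulus at least \<delta>, which bounds the logarithm of
    the modulus from below; \<open>c2\<close> absorbs this bound.\<close>
  define \<delta> where "\<delta> = min 1 \<eta>"
  have \<delta>: "0 < \<delta>" "\<delta> \<le> 1" using \<eta> by (auto simp: \<delta>_def)
  have norm_ge: "norm z \<ge> \<delta>" if z: "is_pole f z" "z \<noteq> 0" for z
  proof (cases "Re z = 1")
    case True
    then have "1 \<le> norm z" using abs_Re_le_cmod[of z] by simp
    then show ?thesis by (simp add: \<delta>_def)
  next
    case False
    then obtain k where k: "Re z = 0" "Im z = of_int k * \<eta>" using pole[OF z(1)] by auto
    then have "k \<noteq> 0" using z(2) by (auto simp: complex_eq_iff)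
    then have "1 * \<eta> \<le> \<bar>of_int k\<bar> * \<eta>" using \<eta> by (intro mult_right_mono) auto
    also have "\<dots> \<le> norm z" using abs_Im_le_cmod[of z] \<eta> by (simp add: k abs_mult)
    finally show ?thesis by (simp add: \<delta>_def)
  qed
  define c1 where "c1 = real M * (4 / \<eta> + 3)"
  define c2 where "c2 = 1 - ln \<delta>"
  have c2: "c2 \<ge> 1" using \<delta> by (simp add: c2_def)
  have "integrated_pole_count r f \<le> c1 * (r + 1) * (ln r + c2)" if r: "r \<ge> 2" for r
  proof -
    have lnr: "ln r \<ge> 0" using r by simp
    have "(\<Sum>z\<in>poles r - {0}. real (mult z) * (ln r - ln (norm z))) \<le> (\<Sum>z\<in>poles r - {0}. real M * (ln r + c2))"
    proof (intro sum_mono mult_mono)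
      fix z assume z: "z \<in> poles r - {0}"
      show "real (mult z) \<le> real M" using z M(2) by (auto simp: poles_def)
      have "\<delta> \<le> norm z" using z norm_ge by (auto simp: poles_def)
      then have "ln \<delta> \<le> ln (norm z)" using \<delta> by (intro ln_mono) auto
      then show "ln r - ln (norm z) \<le> ln r + c2" by (simp add: c2_def)
      have "ln (norm z) \<le> ln r" using z by (intro ln_mono) (auto simp: poles_def)
      then show "0 \<le> ln r - ln (norm z)" by simp
    qed simp
    also have "\<dots> = real (card (poles r - {0})) * (real M * (ln r + c2))" by simp
    also have "\<dots> \<le> (4 * r / \<eta> + 2) * (real M * (ln r + c2))"
    proof (intro mult_right_mono)
      have "card (poles r - {0}) \<le> card (poles r)" by (intro card_mono finite_poles) auto
      then show "real (card (poles r - {0})) \<le> 4 * r / \<eta> + 2" using card_poles_le[of r] r by simp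
    qed (use lnr c2 in auto)
    finally have 1: "(\<Sum>z\<in>poles r - {0}. real (mult z) * (ln r - ln (norm z))) \<le> (4 * r / \<eta> + 2) * (real M * (ln r + c2))" .
    have "pole_count 0 f = (\<Sum>z\<in>poles 0. mult z)" by (simp add: pole_count_def poles_def mult_def)
    also have "\<dots> \<le> (\<Sum>z\<in>{0::complex}. M)"
      using M(2) by (intro order_trans[OF sum_mono sum_mono2]) (auto simp: poles_def)
    finally have "real (pole_count 0 f) * ln r \<le> real M * (ln r + c2)"
      using lnr c2 by (intro mult_mono) auto
    with 1 have "integrated_pole_count r f \<le> (4 * r / \<eta> + 3) * (real M * (ln r + c2))"
      using integrated_pole_count_eq[of r] r by (simp add: algebra_simps)
    also have "\<dots> \<le> ((4 / \<eta> + 3) * (r + 1)) * (real M * (ln r + c2))"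
    proof (rule mult_right_mono)
      have "(4 / \<eta> + 3) * (r + 1) = 4 * r / \<eta> + 3 + (4 / \<eta> + 3 * r)" by (simp add: algebra_simps add_divide_distrib)
      moreover have "0 \<le> 4 / \<eta> + 3 * r" using r \<eta> by simp
      ultimately show "4 * r / \<eta> + 3 \<le> (4 / \<eta> + 3) * (r + 1)" by linarith
    qed (use lnr c2 in auto)
    finally show ?thesis by (simp add: c1_def mult_ac)
  qed
  moreover have "c1 > 0" unfolding c1_def using M(1) \<eta> by (intro mult_pos_pos) (auto intro: add_pos_pos)
  ultimately show ?thesis using c2 by (intro exI[of _ c1] exI[of _ c2]) auto
qed

text \<open>About r / (2 m \<eta>) translates of the pole 1 have modulus at most r / 2, and each of
  them contributes at least ln 2.\<close>

lemma integrated_pole_count_lower: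
  "\<exists>c1 c2. c1 > 0 \<and> (\<forall>r\<ge>2. integrated_pole_count r f \<ge> c1 * r - c2)"
proof -
  define \<omega> where "\<omega> = real m * \<eta>"
  have \<omega>: "\<omega> > 0" using m \<eta> by (simp add: \<omega>_def)
  have "integrated_pole_count r f \<ge> ln 2 * ((r / 2 - 1) / \<omega> - 1)" if r: "r \<ge> 2" for r
  proof -
    define n where "n = nat \<lfloor>(r / 2 - 1) / \<omega>\<rfloor>"
    have n: "(r / 2 - 1) / \<omega> - 1 \<le> real n" "real n \<le> (r / 2 - 1) / \<omega>"
      using r \<omega> by (auto simp: n_def)
    define p where "p j = 1 + \<i> * of_real \<omega> * of_int (int j)" for j
    have p: "is_pole f (p j)" for j
      using is_pole_periodic[of 1 "int j"] pole_1 by (simp add: p_def \<omega>_def)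
    have pn: "norm (p j) \<le> r / 2" if "j < n" for j
    proof -
      have "norm (p j) \<le> 1 + \<omega> * real j"
        unfolding p_def using \<omega> by (intro norm_triangle_le) (simp add: norm_mult)
      also have "\<omega> * real j \<le> \<omega> * real n" using that \<omega> by (intro mult_left_mono) auto
      also have "\<dots> \<le> r / 2 - 1" using n(2) \<omega> by (simp add: field_simps)
      finally show ?thesis by simp
    qed
    have inj: "inj_on p {..<n}" using \<omega> by (auto simp: inj_on_def p_def)
    have p0: "p j \<noteq> 0" for j
    proof
      assume "p j = 0"
      then have "Re (p j) = 0" by simp
      then show False by (simp add: p_def)
    qed
    have sub: "p ` {..<n} \<subseteq> poles r - {0}" using p pn p0 r by (force simp: poles_def)
    have "ln 2 * real n = (\<Sum>z\<in>p ` {..<n}. ln 2)" using inj by (simp add: card_image)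
    also have "\<dots> \<le> (\<Sum>z\<in>p ` {..<n}. real (mult z) * (ln r - ln (norm z)))"
    proof (intro sum_mono)
      fix z assume "z \<in> p ` {..<n}"
      then obtain j where j: "j < n" "z = p j" by auto
      have "ln (norm z) \<le> ln (r / 2)" using pn[OF j(1)] p0 j by (intro ln_mono) auto
      then have "ln 2 \<le> ln r - ln (norm z)" using r by (simp add: ln_div)
      moreover have "1 \<le> real (mult z)" using mult_pos[OF p] j by simp
      ultimately have "1 * ln 2 \<le> real (mult z) * (ln r - ln (norm z))" by (intro mult_mono) auto
      then show "ln 2 \<le> real (mult z) * (ln r - ln (norm z))" by simp
    qed
    also have "\<dots> \<le> (\<Sum>z\<in>poles r - {0}. real (mult z) * (ln r - ln (norm z)))"
      using finite_poles sub by (intro sum_mono2) (auto simp: poles_def intro!: mult_nonneg_nonneg ln_mono)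
    also have "\<dots> \<le> integrated_pole_count r f"
      using integrated_pole_count_eq[of r] r by simp
    finally have "ln 2 * real n \<le> integrated_pole_count r f" .
    moreover have "ln 2 * ((r / 2 - 1) / \<omega> - 1) \<le> ln 2 * real n" using n by (intro mult_left_mono) auto
    ultimately show ?thesis by linarith
  qed
  moreover have "ln 2 * ((r / 2 - 1) / \<omega> - 1) = ln 2 / (2 * \<omega>) * r - ln 2 * (1 / \<omega> + 1)" for r
    by (simp add: diff_divide_distrib algebra_simps)
  ultimately have "\<forall>r\<ge>2. integrated_pole_count r f \<ge> ln 2 / (2 * \<omega>) * r - ln 2 * (1 / \<omega> + 1)"
    by simp
  then show ?thesis using \<omega> by (intro exI[of _ "ln 2 / (2 * \<omega>)"] exI[of _ "ln 2 * (1 / \<omega> + 1)"]) auto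
qed

text \<open>The characteristic lies between a linear function and a multiple of r ln r, and the
  logarithms of both are asymptotic to ln r.\<close>

lemma tendsto_ln_characteristic:
  "((\<lambda>r. ln (nevanlinna_characteristic r f) / ln r) \<longlongrightarrow> 1) at_top"
proof -
  obtain a1 a2 where a: "a1 > 0" "a2 > 0" "\<And>r. r \<ge> 2 \<Longrightarrow> integrated_pole_count r f \<le> a1 * (r + 1) * (ln r + a2)"
    using integrated_pole_count_upper by blast
  obtain b1 b2 where b: "b1 > 0" "\<And>r. r \<ge> 2 \<Longrightarrow> integrated_pole_count r f \<ge> b1 * r - b2"
    using integrated_pole_count_lower by blast
  define U where "U r = (ln C + B * r + 32 * pi) + a1 * (r + 1) * (ln r + a2)" for r
  have up: "nevanlinna_characteristic r f \<le> U r" and low: "b1 * r - b2 \<le> nevanlinna_characteristic r f" if "r \<ge> 2" for r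
    using a(3)[OF that] b(2)[OF that] proximity_le[OF C B bound that] proximity_nonneg[of r f]
    by (auto simp: nevanlinna_characteristic_def U_def)
  have ev: "\<forall>\<^sub>F r in at_top. r \<ge> 2 \<and> b1 * r - b2 > 0 \<and> ln r > 0"
    using b(1) by (intro eventually_conj eventually_ge_at_top) real_asymp+
  have C0: "C > 0" using C by simp
  show ?thesis
  proof (rule tendsto_sandwich)
    show "((\<lambda>r. ln (b1 * r - b2) / ln r) \<longlongrightarrow> 1) at_top" using b(1) by real_asymp
    show "((\<lambda>r. ln (U r) / ln r) \<longlongrightarrow> 1) at_top"
    \<comment> \<open>The asymptotic expansion must know the sign of B, hence the separate case B =
      0.\<close>
    proof (cases "B = 0")
      case True
      show ?thesis unfolding U_def True using a C0 by real_asymp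
    next
      case False
      then have "B > 0" using B by simp
      then show ?thesis unfolding U_def using a C0 by real_asymp
    qed
    show "\<forall>\<^sub>F r in at_top. ln (b1 * r - b2) / ln r \<le> ln (nevanlinna_characteristic r f) / ln r"
      using ev
    proof eventually_elim
      case (elim r)
      then have "ln (b1 * r - b2) \<le> ln (nevanlinna_characteristic r f)" using low[of r] by (intro ln_mono) auto
      then show ?case using elim by (intro divide_right_mono) auto
    qed
    show "\<forall>\<^sub>F r in at_top. ln (nevanlinna_characteristic r f) / ln r \<le> ln (U r) / ln r"
      using ev
    proof eventually_elim
      case (elim r)
      then have "0 < nevanlinna_characteristic r f" using low[of r] by linarith
      then show ?case using elim up[of r] by (intro divide_right_mono) auto
    qed
  qed
qed

lemma nevanlinna_orders: "nevanlinna_order f = 1 \<and> nevanlinna_lower_order f = 1"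
proof -
  have "((\<lambda>r. ereal (ln (nevanlinna_characteristic r f) / ln r)) \<longlongrightarrow> ereal 1) at_top"
    using tendsto_ln_characteristic by simp
  then show ?thesis
    unfolding nevanlinna_order_def nevanlinna_lower_order_def
    by (simp add: lim_imp_Limsup lim_imp_Liminf one_ereal_def)
qed

end

section \<open>Continuation of the generating series\<close>

text \<open>\<open>norm (1 - w)\<close> is at least \<open>\<bar>1 - exp y\<bar>\<close>, hence at
  least \<open>\<bar>y\<bar> / (1 + \<bar>y\<bar>)\<close>. The bound depends on the modulus of w
  alone and has only a simple singularity at the unit circle.\<close>

lemma norm_inverse_one_minus_le:
  fixes w :: complex
  assumes "norm w = exp y" "y \<noteq> 0"
  shows "1 / norm (1 - w) \<le> 1 + 1 / \<bar>y\<bar>"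
proof -
  have key: "\<bar>y\<bar> / (1 + \<bar>y\<bar>) \<le> \<bar>1 - exp y\<bar>"
  proof (cases "y > 0")
    case True
    have "y / (1 + y) \<le> y" using True by (simp add: field_simps)
    also have "\<dots> \<le> exp y - 1" using exp_ge_add_one_self[of y] by linarith
    finally show ?thesis using True by simp
  next
    case False
    then have y: "y < 0" using assms by simp
    have "1 - y \<le> exp (- y)" using exp_ge_add_one_self[of "- y"] by simp
    then have "exp y * (1 - y) \<le> exp y * exp (- y)" by (intro mult_left_mono) auto
    also have "\<dots> = 1" by (simp flip: exp_add)
    finally have "exp y \<le> 1 / (1 - y)" using y by (simp add: pos_le_divide_eq)
    moreover have "1 - 1 / (1 - y) = \<bar>y\<bar> / (1 + \<bar>y\<bar>)" using y by (simp add: divide_simps)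
    ultimately have "\<bar>y\<bar> / (1 + \<bar>y\<bar>) \<le> 1 - exp y" by linarith
    then show ?thesis by linarith
  qed
  have "\<bar>1 - exp y\<bar> \<le> norm (1 - w)"
    using norm_triangle_ineq3[of 1 w] assms(1) by simp
  with key have le: "\<bar>y\<bar> / (1 + \<bar>y\<bar>) \<le> norm (1 - w)" by linarith
  have pos: "\<bar>y\<bar> / (1 + \<bar>y\<bar>) > 0" using assms(2) by (intro divide_pos_pos) auto
  have "1 / norm (1 - w) \<le> 1 / (\<bar>y\<bar> / (1 + \<bar>y\<bar>))"
    using le pos by (intro divide_left_mono mult_pos_pos) auto
  also have "\<dots> = 1 + 1 / \<bar>y\<bar>" using assms(2) by (simp add: field_simps)
  finally show ?thesis .
qed

text \<open>Shifting the tail by one period multiplies it by \<open>w ^ m\<close>, so its sum solves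
  a linear equation whose constant term is the first block of m terms.\<close>

lemma periodic_power_sums:
  fixes h :: "nat \<Rightarrow> nat" and w :: complex
  assumes per: "\<And>n. h (n + m) = h n" and w: "norm w < 1" and m: "m \<ge> 1"
  shows "(\<lambda>n. of_nat (h (n + c)) * w ^ (n + c)) sums ((\<Sum>j<m. of_nat (h (c + j)) * w ^ (c + j)) / (1 - w ^ m))"
    and "summable (\<lambda>n. norm (of_nat (h n) * w ^ n))"
proof -
  define H where "H = (\<Sum>j<m. h j)"
  have bound: "h n \<le> H" for n
  proof (induction n rule: less_induct)
    case (less n)
    show ?case
    proof (cases "n < m")
      case True
      then show ?thesis unfolding H_def by (intro member_le_sum) auto
    next
      case False
      then show ?thesis using less[of "n - m"] per[of "n - m"] m by simp
    qed
  qed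
  show sum: "summable (\<lambda>n. norm (of_nat (h n) * w ^ n))"
  proof (rule summable_comparison_test')
    show "summable (\<lambda>n. real H * norm w ^ n)" using w by (intro summable_mult summable_geometric) auto
    show "norm (norm (of_nat (h n) * w ^ n)) \<le> real H * norm w ^ n" if "n \<ge> 0" for n
      using bound[of n] by (simp add: norm_mult norm_power mult_right_mono)
  qed
  define f where "f n = of_nat (h (n + c)) * w ^ (n + c)" for n
  have sf: "summable f" unfolding f_def
    using summable_ignore_initial_segment[OF summable_norm_cancel[OF sum], of c] by simp
  have shift: "f (n + m) = w ^ m * f n" for n
    using per[of "n + c"] by (simp add: f_def power_add mult_ac add_ac)
  have *: "x = a * x + s \<Longrightarrow> (1 - a) * x = s" for a x s :: complex
    by (metis add_diff_cancel_left' left_diff_distrib mult_1)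
  have "suminf f = suminf (\<lambda>n. f (n + m)) + (\<Sum>i<m. f i)" by (rule suminf_split_initial_segment[OF sf])
  also have "suminf (\<lambda>n. f (n + m)) = w ^ m * suminf f" unfolding shift by (rule suminf_mult[OF sf])
  finally have eq: "(1 - w ^ m) * suminf f = (\<Sum>i<m. f i)" by (rule *)
  have "norm (w ^ m) < 1" using w m by (simp add: norm_power power_less_one_iff)
  then have "1 - w ^ m \<noteq> 0" by auto
  then have "suminf f = (\<Sum>j<m. of_nat (h (c + j)) * w ^ (c + j)) / (1 - w ^ m)"
    using eq by (simp add: f_def field_simps add.commute)
  then show "(\<lambda>n. of_nat (h (n + c)) * w ^ (n + c)) sums ((\<Sum>j<m. of_nat (h (c + j)) * w ^ (c + j)) / (1 - w ^ m))"
    using summable_sums[OF sf] by (simp add: f_def[abs_def])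
qed

text \<open>The identity theorem gives equality off a discrete set; there nice meromorphy decides,
  by continuity or by the value 0 at poles.\<close>

lemma nicely_meromorphic_unique:
  assumes f: "f nicely_meromorphic_on UNIV" and g: "g nicely_meromorphic_on UNIV"
    and S: "open S" "S \<noteq> {}" "\<And>z. z \<in> S \<Longrightarrow> f z = g z"
  shows "f = g"
proof
  fix z
  have mero: "(\<lambda>z. f z - g z) meromorphic_on UNIV"
    using f g by (intro meromorphic_intros) (auto simp: nicely_meromorphic_on_def)
  obtain s where s: "s \<in> S" using S by blast
  have "\<forall>\<^sub>F w in at s. f w - g w = 0"
    using eventually_at_in_open'[OF S(1) s] by eventually_elim (use S(3) in auto)
  moreover have "\<not> (\<forall>\<^sub>F w in at s. f w - g w \<noteq> 0)"
    using calculation eventually_conj[of "\<lambda>w. f w - g w = 0" "at s" "\<lambda>w. f w - g w \<noteq> 0"] by auto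
  then have "\<not> (\<forall>\<^sub>\<approx>z\<in>UNIV. f z - g z \<noteq> 0)" by (auto simp: eventually_cosparse_open_eq)
  ultimately have "\<forall>\<^sub>\<approx>z\<in>UNIV. f z - g z = 0"
    using meromorphic_imp_constant_or_avoid[OF mero, of 0] by auto
  then have ev: "\<forall>\<^sub>F w in at z. f w = g w" by (simp add: eventually_cosparse_open_eq)
  have pole: "is_pole f z \<longleftrightarrow> is_pole g z" by (rule is_pole_cong[OF ev refl])
  show "f z = g z"
  proof (cases "is_pole f z")
    case True
    have no_lim: "\<not> h \<midarrow>z\<rightarrow> h z" if "is_pole h z" for h :: "complex \<Rightarrow> complex"
      using that not_tendsto_and_filterlim_at_infinity[of "at z"] unfolding is_pole_def by auto
    then have "f z = 0" "g z = 0" using f g True pole unfolding nicely_meromorphic_on_def by auto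
    then show ?thesis by simp
  next
    case False
    then have "f \<midarrow>z\<rightarrow> f z" "g \<midarrow>z\<rightarrow> g z" using f g pole unfolding nicely_meromorphic_on_def by auto
    moreover from this(1) have "g \<midarrow>z\<rightarrow> f z" using tendsto_cong[OF ev] by blast
    ultimately show ?thesis using LIM_unique by blast
  qed
qed

text \<open>The sequence \<open>A n\<close> counts the positive divisors of degree \<open>n\<close>, and \<open>h n\<close> the divisor classes.\<close>

locale divisor_counts =
  fixes q c m :: nat and G :: int and h A :: "nat \<Rightarrow> nat"
  assumes q: "q \<ge> 2" and m: "m \<ge> 1" and h0: "h 0 \<ge> 1" and per: "\<And>n. h (n + m) = h n"
    and A: "\<And>n. n \<ge> c \<Longrightarrow> real (A n) * (real q - 1) = real (h n) * (real q powi (int n - G) - 1)"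
begin

abbreviation L :: real where "L \<equiv> ln (real q)"

text \<open>For n \<ge> c one has
  \<open>A n = h n * (\<kappa>1 * q ^ n - \<kappa>2)\<close>.\<close>

definition \<kappa>1 :: real where "\<kappa>1 = real q powi (- G) / (real q - 1)"
definition \<kappa>2 :: real where "\<kappa>2 = 1 / (real q - 1)"

text \<open>One period of terms from index c on, the numerator of the tail of the series with
  coefficients h n.\<close>

definition numer :: "complex \<Rightarrow> complex" where
  "numer w = (\<Sum>j<m. of_nat (h (c + j)) * w ^ (c + j))"

text \<open>The finitely many degrees below c, to which the counting formula does not apply.\<close>

definition head :: "complex \<Rightarrow> complex" where
  "head w = (\<Sum>n<c. of_nat (A n) * w ^ n)"

text \<open>\<open>u\<close> is q to the power -s and \<open>v\<close> is q to the power 1 - s, that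
  is, q times \<open>u\<close>; as exponentials both are entire.\<close>

definition u :: "complex \<Rightarrow> complex" where "u s = exp (- (of_real L * s))"
definition v :: "complex \<Rightarrow> complex" where "v s = exp (of_real L * (1 - s))"

definition F :: "complex \<Rightarrow> complex" where
  "F s = head (u s) + of_real \<kappa>1 * numer (v s) / (1 - v s ^ m) - of_real \<kappa>2 * numer (u s) / (1 - u s ^ m)"

lemma L_pos: "L > 0" using q by simp

lemma v_eq: "v s = of_nat q * u s"
proof -
  have "v s = exp (of_real L) * u s" by (simp add: v_def u_def right_diff_distrib exp_diff exp_minus field_simps)
  also have "exp (of_real L :: complex) = of_nat q" using q by (simp add: exp_of_real)
  finally show ?thesis .
qed

lemma norm_u: "norm (u s) = exp (- (L * Re s))" and norm_v: "norm (v s) = exp (L * (1 - Re s))"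
  by (simp_all add: u_def v_def)

lemma count_series_sums:
  assumes s: "Re s > 1"
  shows "(\<lambda>n. of_nat (A n) * u s ^ n) sums F s" "summable (\<lambda>n. norm (of_nat (A n) * u s ^ n))"
proof -
  have q1: "real q - 1 > 0" using q by simp
  have v1: "norm (v s) < 1" and u1: "norm (u s) < 1"
    using s L_pos by (simp_all add: norm_u norm_v mult_pos_neg)
  have coeff: "real (A n) = \<kappa>1 * real (h n) * real q ^ n - \<kappa>2 * real (h n)" if "n \<ge> c" for n
  proof -
    have "real q powi (int n - G) = real q powi (- G) * real q ^ n"
      using q by (simp add: power_int_diff power_int_minus field_simps)
    moreover have "real (A n) = real (h n) * (real q powi (int n - G) - 1) / (real q - 1)"
      using A[OF that] q1 by (simp add: eq_divide_eq)
    ultimately have "real (A n) = real (h n) * (real q powi (- G) * real q ^ n - 1) / (real q - 1)" by simp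
    then show ?thesis by (simp add: \<kappa>1_def \<kappa>2_def diff_divide_distrib algebra_simps)
  qed
  have term_eq: "of_nat (A n) * u s ^ n = of_real \<kappa>1 * (of_nat (h n) * v s ^ n) - of_real \<kappa>2 * (of_nat (h n) * u s ^ n)"
    if "n \<ge> c" for n
  proof -
    have "(of_nat (A n) :: complex) = of_real (real (A n))" by simp
    also have "\<dots> = of_real \<kappa>1 * of_nat (h n) * of_nat q ^ n - of_real \<kappa>2 * of_nat (h n)"
      by (simp only: coeff[OF that] of_real_diff of_real_mult of_real_power of_real_of_nat_eq)
    finally have eq: "(of_nat (A n) :: complex) = of_real \<kappa>1 * of_nat (h n) * of_nat q ^ n - of_real \<kappa>2 * of_nat (h n)" .
    show ?thesis unfolding eq by (simp add: v_eq power_mult_distrib algebra_simps)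
  qed
  have "(\<lambda>n. of_real \<kappa>1 * (of_nat (h (n + c)) * v s ^ (n + c)) - of_real \<kappa>2 * (of_nat (h (n + c)) * u s ^ (n + c))) sums
      (of_real \<kappa>1 * (numer (v s) / (1 - v s ^ m)) - of_real \<kappa>2 * (numer (u s) / (1 - u s ^ m)))"
    unfolding numer_def by (intro sums_diff sums_mult periodic_power_sums per v1 u1 m)
  then have "(\<lambda>n. of_nat (A (n + c)) * u s ^ (n + c)) sums
      (of_real \<kappa>1 * (numer (v s) / (1 - v s ^ m)) - of_real \<kappa>2 * (numer (u s) / (1 - u s ^ m)))"
    using term_eq by (simp del: of_nat_add)
  from sums_iff_shift[THEN iffD1, OF this]
  have "(\<lambda>n. of_nat (A n) * u s ^ n) sums (of_real \<kappa>1 * (numer (v s) / (1 - v s ^ m)) - of_real \<kappa>2 * (numer (u s) / (1 - u s ^ m)) + head (u s))"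
    unfolding head_def .
  then show "(\<lambda>n. of_nat (A n) * u s ^ n) sums F s" by (simp add: F_def algebra_simps)
  have "summable (\<lambda>n. \<bar>\<kappa>1\<bar> * norm (of_nat (h n) * v s ^ n) + \<bar>\<kappa>2\<bar> * norm (of_nat (h n) * u s ^ n))"
    by (intro summable_add summable_mult periodic_power_sums(2)[where h = h and m = m] per m v1 u1)
  moreover have "norm (norm (of_nat (A n) * u s ^ n)) \<le> \<bar>\<kappa>1\<bar> * norm (of_nat (h n) * v s ^ n) + \<bar>\<kappa>2\<bar> * norm (of_nat (h n) * u s ^ n)"
    if "n \<ge> c" for n
    unfolding real_norm_def abs_norm_cancel term_eq[OF that] by (rule order_trans[OF norm_triangle_ineq4]) (simp add: norm_mult)
  ultimately show "summable (\<lambda>n. norm (of_nat (A n) * u s ^ n))" by (rule summable_comparison_test')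
qed

lemma u_power: "u s ^ m = exp (- (of_real (real m * L) * s))" and v_power: "v s ^ m = exp (of_real (real m * L) * (1 - s))"
  by (simp_all add: u_def v_def mult.assoc flip: exp_of_nat_mult)

text \<open>Spacing of the solutions of \<open>u s ^ m = 1\<close> on their line; the period of
  \<open>u\<close> itself is m \<eta> = 2 pi / ln q.\<close>

definition \<eta> :: real where "\<eta> = 2 * pi / (real m * L)"

lemma \<eta>_pos: "\<eta> > 0"
  using L_pos m by (simp add: \<eta>_def)

lemma
  shows u_power_eq_1: "u s ^ m = 1 \<Longrightarrow> Re s = 0 \<and> (\<exists>k::int. Im s = of_int k * \<eta>)"
    and v_power_eq_1: "v s ^ m = 1 \<Longrightarrow> Re s = 1 \<and> (\<exists>k::int. Im s = of_int k * \<eta>)"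
proof -
  have mL: "real m * L > 0" using m L_pos by simp
  have solve: "y = of_int (- k) * (2 * pi / x)" if "x > 0" "- (x * y) = of_int (2 * k) * pi" for x y and k :: int
    using that by (simp add: field_simps)
  show "Re s = 0 \<and> (\<exists>k::int. Im s = of_int k * \<eta>)" if 1: "u s ^ m = 1"
  proof -
    obtain k :: int where k: "Re s = 0" "- (real m * L * Im s) = of_int (2 * k) * pi"
      using 1 mL unfolding u_power exp_eq_1 by auto
    then have "Im s = of_int (- k) * \<eta>" unfolding \<eta>_def by (intro solve mL)
    then show ?thesis using k by blast
  qed
  show "Re s = 1 \<and> (\<exists>k::int. Im s = of_int k * \<eta>)" if 1: "v s ^ m = 1"
  proof -
    obtain k :: int where k: "Re s = 1" "- (real m * L * Im s) = of_int (2 * k) * pi"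
      using 1 mL unfolding v_power exp_eq_1 by auto
    then have "Im s = of_int (- k) * \<eta>" unfolding \<eta>_def by (intro solve mL)
    then show ?thesis using k by blast
  qed
qed

section \<open>Meromorphic continuation and its poles\<close>

lemma F_meromorphic: "F meromorphic_on UNIV"
  unfolding F_def[abs_def] head_def numer_def u_def v_def
  by (intro meromorphic_intros analytic_on_imp_meromorphic_on analytic_intros)

lemma F_analytic:
  assumes "u s ^ m \<noteq> 1" "v s ^ m \<noteq> 1"
  shows "F analytic_on {s}"
proof -
  have "u analytic_on {s}" "v analytic_on {s}" unfolding u_def[abs_def] v_def[abs_def] by (auto intro!: analytic_intros)
  then show ?thesis
    unfolding F_def[abs_def] head_def numer_def using assms by (auto intro!: analytic_intros)
qed

text \<open>Zeros of the numerators may cancel zeros of the denominators, and at a true pole the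
  convention for division by 0 need not leave the value 0; \<open>remove_sings\<close> repairs
  both.\<close>

definition Z :: "complex \<Rightarrow> complex" where "Z = remove_sings F"

lemma Z_nicely_meromorphic: "Z nicely_meromorphic_on UNIV"
  unfolding Z_def by (rule remove_sings_nicely_meromorphic[OF F_meromorphic])

lemma Z_eq: "u s ^ m \<noteq> 1 \<Longrightarrow> v s ^ m \<noteq> 1 \<Longrightarrow> Z s = F s"
  unfolding Z_def using F_analytic by simp

lemma F_shift: "F (z + \<i> * of_real (real m * \<eta>)) = F z"
proof -
  have m\<eta>: "of_real L * (\<i> * of_real (real m * \<eta>)) = 2 * of_real pi * \<i>"
    using m L_pos by (simp add: \<eta>_def)
  have "u (z + \<i> * of_real (real m * \<eta>)) = exp (- (of_real L * z) - of_real L * (\<i> * of_real (real m * \<eta>)))"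
    by (simp add: u_def algebra_simps)
  also have "\<dots> = u z" unfolding m\<eta> exp_diff by (simp add: u_def)
  finally show ?thesis unfolding F_def v_eq by simp
qed

lemma Z_periodic: "Z (z + \<i> * of_real (real m * \<eta>)) = Z z"
proof -
  let ?w = "\<i> * of_real (real m * \<eta>)"
  have "(\<lambda>x. F (z + ?w + x)) = (\<lambda>x. F (z + x))" using F_shift[of "z + _"] by (simp add: add_ac)
  then show ?thesis
    unfolding Z_def using remove_sings_shift_0[of F "z + ?w"] remove_sings_shift_0[of F z] by (simp only:)
qed

lemma Z_pole:
  assumes "is_pole Z z"
  shows "(Re z = 0 \<or> Re z = 1) \<and> (\<exists>k::int. Im z = of_int k * \<eta>)"
proof -
  have "u z ^ m = 1 \<or> v z ^ m = 1"
  proof (rule ccontr)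
    assume "\<not> ?thesis"
    then have "F analytic_on {z}" by (intro F_analytic) auto
    then have "Z analytic_on {z}" unfolding Z_def by (rule remove_sings_analytic_on)
    then show False using assms analytic_at_imp_no_pole by blast
  qed
  then show ?thesis using u_power_eq_1 v_power_eq_1 by blast
qed

text \<open>Among m consecutive indices one is a multiple of m, where h takes the value h 0 \<ge>
  1.\<close>

lemma numer_1: "numer 1 \<noteq> 0"
proof -
  have hm: "h (k * m) = h 0" for k
  proof (induction k)
    case (Suc k)
    then show ?case using per[of "k * m"] by (simp add: add.commute)
  qed simp
  have "\<exists>j<m. h (c + j) \<noteq> 0"
  proof -
    define j where "j = (m - c mod m) mod m"
    have "(c + j) mod m = 0"
    proof -
      have "(c + j) mod m = (c mod m + (m - c mod m)) mod m" by (simp add: j_def mod_simps)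
      also have "c mod m + (m - c mod m) = m" using m by simp
      finally show ?thesis by simp
    qed
    then have "m dvd c + j" by (simp add: dvd_eq_mod_eq_0)
    then obtain k where "c + j = m * k" by (elim dvdE)
    then have "h (c + j) \<noteq> 0" using hm[of k] h0 by (simp add: mult.commute)
    moreover have "j < m" using m by (simp add: j_def)
    ultimately show ?thesis by blast
  qed
  then have "(\<Sum>j<m. h (c + j)) \<noteq> 0" by auto
  moreover have "numer 1 = of_nat (\<Sum>j<m. h (c + j))" by (simp add: numer_def)
  ultimately show ?thesis by (simp only: of_nat_eq_0_iff) simp
qed

text \<open>At s = 1 the argument \<open>v\<close> equals 1, so the second term of \<open>F\<close>
  has a nonzero numerator over a denominator with an isolated zero, while the terms in
  \<open>u\<close> stay continuous because \<open>u 1 ^ m\<close> differs from 1.\<close>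

lemma Z_pole_1: "is_pole Z 1"
proof -
  have "is_pole (\<lambda>s. of_real \<kappa>1 * numer (v s) / (1 - v s ^ m)) 1"
  proof (rule is_pole_divide)
    show "isCont (\<lambda>s. of_real \<kappa>1 * numer (v s)) 1"
      unfolding numer_def v_def by (intro continuous_intros)
    have "\<kappa>1 \<noteq> 0" using q by (simp add: \<kappa>1_def)
    then show "of_real \<kappa>1 * numer (v 1) \<noteq> 0" using numer_1 by (simp add: v_def)
    show "filterlim (\<lambda>s. 1 - v s ^ m) (at 0) (at 1)"
      unfolding filterlim_at
    proof
      have "isCont (\<lambda>s. 1 - v s ^ m) 1" unfolding v_def by (intro continuous_intros)
      then show "((\<lambda>s. 1 - v s ^ m) \<longlongrightarrow> 0) (at 1)" by (simp add: isCont_def v_def)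
      have "\<forall>\<^sub>F s in at 1. s \<in> ball 1 \<eta> - {1}" using \<eta>_pos by (intro eventually_at_in_open) auto
      then show "\<forall>\<^sub>F s in at 1. 1 - v s ^ m \<in> UNIV \<and> 1 - v s ^ m \<noteq> 0"
      proof eventually_elim
        case (elim s)
        have "v s ^ m \<noteq> 1"
        proof
          assume "v s ^ m = 1"
          then obtain k :: int where k: "Re s = 1" "Im s = of_int k * \<eta>" using v_power_eq_1 by blast
          then have "k \<noteq> 0" using elim by (auto simp: complex_eq_iff)
          then have "1 * \<eta> \<le> \<bar>of_int k\<bar> * \<eta>" using \<eta>_pos by (intro mult_right_mono) auto
          also have "\<dots> = \<bar>Im (s - 1)\<bar>" using k \<eta>_pos by (simp add: abs_mult)
          also have "\<dots> \<le> norm (s - 1)" by (rule abs_Im_le_cmod)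
          finally show False using elim by (simp add: dist_norm norm_minus_commute)
        qed
        then show ?case by auto
      qed
    qed
  qed
  then have lim: "filterlim (\<lambda>s. of_real \<kappa>1 * numer (v s) / (1 - v s ^ m)) at_infinity (at 1)" by (simp add: is_pole_def)
  have "u 1 ^ m \<noteq> 1" using u_power_eq_1[of 1] by auto
  then have "isCont (\<lambda>s. head (u s) - of_real \<kappa>2 * numer (u s) / (1 - u s ^ m)) 1"
    unfolding head_def numer_def u_def by (intro continuous_intros) auto
  then have "((\<lambda>s. head (u s) - of_real \<kappa>2 * numer (u s) / (1 - u s ^ m)) \<longlongrightarrow>
      head (u 1) - of_real \<kappa>2 * numer (u 1) / (1 - u 1 ^ m)) (at 1)" by (simp add: isCont_def)
  from tendsto_add_filterlim_at_infinity[OF this lim]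
  have "is_pole F 1" unfolding is_pole_def F_def by (simp add: algebra_simps)
  moreover have "isolated_singularity_at F 1"
    by (rule meromorphic_on_isolated_singularity[OF meromorphic_on_subset[OF F_meromorphic]]) simp
  ultimately show ?thesis unfolding Z_def by (simp add: is_pole_remove_sings_iff)
qed

lemma numer_bound: "norm w \<le> E \<Longrightarrow> 1 \<le> E \<Longrightarrow> norm (numer w) \<le> real (\<Sum>j<m. h (c + j)) * E ^ (c + m)"
  and head_bound: "norm w \<le> E \<Longrightarrow> 1 \<le> E \<Longrightarrow> norm (head w) \<le> real (\<Sum>n<c. A n) * E ^ (c + m)"
proof -
  have pw: "norm (w ^ n) \<le> E ^ (c + m)" if "norm w \<le> E" "1 \<le> E" "n \<le> c + m" for n
  proof -
    have "norm (w ^ n) \<le> E ^ n" using that by (simp add: norm_power power_mono)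
    also have "\<dots> \<le> E ^ (c + m)" using that by (intro power_increasing) auto
    finally show ?thesis .
  qed
  show "norm (numer w) \<le> real (\<Sum>j<m. h (c + j)) * E ^ (c + m)" if "norm w \<le> E" "1 \<le> E"
    unfolding numer_def of_nat_sum sum_distrib_right
    using pw[OF that] by (intro sum_norm_le) (simp add: norm_mult mult_left_mono)
  show "norm (head w) \<le> real (\<Sum>n<c. A n) * E ^ (c + m)" if "norm w \<le> E" "1 \<le> E"
    unfolding head_def of_nat_sum sum_distrib_right
    using pw[OF that] by (intro sum_norm_le) (simp add: norm_mult mult_left_mono)
qed

text \<open>The moduli of \<open>u\<close> and \<open>v\<close> are at most
  \<open>exp (L * (1 + \<bar>x\<bar>))\<close> for x = Re s, which controls the polynomials
  \<open>head\<close> and \<open>numer\<close>. Each denominator is singular on just one of the two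
  lines and is controlled by the distance to it.\<close>

lemma Z_bound:
  "\<exists>C B. C \<ge> 1 \<and> B \<ge> 0 \<and> (\<forall>s. Re s \<noteq> 0 \<longrightarrow> Re s \<noteq> 1 \<longrightarrow>
      norm (Z s) \<le> C * exp (B * \<bar>Re s\<bar>) * (1 + 1 / \<bar>Re s\<bar>) * (1 + 1 / \<bar>Re s - 1\<bar>))"
proof -
  define a where "a = real (\<Sum>n<c. A n)"
  define b where "b = real (\<Sum>j<m. h (c + j))"
  \<comment> \<open>Absorbs the factor m L from the exponents of the denominators, turning
    \<open>1 + 1 / \<bar>real m * L * t\<bar>\<close> into a multiple of
    \<open>1 + 1 / \<bar>t\<bar>\<close>.\<close>
  define C1 where "C1 = 1 + 1 / (real m * L)"
  define k where "k = c + m"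
  define C where "C = 1 + (a + (\<bar>\<kappa>1\<bar> + \<bar>\<kappa>2\<bar>) * b * C1) * exp (real k * L)"
  have mL: "real m * L > 0" using m L_pos by simp
  have C1: "C1 \<ge> 1" using mL by (simp add: C1_def)
  have ab: "a \<ge> 0" "b \<ge> 0" by (simp_all only: a_def b_def of_nat_0_le_iff)
  have C: "C \<ge> 1" using ab C1 by (simp add: C_def)
  have "norm (Z s) \<le> C * exp (real k * L * \<bar>Re s\<bar>) * (1 + 1 / \<bar>Re s\<bar>) * (1 + 1 / \<bar>Re s - 1\<bar>)"
    if s: "Re s \<noteq> 0" "Re s \<noteq> 1" for s
  proof -
    define x where "x = Re s"
    define E where "E = exp (L * (1 + \<bar>x\<bar>))"
    define X0 where "X0 = 1 + 1 / \<bar>x\<bar>"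
    define X1 where "X1 = 1 + 1 / \<bar>x - 1\<bar>"
    have X: "X0 \<ge> 1" "X1 \<ge> 1" by (simp_all add: X0_def X1_def)
    have E1: "E \<ge> 1" using L_pos by (simp add: E_def)
    have uE: "norm (u s) \<le> E"
    proof -
      have "L * (- x) \<le> L * (1 + \<bar>x\<bar>)" using L_pos by (intro mult_left_mono) auto
      then show ?thesis by (simp add: norm_u E_def x_def)
    qed
    have vE: "norm (v s) \<le> E"
    proof -
      have "L * (1 - x) \<le> L * (1 + \<bar>x\<bar>)" using L_pos by (intro mult_left_mono) auto
      then show ?thesis by (simp add: norm_v E_def x_def)
    qed
    have C1_le: "1 + 1 / \<bar>real m * L * t\<bar> \<le> C1 * (1 + 1 / \<bar>t\<bar>)" for t
    proof -
      have "1 / \<bar>real m * L * t\<bar> = 1 / (real m * L) * (1 / \<bar>t\<bar>)"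
        by (simp add: abs_mult abs_of_pos[OF L_pos])
      moreover have "1 + p * r \<le> (1 + p) * (1 + r)" if "0 \<le> p" "0 \<le> r" for p r :: real
        using that by (simp add: algebra_simps)
      ultimately show ?thesis unfolding C1_def using mL by (metis divide_nonneg_nonneg abs_ge_zero less_imp_le zero_le_one)
    qed
    have d1: "1 / norm (1 - v s ^ m) \<le> C1 * X1"
    proof -
      have "norm (v s ^ m) = exp (real m * L * (1 - x))" unfolding v_power by (simp add: x_def)
      then have "1 / norm (1 - v s ^ m) \<le> 1 + 1 / \<bar>real m * L * (1 - x)\<bar>"
        using mL s m by (intro norm_inverse_one_minus_le) (auto simp: x_def)
      also have "\<dots> \<le> C1 * X1" using C1_le[of "1 - x"] by (simp add: X1_def abs_minus_commute)
      finally show ?thesis .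
    qed
    have d0: "1 / norm (1 - u s ^ m) \<le> C1 * X0"
    proof -
      have "norm (u s ^ m) = exp (real m * L * (- x))" unfolding u_power by (simp add: x_def)
      then have "1 / norm (1 - u s ^ m) \<le> 1 + 1 / \<bar>real m * L * (- x)\<bar>"
        using mL s m by (intro norm_inverse_one_minus_le) (auto simp: x_def)
      also have "\<dots> \<le> C1 * X0" using C1_le[of "- x"] by (simp add: X0_def)
      finally show ?thesis .
    qed
    have XX: "1 \<le> X0 * X1" "X0 \<le> X0 * X1" "X1 \<le> X0 * X1"
      using X mult_mono[of 1 X0 1 X1] by (auto simp: mult_le_cancel_left1 mult_le_cancel_right1)
    have aE: "a * E ^ k \<le> a * E ^ k * (X0 * X1)"
      using mult_left_mono[OF XX(1), of "a * E ^ k"] ab E1 by simp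
    have "Z s = F s" by (rule Z_eq) (use s u_power_eq_1 v_power_eq_1 in blast)+
    also have "norm \<dots> \<le> norm (head (u s)) + norm (of_real \<kappa>1 * numer (v s) / (1 - v s ^ m)) + norm (of_real \<kappa>2 * numer (u s) / (1 - u s ^ m))"
      unfolding F_def by (intro order_trans[OF norm_triangle_ineq4] add_mono norm_triangle_ineq order_refl)
    also have "\<dots> = norm (head (u s)) + \<bar>\<kappa>1\<bar> * (norm (numer (v s)) * (1 / norm (1 - v s ^ m))) + \<bar>\<kappa>2\<bar> * (norm (numer (u s)) * (1 / norm (1 - u s ^ m)))"
      by (simp add: norm_mult norm_divide)
    also have "\<dots> \<le> a * E ^ k + \<bar>\<kappa>1\<bar> * ((b * E ^ k) * (C1 * X1)) + \<bar>\<kappa>2\<bar> * ((b * E ^ k) * (C1 * X0))"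
      unfolding a_def b_def k_def using uE vE E1 d0 d1
      by (intro add_mono mult_left_mono mult_mono numer_bound head_bound) (auto intro!: mult_nonneg_nonneg sum_nonneg)
    also have "\<dots> \<le> a * E ^ k * (X0 * X1) + \<bar>\<kappa>1\<bar> * ((b * E ^ k) * (C1 * (X0 * X1))) + \<bar>\<kappa>2\<bar> * ((b * E ^ k) * (C1 * (X0 * X1)))"
      using XX ab C1 E1 aE by (intro add_mono mult_left_mono mult_nonneg_nonneg) auto
    also have "\<dots> = ((a + (\<bar>\<kappa>1\<bar> + \<bar>\<kappa>2\<bar>) * b * C1) * E ^ k) * (X0 * X1)" by (simp add: algebra_simps)
    also have "E ^ k = exp (real k * L) * exp (real k * L * \<bar>x\<bar>)"
      by (simp add: E_def algebra_simps flip: exp_of_nat_mult exp_add)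
    also have "((a + (\<bar>\<kappa>1\<bar> + \<bar>\<kappa>2\<bar>) * b * C1) * (exp (real k * L) * exp (real k * L * \<bar>x\<bar>))) * (X0 * X1)
        = (C - 1) * (exp (real k * L * \<bar>x\<bar>) * (X0 * X1))" by (simp add: C_def mult_ac)
    also have "\<dots> \<le> C * (exp (real k * L * \<bar>x\<bar>) * (X0 * X1))"
      using X by (intro mult_right_mono mult_nonneg_nonneg) auto
    finally show ?thesis by (simp add: x_def X0_def X1_def mult_ac)
  qed
  then show ?thesis using C L_pos by (intro exI[of _ C] exI[of _ "real k * L"]) auto
qed

lemma nevanlinna_orders_Z: "nevanlinna_order Z = 1 \<and> nevanlinna_lower_order Z = 1"
proof -
  obtain C B where CB: "C \<ge> 1" "B \<ge> 0" "\<And>s. Re s \<noteq> 0 \<Longrightarrow> Re s \<noteq> 1 \<Longrightarrow>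
      norm (Z s) \<le> C * exp (B * \<bar>Re s\<bar>) * (1 + 1 / \<bar>Re s\<bar>) * (1 + 1 / \<bar>Re s - 1\<bar>)"
    using Z_bound by blast
  interpret periodic_meromorphic Z \<eta> C B m
    by unfold_locales (use \<eta>_pos m Z_periodic Z_pole Z_nicely_meromorphic Z_pole_1 CB in \<open>auto simp: nicely_meromorphic_on_def\<close>)
  show ?thesis by (rule nevanlinna_orders)
qed

end

section \<open>The zeta-function\<close>

context
  fixes K :: "'a::field set"
  assumes ff: "function_field K" and fin: "finite K"
begin

text \<open>Absolute convergence permits grouping the divisors by degree; degree n contributes
  \<open>A n\<close> equal terms \<open>u s ^ n\<close>.\<close>

lemma zeta_series_eq:
  fixes A :: "nat \<Rightarrow> nat"
  defines "A \<equiv> \<lambda>n. card {D\<in>positive_divisors K. divisor_degree K D = n}"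
  assumes counts: "divisor_counts (card K) c m G h A"
    and finB: "\<And>n. finite {D\<in>positive_divisors K. divisor_degree K D = n}"
    and s: "Re s > 1"
  shows "zeta_series K s = divisor_counts.F (card K) c m G h A s"
proof -
  interpret divisor_counts "card K" c m G h A by (rule counts)
  define B where "B n = {D\<in>positive_divisors K. divisor_degree K D = n}" for n
  have B: "finite (B n)" "card (B n) = A n" for n using finB by (auto simp: B_def A_def)
  define f where "f x = u s ^ fst x" for x :: "nat \<times> 'a set multiset"
  have term_eq: "1 / of_nat (absolute_norm K D) powr s = u s ^ divisor_degree K D" for D
  proof -
    have "(of_nat (absolute_norm K D) :: complex) = exp (of_nat (divisor_degree K D) * of_real L)"
      using q by (simp add: absolute_norm_def exp_of_nat_mult exp_of_real)
    \<comment> \<open>The norm is a positive real number, so its principal logarithm is the degree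
      times ln q.\<close>
    moreover have "Ln (exp (of_nat (divisor_degree K D) * of_real L)) = of_nat (divisor_degree K D) * of_real L"
      by (rule Ln_exp) (auto simp: pi_gt_zero)
    ultimately have "of_nat (absolute_norm K D) powr s = exp (s * (of_nat (divisor_degree K D) * of_real L))"
      by (simp add: powr_def)
    then have "1 / of_nat (absolute_norm K D) powr s = exp (of_nat (divisor_degree K D) * - (of_real L * s))"
      by (simp add: exp_minus field_simps)
    then show ?thesis by (simp only: u_def exp_of_nat_mult)
  qed
  have bij: "bij_betw snd (Sigma UNIV B) (positive_divisors K)"
    by (rule bij_betwI[of _ _ _ "\<lambda>D. (divisor_degree K D, D)"]) (auto simp: B_def)
  have "zeta_series K s = infsum (\<lambda>D. u s ^ divisor_degree K D) (positive_divisors K)"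
    by (simp add: zeta_series_def term_eq)
  also have "\<dots> = infsum (\<lambda>x. u s ^ divisor_degree K (snd x)) (Sigma UNIV B)"
    by (rule infsum_reindex_bij_betw[OF bij, symmetric])
  also have "\<dots> = infsum f (Sigma UNIV B)"
    by (intro infsum_cong) (auto simp: f_def B_def)
  also have "\<dots> = infsum (\<lambda>n. infsum (\<lambda>D. f (n, D)) (B n)) UNIV"
  proof (rule infsum_Sigma_banach[symmetric])
    have "(\<lambda>x. norm (f x)) summable_on Sigma UNIV B"
      unfolding Infinite_Sum.abs_summable_on_Sigma_iff
    proof (intro conjI ballI)
      show "(\<lambda>D. norm (f (n, D))) summable_on B n" for n using B by simp
      have "summable (\<lambda>n. norm (norm (of_nat (A n) * u s ^ n)))" using count_series_sums(2)[OF s] by simp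
      then have "(\<lambda>n. norm (norm (of_nat (A n) * u s ^ n))) summable_on UNIV"
        by (intro norm_summable_imp_summable_on) simp
      moreover have "infsum (\<lambda>D. norm (f (n, D))) (B n) = norm (of_nat (A n) * u s ^ n)" for n
        using B[of n] by (simp add: f_def norm_mult)
      ultimately show "(\<lambda>n. norm (infsum (\<lambda>D. norm (f (n, D))) (B n))) summable_on UNIV" by simp
    qed
    then show "f summable_on Sigma UNIV B" by (rule abs_summable_summable)
  qed
  also have "\<dots> = infsum (\<lambda>n. of_nat (A n) * u s ^ n) UNIV"
    using B by (intro infsum_cong) (simp add: f_def)
  also have "\<dots> = F s"
    by (rule infsumI, rule norm_summable_imp_has_sum) (use count_series_sums[OF s] in auto)
  finally show ?thesis .
qed

lemma zeta_orders: "nevanlinna_order (zeta K) = 1 \<and> nevanlinna_lower_order (zeta K) = 1"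
proof -
  define A where "A n = card {D\<in>positive_divisors K. divisor_degree K D = n}" for n
  have "(\<forall>n. finite {D\<in>positive_divisors K. divisor_degree K D = n}) \<and> (\<exists>c m G h. divisor_counts (card K) c m G h A)"
  proof (rule divisors_of_degree[OF ff fin], goal_cases)
    case (1 c m G h)
    then have "divisor_counts (card K) c m G h A"
      using card_K_ge_2[OF ff fin] by unfold_locales (auto simp: A_def)
    then show ?case using 1(4) by blast
  qed
  then obtain c m G h where counts: "divisor_counts (card K) c m G h A"
    and finB: "\<And>n. finite {D\<in>positive_divisors K. divisor_degree K D = n}" by blast
  interpret divisor_counts "card K" c m G h A by (rule counts)
  have series: "zeta_series K s = F s" if "Re s > 1" for s
    by (rule zeta_series_eq[OF _ finB that, folded A_def]) (rule counts)
  have Z_series: "Z s = zeta_series K s" if "Re s > 1" for s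
    unfolding series[OF that] by (rule Z_eq) (use that u_power_eq_1 v_power_eq_1 in force)+
  have "zeta K = Z"
    unfolding zeta_def
  proof (rule the_equality)
    show "Z nicely_meromorphic_on UNIV \<and> (\<forall>s. Re s > 1 \<longrightarrow> Z s = zeta_series K s)"
      using Z_nicely_meromorphic Z_series by blast
    fix f assume f: "f nicely_meromorphic_on UNIV \<and> (\<forall>s. Re s > 1 \<longrightarrow> f s = zeta_series K s)"
    show "f = Z"
    proof (rule nicely_meromorphic_unique[of _ _ "{s. Re s > 1}"])
      show "{s. Re s > 1} \<noteq> {}" by (auto intro: exI[of _ 2])
    qed (use f Z_nicely_meromorphic Z_series open_halfspace_Re_gt in auto)
  qed
  then show ?thesis using nevanlinna_orders_Z by simp
qed

end

theorem theorem3: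
  fixes K :: "'a::field set"
  assumes "function_field K" and "finite K"
  shows "nevanlinna_order (zeta K) = 1 \<and> nevanlinna_lower_order (zeta K) = 1"
  by (rule zeta_orders[OF assms])

end
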